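(* Let $T:I\to I$ be a piecewise $C^2$ expanding map satisfying assumptions (A1) and (A2) stated in the context, let $\psi\in BV$, and let $\sigma^2$ and $\sigma^2_{\varepsilon,l}$ be the diffusion coefficient of $\psi$ and its truncated Ulam approximation as defined in the context. Then for any $\tau>0$ there exist an integer $l_*>0$ and a real number $\varepsilon_*>0$ such that $$|\sigma^2_{\varepsilon_*,l_*}-\sigma^2|\le\tau .$$
   Context: $I=[0,1]$, $m$ is Lebesgue measure on $I$, $L^p=L^p(I,m)$, $\|\cdot\|_p$ is the $L^p$ norm. $T:I\to I$ is piecewise $C^2$ and expanding (finitely or countably many branches). Its transfer operator $P:L^1\to L^1$ is defined by $\int_I f\cdot (g\circ T)\,dm=\int_I P(f)\,g\,dm$ for $f\in L^1$, $g\in L^\infty$. For $f\in L^1$, $Vf=\inf\{\mathrm{var}\,\overline f:\overline f=f\text{ a.e.}\}$, where $\mathrm{var}$ is the usual total variation on $[0,1]$; $BV$ is the space of $f\in L^1$ with $Vf<\infty$, with norm $\|f\|_{BV}=Vf+\|f\|_1$. Assumptions. (A1) There exist $\alpha\in(0,1)$ and $B_0\ge0$ such that $VPf\le\alpha Vf+B_0\|f\|_1$ for all $f\in BV$. (A2) $P$, as an operator on $BV$, has $1$ as a simple eigenvalue, and $P$ has no other eigenvalues of modulus one. Under these assumptions $T$ has a unique absolutely continuous invariant probability measure $\nu$, with density $h=d\nu/dm\in BV$. Diffusion coefficient. For $\psi\in BV$ put $\mu=\int_I\psi\,d\nu$, $\hat\psi=\psi-\mu$, and $$\sigma^2=\lim_{n\to\infty}\frac1n\int_I\Big(\sum_{i=0}^{n-1}\psi(T^ix)-n\int_I\psi\,d\nu\Big)^2d\nu=\int_I\hat\psi^2h\,dm+2\sum_{i=1}^\infty\int_IP^i(\hat\psi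 h)\hat\psi\,dm .$$ Ulam's scheme. For each $\varepsilon>0$ let $\eta=\{I_k\}_{k=1}^{d(\eta)}$ be a finite partition of $[0,1]$ into intervals of length at most $\varepsilon$ (the dependence on the choice of $\eta$ is suppressed in the notation). Let $\Pi_\varepsilon f=E(f\mid\mathfrak B_\eta)$ be the conditional expectation with respect to $m$ and the $\sigma$-algebra $\mathfrak B_\eta$ generated by $\eta$, and $P_\varepsilon=\Pi_\varepsilon\circ P\circ\Pi_\varepsilon$. Let $h_\varepsilon\in BV$ be the unique fixed point of $P_\varepsilon$ normalized by $\int_I h_\varepsilon\,dm=1$. Put $\mu_\varepsilon=\int_I\psi h_\varepsilon\,dm$, $\hat\psi_\varepsilon=\psi-\mu_\varepsilon$, and for an integer $l\ge1$ $$\sigma^2_{\varepsilon,l}=\int_I\hat\psi_\varepsilon^2h_\varepsilon\,dm+2\sum_{i=1}^{l-1}\int_IP_\varepsilon^i(\hat\psi_\varepsilon h_\varepsilon)\hat\psi_\varepsilon\,dm .$$ *)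

theory Defs
  imports "HOL-Probability.Probability"
begin

abbreviation leb01 :: "real measure"
  where "leb01 \<equiv> lebesgue_on {0..1}"

text \<open>
  Elements of function spaces are represented by functions and compared almost everywhere.
  The notions below are polymorphic in the scalars, because the eigenvalue condition on the
  transfer operator refers to its action on complex-valued functions of bounded variation,
  while everything else is about real-valued functions.
\<close>

definition L_infinity :: "(real \<Rightarrow> 'a::real_normed_vector) set"
  where "L_infinity = {g. g \<in> borel_measurable leb01 \<and> (\<exists>C. AE x in leb01. norm (g x) \<le> C)}"

text \<open>
  The supremum runs over all finite chains \<open>x 0 \<le> \<dots> \<le> x n\<close> in the unit interval; what the
  monotone sequence \<open>x\<close> does beyond \<open>n\<close> is irrelevant.
\<close>

definition total_var :: "(real \<Rightarrow> 'a::real_normed_vector) \<Rightarrow> ennreal"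
  where "total_var f =
    (SUP n. SUP x\<in>{x::nat \<Rightarrow> real. mono x \<and> range x \<subseteq> {0..1}}.
      \<Sum>i<n. ennreal (norm (f (x (Suc i)) - f (x i))))"

definition ess_var :: "(real \<Rightarrow> 'a::real_normed_vector) \<Rightarrow> ennreal"
  where "ess_var f = (INF g\<in>{g. AE x in leb01. g x = f x}. total_var g)"

definition BV :: "(real \<Rightarrow> 'a::{banach, second_countable_topology}) set"
  where "BV = {f. integrable leb01 f \<and> ess_var f < \<infinity>}"

text \<open>
  The branches are the restrictions of \<open>T\<close> to the members of a finite or countable family of
  disjoint open intervals covering the unit interval up to a null set. On the exceptional null
  set \<open>T\<close> is arbitrary.
\<close>

definition piecewise_C2_expanding :: "(real \<Rightarrow> real) \<Rightarrow> bool"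
  where "piecewise_C2_expanding T \<longleftrightarrow>
    T \<in> {0..1} \<rightarrow> {0..1} \<and>
    (\<exists>\<J> \<theta>. countable \<J> \<and> disjoint \<J> \<and> 1 < \<theta> \<and>
      (\<forall>J\<in>\<J>. open J \<and> is_interval J \<and> J \<subseteq> {0..1}) \<and>
      negligible ({0..1} - \<Union>\<J>) \<and>
      (\<forall>J\<in>\<J>. T differentiable_on J \<and> deriv T differentiable_on J \<and>
        continuous_on J (deriv (deriv T)) \<and> (\<forall>x\<in>J. \<theta> \<le> \<bar>deriv T x\<bar>)))"

text \<open>
  The defining duality determines the transfer operator up to null sets; the choice picks a
  representative. For complex scalars this is the complexification of the real operator.
\<close>

definition transfer_operator ::
    "(real \<Rightarrow> real) \<Rightarrow>
     (real \<Rightarrow> 'a::{real_normed_field, banach, second_countable_topology}) \<Rightarrow> real \<Rightarrow> 'a"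
  where "transfer_operator T f = (SOME F. integrable leb01 F \<and>
    (\<forall>g\<in>L_infinity. (LINT x|leb01. f x * g (T x)) = (LINT x|leb01. F x * g x)))"

definition Lasota_Yorke :: "(real \<Rightarrow> real) \<Rightarrow> bool"
  where "Lasota_Yorke T \<longleftrightarrow>
    (\<exists>\<alpha> B\<^sub>0. 0 < \<alpha> \<and> \<alpha> < 1 \<and> 0 \<le> B\<^sub>0 \<and>
      (\<forall>f::real \<Rightarrow> real. f \<in> BV \<longrightarrow>
        ess_var (transfer_operator T f)
          \<le> ennreal \<alpha> * ess_var f + ennreal (B\<^sub>0 * (LINT x|leb01. \<bar>f x\<bar>))))"

definition BV_eigenvalue :: "((real \<Rightarrow> complex) \<Rightarrow> real \<Rightarrow> complex) \<Rightarrow> complex \<Rightarrow> bool"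
  where "BV_eigenvalue P z \<longleftrightarrow>
    (\<exists>f\<in>BV. \<not> (AE x in leb01. f x = 0) \<and> (AE x in leb01. P f x = z * f x))"

text \<open>
  Simple means of algebraic multiplicity one: the generalized eigenspace, i.e. the union over \<open>k\<close>
  of the kernels of \<open>(P - z)\<^sup>k\<close> on \<open>BV\<close>, is spanned by a single eigenfunction.
\<close>

definition simple_BV_eigenvalue ::
    "((real \<Rightarrow> complex) \<Rightarrow> real \<Rightarrow> complex) \<Rightarrow> complex \<Rightarrow> bool"
  where "simple_BV_eigenvalue P z \<longleftrightarrow>
    (\<exists>f\<in>BV. \<not> (AE x in leb01. f x = 0) \<and> (AE x in leb01. P f x = z * f x) \<and>
      (\<forall>g\<in>BV. \<forall>k. (AE x in leb01. ((\<lambda>u x. P u x - z * u x) ^^ k) g x = 0) \<longrightarrow>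
        (\<exists>c. AE x in leb01. g x = c * f x)))"

definition peripheral_spectrum_trivial :: "(real \<Rightarrow> real) \<Rightarrow> bool"
  where "peripheral_spectrum_trivial T \<longleftrightarrow>
    simple_BV_eigenvalue (transfer_operator T) 1 \<and>
    (\<forall>z. cmod z = 1 \<and> BV_eigenvalue (transfer_operator T) z \<longrightarrow> z = 1)"

definition acim :: "(real \<Rightarrow> real) \<Rightarrow> real measure \<Rightarrow> bool"
  where "acim T \<nu> \<longleftrightarrow>
    prob_space \<nu> \<and> sets \<nu> = sets leb01 \<and> absolutely_continuous leb01 \<nu> \<and>
    (\<forall>A\<in>sets leb01. emeasure \<nu> (T -` A \<inter> {0..1}) = emeasure \<nu> A)"

definition diffusion_coefficient ::
    "(real \<Rightarrow> real) \<Rightarrow> real measure \<Rightarrow> (real \<Rightarrow> real) \<Rightarrow> real"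
  where "diffusion_coefficient T \<nu> \<psi> =
    lim (\<lambda>n. 1 / real n *
      (LINT x|\<nu>. ((\<Sum>i<n. \<psi> ((T ^^ i) x)) - real n * (LINT y|\<nu>. \<psi> y))\<^sup>2))"

definition interval_partition :: "real \<Rightarrow> real set set \<Rightarrow> bool"
  where "interval_partition \<epsilon> \<eta> \<longleftrightarrow>
    finite \<eta> \<and> partition_on {0..1} \<eta> \<and> (\<forall>J\<in>\<eta>. is_interval J \<and> measure leb01 J \<le> \<epsilon>)"

definition ulam_projection :: "real set set \<Rightarrow> (real \<Rightarrow> real) \<Rightarrow> real \<Rightarrow> real"
  where "ulam_projection \<eta> = real_cond_exp leb01 (sigma {0..1} \<eta>)"

definition ulam_operator ::
    "(real \<Rightarrow> real) \<Rightarrow> real set set \<Rightarrow> (real \<Rightarrow> real) \<Rightarrow> real \<Rightarrow> real"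
  where "ulam_operator T \<eta> = ulam_projection \<eta> \<circ> transfer_operator T \<circ> ulam_projection \<eta>"

definition normalized_ulam_fixed_point ::
    "(real \<Rightarrow> real) \<Rightarrow> real set set \<Rightarrow> (real \<Rightarrow> real) \<Rightarrow> bool"
  where "normalized_ulam_fixed_point T \<eta> h \<longleftrightarrow>
    h \<in> BV \<and> (AE x in leb01. ulam_operator T \<eta> h x = h x) \<and> (LINT x|leb01. h x) = 1"

definition unique_ulam_density ::
    "(real \<Rightarrow> real) \<Rightarrow> real set set \<Rightarrow> (real \<Rightarrow> real) \<Rightarrow> bool"
  where "unique_ulam_density T \<eta> h \<longleftrightarrow>
    normalized_ulam_fixed_point T \<eta> h \<and>
    (\<forall>g. normalized_ulam_fixed_point T \<eta> g \<longrightarrow> (AE x in leb01. g x = h x))"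

definition ulam_diffusion ::
    "(real \<Rightarrow> real) \<Rightarrow> real set set \<Rightarrow> (real \<Rightarrow> real) \<Rightarrow> (real \<Rightarrow> real) \<Rightarrow> nat \<Rightarrow> real"
  where "ulam_diffusion T \<eta> h \<psi> l =
    (let \<mu> = (LINT x|leb01. \<psi> x * h x); \<psi>' = (\<lambda>x. \<psi> x - \<mu>)
     in (LINT x|leb01. (\<psi>' x)\<^sup>2 * h x) +
        2 * (\<Sum>i=1..<l. LINT x|leb01.
              (ulam_operator T \<eta> ^^ i) (\<lambda>y. \<psi>' y * h y) x * \<psi>' x))"

end

theory Submission
  imports Defs "HOL-Computational_Algebra.Fundamental_Theorem_Algebra"
begin

text \<open>
  Write \<open>P\<close> for the transfer operator on \<open>L\<^sup>1\<close>, \<open>Q\<close> for one of its Ulam discretizations \<open>\<Pi> P \<Pi>\<close>, and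
  \<open>h\<close> for the invariant density. Both variances are built from autocovariances of the centred
  observable: \<open>\<sigma>\<^sup>2 = c 0 + 2 (c 1 + c 2 + \<dots>)\<close> with \<open>c i = \<integral> P\<^sup>i((\<psi> - \<mu>) h) (\<psi> - \<mu>)\<close>, and the Ulam
  approximation is the same sum with \<open>Q\<close> and its fixed point in place of \<open>P\<close> and \<open>h\<close>, cut off at \<open>l\<close>.
  The series for \<open>\<sigma>\<^sup>2\<close> converges, so a large \<open>l\<close> leaves a tail below \<open>\<tau>/2\<close>. For that \<open>l\<close> only
  finitely many autocovariances remain, and each of them is continuous as the mesh tends to zero.
  The order of the two choices matters: since \<open>l\<close> is fixed first, all that enters about the
  operators \<open>Q\<close> is their convergence to \<open>P\<close> on functions of bounded variation and the convergence
  of their fixed points.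

  Three properties of bounded variation carry the argument. Sets bounded in variation and norm are
  sequentially compact in \<open>L\<^sup>1\<close>, with variation lower semicontinuous (\<open>BV_selection\<close>, from Helly's
  theorem). Averaging over a partition into intervals does not increase the variation, because it
  preserves monotonicity (\<open>step_average_dominated\<close>); so \<open>P\<close> and all \<open>Q\<close> satisfy one and the same
  Lasota-Yorke inequality. Averaging moves a function by at most mesh times variation
  (\<open>step_average_L1_close\<close>); so \<open>Q\<close> is close to \<open>P\<close>, and functionals that are finite in number
  control the norm up to a small multiple of the variation.

  The functional analysis that follows from these properties is developed in the locale
  \<open>bv_space\<close>. Its heart is \<open>iterates_tendsto_0\<close>: if \<open>P\<^sup>n x\<close> does not tend to zero for some \<open>x\<close> of
  integral zero, then a limit point \<open>y\<close> of the orbit generates a finite-dimensional invariant space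
  on which \<open>P\<close> is isometric, so \<open>P\<close> has an eigenvalue of modulus one with an eigenvector of integral
  zero, which the spectral assumption forbids. Compactness upgrades this to uniform and then to
  geometric decay (\<open>iterates_uniformly_small\<close>, \<open>iterates_summable\<close>), whence the series converges,
  and to existence, uniqueness and convergence of the fixed points of \<open>Q\<close>
  (\<open>perturbed_unique_fixed_point\<close>, \<open>perturbed_fixed_points_tendsto\<close>).

  What remains is to realize the setting. An expanding map is nonsingular, so the transfer operator
  exists (\<open>piecewise_expanding_nonsingular\<close>, \<open>transfer_exists_real\<close>). The density of \<open>\<nu>\<close> is only
  known to be integrable; it coincides with the fixed point of bounded variation because functions of
  bounded variation are dense (\<open>BV_dense_L1\<close>, \<open>invariant_L1_eq_BV_invariant\<close>). The limit that
  defines \<open>\<sigma>\<^sup>2\<close> is a Cesaro mean of the partial sums of the series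
  (\<open>diffusion_coefficient_eq_series\<close>).
\<close>

section \<open>Operators with a Lasota-Yorke inequality\<close>

text \<open>
  A further functional \<open>\<phi>\<close> is killed by projecting along some \<open>q\<close> with \<open>\<phi> (L q) = 1\<close>. Multiplying by a
  power of the indeterminate that exceeds the degree of \<open>q\<close> beforehand keeps the map injective. That the
  kernel contains a copy of all polynomials, not just one of them, is what makes the induction go
  through.
\<close>

lemma exists_injective_into_common_kernel:
  fixes \<Phi> :: "(real poly \<Rightarrow> real) set"
  assumes "finite \<Phi>"
    and "\<And>\<phi> p q. \<phi> \<in> \<Phi> \<Longrightarrow> \<phi> (p + q) = \<phi> p + \<phi> q"
    and "\<And>\<phi> c p. \<phi> \<in> \<Phi> \<Longrightarrow> \<phi> (smult c p) = c * \<phi> p"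
  shows "\<exists>L. (\<forall>p q. L (p + q) = L p + L q) \<and> (\<forall>c p. L (smult c p) = smult c (L p)) \<and>
    (\<forall>p. L p = 0 \<longrightarrow> p = 0) \<and> (\<forall>\<phi>\<in>\<Phi>. \<forall>p. \<phi> (L p) = 0)"
  using assms
proof (induction \<Phi> rule: finite_induct)
  case empty
  show ?case by (intro exI[of _ "\<lambda>p. p"]) auto
next
  case (insert \<phi> \<Phi>)
  have "\<exists>L. (\<forall>p q. L (p + q) = L p + L q) \<and> (\<forall>c p. L (smult c p) = smult c (L p)) \<and>
    (\<forall>p. L p = 0 \<longrightarrow> p = 0) \<and> (\<forall>\<phi>\<in>\<Phi>. \<forall>p. \<phi> (L p) = 0)"
    by (rule insert.IH) (simp_all add: insert.prems)
  then obtain L :: "real poly \<Rightarrow> real poly"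
    where L: "\<forall>p q. L (p + q) = L p + L q" "\<forall>c p. L (smult c p) = smult c (L p)"
      "\<forall>p. L p = 0 \<longrightarrow> p = 0" "\<forall>\<phi>\<in>\<Phi>. \<forall>p. \<phi> (L p) = 0"
    by (elim exE conjE)
  note add = L(1)[rule_format] and scale = L(2)[rule_format] and inj = L(3)[rule_format] and ker = L(4)[rule_format]
  have \<phi>_add: "\<phi> (p + q) = \<phi> p + \<phi> q" and \<phi>_scale: "\<phi> (smult c p) = c * \<phi> p" for p q c
    using insert.prems by auto
  show ?case
  proof (cases "\<forall>p. \<phi> (L p) = 0")
    case True
    then show ?thesis using add scale inj ker by (intro exI[of _ L]) auto
  next
    case False
    then obtain q1 where q1: "\<phi> (L q1) \<noteq> 0" by blast
    define q where "q = smult (1 / \<phi> (L q1)) q1"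
    have q: "\<phi> (L q) = 1" using q1 by (simp add: q_def scale \<phi>_scale)
    define M where "M p = monom 1 (Suc (degree q)) * p" for p :: "real poly"
    define N where "N p = M p + smult (- \<phi> (L (M p))) q" for p
    have M_add: "M (p + r) = M p + M r" and M_scale: "M (smult c p) = smult c (M p)" for p r c
      by (simp_all add: M_def ring_distribs)
    have N_add: "N (p + r) = N p + N r" for p r
      by (simp add: N_def M_add add \<phi>_add smult_add_left smult_diff_left)
    have N_scale: "N (smult c p) = smult c (N p)" for p c
      by (simp add: N_def M_scale scale \<phi>_scale smult_add_right smult_diff_right)
    \<comment> \<open>Multiples of \<open>q\<close> are too short to be in the range of \<open>M\<close>.\<close>
    have N_inj: "p = 0" if "N p = 0" for p
    proof (rule ccontr)
      assume "p \<noteq> 0"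
      then have deg: "degree (M p) = Suc (degree q) + degree p"
        unfolding M_def by (subst degree_mult_eq) (auto simp: degree_monom_eq)
      have "M p = smult (\<phi> (L (M p))) q" using that by (simp add: N_def)
      then have "degree (M p) \<le> degree q" by (metis degree_smult_le)
      with deg show False by simp
    qed
    have N_ker: "\<phi> (L (N p)) = 0" for p
      unfolding N_def by (simp add: add \<phi>_add scale \<phi>_scale q del: smult_minus_left)
    show ?thesis
    proof (intro exI[of _ "\<lambda>p. L (N p)"] conjI allI impI ballI)
      show "p = 0" if "L (N p) = 0" for p using that inj N_inj by blast
      show "\<psi> (L (N p)) = 0" if "\<psi> \<in> insert \<phi> \<Phi>" for \<psi> p using that ker N_ker by blast
    qed (simp_all only: N_add N_scale add scale)
  qed
qed

lemma exists_poly_in_common_kernel: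
  fixes \<Phi> :: "(real poly \<Rightarrow> real) set"
  assumes "finite \<Phi>"
    and "\<And>\<phi> p q. \<phi> \<in> \<Phi> \<Longrightarrow> \<phi> (p + q) = \<phi> p + \<phi> q"
    and "\<And>\<phi> c p. \<phi> \<in> \<Phi> \<Longrightarrow> \<phi> (smult c p) = c * \<phi> p"
  shows "\<exists>p. p \<noteq> 0 \<and> (\<forall>\<phi>\<in>\<Phi>. \<phi> p = 0)"
proof -
  have "\<exists>L. (\<forall>p q. L (p + q) = L p + L q) \<and> (\<forall>c p. L (smult c p) = smult c (L p)) \<and>
    (\<forall>p. L p = 0 \<longrightarrow> p = 0) \<and> (\<forall>\<phi>\<in>\<Phi>. \<forall>p. \<phi> (L p) = 0)"
    by (rule exists_injective_into_common_kernel) (simp_all add: assms)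
  then obtain L :: "real poly \<Rightarrow> real poly"
    where L: "\<forall>p. L p = 0 \<longrightarrow> p = 0" "\<forall>\<phi>\<in>\<Phi>. \<forall>p. \<phi> (L p) = 0"
    by (elim exE conjE)
  have "L 1 \<noteq> 0" using L(1) by (metis one_neq_zero)
  with L(2) show ?thesis by (intro exI[of _ "L 1"]) simp
qed

text \<open>
  An abstract \<open>L\<^sup>1\<close> (the whole type) with its functions of bounded variation \<open>B\<close>, the variation \<open>V\<close> and the
  integral \<open>I\<close>. All limits come from \<open>compact\<close>, which combines Helly selection with lower
  semicontinuity of the variation. The assumption \<open>separating\<close> says that
  \<open>B\<close> is finite-dimensional up to a small multiple of the variation.
\<close>

locale bv_space =
  fixes B :: "'a::real_normed_vector set" and V :: "'a \<Rightarrow> real" and I :: "'a \<Rightarrow> real"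
  assumes subspace_B: "subspace B"
    and V_nonneg: "x \<in> B \<Longrightarrow> 0 \<le> V x"
    and V_add: "x \<in> B \<Longrightarrow> y \<in> B \<Longrightarrow> V (x + y) \<le> V x + V y"
    and V_scale: "x \<in> B \<Longrightarrow> V (c *\<^sub>R x) = \<bar>c\<bar> * V x"
    and linear_I: "linear I"
    and I_le: "\<bar>I x\<bar> \<le> norm x"
    and compact: "(\<And>n. X n \<in> B) \<Longrightarrow> (\<And>n::nat. V (X n) \<le> C) \<Longrightarrow> (\<And>n. norm (X n) \<le> D) \<Longrightarrow>
        \<exists>x\<in>B. \<exists>s. strict_mono s \<and> V x \<le> C \<and> (\<lambda>n. X (s n)) \<longlonglongrightarrow> x"
    and separating: "0 < \<delta> \<Longrightarrow> \<exists>\<Phi>::('a \<Rightarrow> real) set. finite \<Phi> \<and> (\<forall>\<phi>\<in>\<Phi>. linear \<phi>) \<and>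
        (\<forall>x\<in>B. (\<forall>\<phi>\<in>\<Phi>. \<phi> x = 0) \<longrightarrow> norm x \<le> \<delta> * V x)"
begin

text \<open>
  Contractions that preserve the integral and satisfy the Lasota-Yorke inequality with constants
  \<open>a\<close> and \<open>b\<close>. The constants are parameters because a transfer operator shares them with all its
  discretizations, which is the source of the uniformity below.
\<close>

definition LY_op :: "real \<Rightarrow> real \<Rightarrow> ('a \<Rightarrow> 'a) \<Rightarrow> bool"
  where "LY_op a b P \<longleftrightarrow> 0 \<le> a \<and> a < 1 \<and> 0 \<le> b \<and> linear P \<and> (\<forall>x. norm (P x) \<le> norm x) \<and> (\<forall>x. I (P x) = I x) \<and>
    (\<forall>x\<in>B. P x \<in> B \<and> V (P x) \<le> a * V x + b * norm x)"

lemma B_closed: "0 \<in> B" "x \<in> B \<Longrightarrow> y \<in> B \<Longrightarrow> x + y \<in> B" "x \<in> B \<Longrightarrow> c *\<^sub>R x \<in> B"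
  "x \<in> B \<Longrightarrow> y \<in> B \<Longrightarrow> x - y \<in> B"
  using subspace_B by (auto simp: subspace_0 subspace_add subspace_scale subspace_diff)

lemma B_sum: "(\<And>i. i \<in> A \<Longrightarrow> f i \<in> B) \<Longrightarrow> sum f A \<in> B"
  using subspace_B by (rule subspace_sum)

lemma V_zero: "V 0 = 0"
  using V_scale[of 0 0] B_closed(1) by simp

lemma V_sum: "(\<And>i. i \<in> A \<Longrightarrow> f i \<in> B) \<Longrightarrow> V (sum f A) \<le> (\<Sum>i\<in>A. V (f i))"
proof (induction A rule: infinite_finite_induct)
  case (insert i A)
  have "V (f i + sum f A) \<le> V (f i) + V (sum f A)" by (intro V_add B_sum insert.prems) auto
  also have "\<dots> \<le> V (f i) + (\<Sum>i\<in>A. V (f i))" using insert by simp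
  finally show ?case using insert by simp
qed (auto simp: V_zero)

lemma V_diff: "x \<in> B \<Longrightarrow> y \<in> B \<Longrightarrow> V (x - y) \<le> V x + V y"
  using V_add[of x "(-1) *\<^sub>R y"] V_scale[of y "-1"] B_closed(3)[of y "-1"] by simp

lemma tendsto_I: "(X \<longlongrightarrow> x) F \<Longrightarrow> ((\<lambda>n. I (X n)) \<longlongrightarrow> I x) F"
proof -
  have "bounded_linear I"
    by (rule linear_conv_bounded_linear[THEN iffD1] | rule bounded_linear_intro[of I 1])
      (use linear_I I_le in \<open>auto simp: linear_add linear_scale\<close>)
  then show "(X \<longlongrightarrow> x) F \<Longrightarrow> ((\<lambda>n. I (X n)) \<longlongrightarrow> I x) F" by (rule bounded_linear.tendsto)
qed

context
  fixes a b :: real and P :: "'a \<Rightarrow> 'a"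
  assumes P: "LY_op a b P"
begin

lemma LY_constants: "0 \<le> a" "a < 1" "0 \<le> b" using P by (auto simp: LY_op_def)

lemma LY_linear: "linear P" using P by (simp add: LY_op_def)
lemma LY_norm: "norm (P x) \<le> norm x" using P by (simp add: LY_op_def)
lemma LY_pres_B: "x \<in> B \<Longrightarrow> P x \<in> B" using P by (simp add: LY_op_def)

lemma LY_iter_linear: "linear (P ^^ n)"
  by (induction n) (use linear_compose[OF _ LY_linear] linear_ident in \<open>auto simp: o_def id_def\<close>)

lemma LY_iter_norm: "norm ((P ^^ n) x) \<le> norm x"
  by (induction n) (auto intro: order_trans[OF LY_norm])

lemma LY_iter_mono: "m \<le> n \<Longrightarrow> norm ((P ^^ n) x) \<le> norm ((P ^^ m) x)"
  by (metis LY_iter_norm funpow_add le_add_diff_inverse2 o_apply)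

lemma LY_iter_I: "I ((P ^^ n) x) = I x"
  using P by (induction n) (auto simp: LY_op_def)

lemma LY_iter_B: "x \<in> B \<Longrightarrow> (P ^^ n) x \<in> B"
  by (induction n) (auto intro: LY_pres_B)

lemma LY_iter_tendsto: "(X \<longlongrightarrow> x) F \<Longrightarrow> ((\<lambda>k. (P ^^ n) (X k)) \<longlongrightarrow> (P ^^ n) x) F"
proof -
  have "bounded_linear (P ^^ n)"
    by (rule bounded_linear_intro[of _ 1])
      (use LY_iter_linear LY_iter_norm in \<open>auto simp: linear_add linear_scale\<close>)
  then show "(X \<longlongrightarrow> x) F \<Longrightarrow> ((\<lambda>k. (P ^^ n) (X k)) \<longlongrightarrow> (P ^^ n) x) F"
    by (rule bounded_linear.tendsto)
qed

lemmas LY_tendsto = LY_iter_tendsto[where n = 1, simplified]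

lemma LY_iter_V:
  assumes x: "x \<in> B"
  shows "V ((P ^^ n) x) \<le> a ^ n * V x + b / (1 - a) * norm x"
proof (induction n)
  case 0
  show ?case using LY_constants by simp
next
  case (Suc n)
  have "V ((P ^^ Suc n) x) \<le> a * V ((P ^^ n) x) + b * norm ((P ^^ n) x)"
    using P LY_iter_B[OF x] by (simp add: LY_op_def)
  also have "\<dots> \<le> a * (a ^ n * V x + b / (1 - a) * norm x) + b * norm x"
    by (intro add_mono mult_left_mono Suc LY_iter_norm LY_constants)
  also have "\<dots> = a ^ Suc n * V x + b / (1 - a) * norm x"
    using LY_constants by (simp add: field_simps)
  finally show ?case .
qed

lemma LY_iter_V_uniform: 
  assumes x: "x \<in> B"
  shows "V ((P ^^ n) x) \<le> V x + b / (1 - a) * norm x"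
proof -
  have "a ^ n * V x \<le> 1 * V x"
    by (intro mult_right_mono power_le_one) (use LY_constants V_nonneg[OF x] in auto)
  then show ?thesis using LY_iter_V[OF x, of n] by simp
qed

text \<open>
  Along the return times the term \<open>a ^ m k * V e\<close> of the iterated inequality dies out. On recurrent
  vectors the variation is therefore controlled by the norm; with \<open>separating\<close> this will make spaces
  of recurrent vectors finite-dimensional.
\<close>

lemma LY_recurrent_V_le:
  assumes e: "e \<in> B" and m: "filterlim m at_top sequentially"
    and lim: "(\<lambda>k. (P ^^ m k) e) \<longlonglongrightarrow> e"
  shows "V e \<le> b / (1 - a) * norm e"
proof (rule field_le_epsilon)
  fix \<delta> :: real assume \<delta>: "0 < \<delta>"
  have "(\<lambda>n. a ^ n * V e) \<longlonglongrightarrow> 0 * V e"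
    by (intro tendsto_mult tendsto_const LIMSEQ_power_zero) (use LY_constants in auto)
  then have "(\<lambda>k. a ^ m k * V e) \<longlonglongrightarrow> 0"
    using m by (auto intro: filterlim_compose)
  then have "\<forall>\<^sub>F k in sequentially. a ^ m k * V e < \<delta>"
    using \<delta> by (auto dest: order_tendstoD(2))
  then obtain N where N: "\<And>k. k \<ge> N \<Longrightarrow> a ^ m k * V e < \<delta>"
    by (auto simp: eventually_sequentially)
  define X where "X k = (P ^^ m (k + N)) e" for k
  obtain x s where x: "V x \<le> b / (1 - a) * norm e + \<delta>" "strict_mono s" "(\<lambda>n. X (s n)) \<longlonglongrightarrow> x"
    using compact[of X "b / (1 - a) * norm e + \<delta>" "norm e"] LY_iter_B[OF e] LY_iter_V[OF e] N LY_iter_norm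
    unfolding X_def by (smt (verit, best) le_add2)
  have "X \<longlonglongrightarrow> e" unfolding X_def using lim by (rule LIMSEQ_ignore_initial_segment)
  then have "(X \<circ> s) \<longlonglongrightarrow> e" using x(2) by (rule LIMSEQ_subseq_LIMSEQ)
  then have "x = e" using x(3) LIMSEQ_unique by (auto simp: o_def)
  then show "V e \<le> b / (1 - a) * norm e + \<delta>" using x(1) by simp
qed

lemma LY_fixed_V_le:
  assumes "e \<in> B" "P e = e"
  shows "V e \<le> b / (1 - a) * norm e"
proof -
  have "(P ^^ n) e = e" for n by (induction n) (auto simp: assms)
  then show ?thesis using LY_recurrent_V_le[OF assms(1), of "\<lambda>n. n"] by (simp add: filterlim_ident)
qed

text \<open>
  The Cesaro means of the orbit stay bounded in variation and are asymptotically invariant, so any of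
  their limit points is a fixed point.
\<close>

lemma LY_fixed_point_exists:
  assumes x: "x \<in> B"
  shows "\<exists>h\<in>B. P h = h \<and> I h = I x \<and> norm h \<le> norm x"
proof -
  define A where "A n = (1 / real (Suc n)) *\<^sub>R (\<Sum>k<Suc n. (P ^^ k) x)" for n
  let ?C = "V x + b / (1 - a) * norm x"
  have AB: "A n \<in> B" for n unfolding A_def by (intro B_closed B_sum LY_iter_B x)
  have AV: "V (A n) \<le> ?C" for n
  proof -
    have "V (A n) = 1 / real (Suc n) * V (\<Sum>k<Suc n. (P ^^ k) x)"
      unfolding A_def by (subst V_scale) (auto intro!: B_closed B_sum LY_iter_B x)
    also have "\<dots> \<le> 1 / real (Suc n) * (\<Sum>k<Suc n. V ((P ^^ k) x))"
      by (intro mult_left_mono V_sum LY_iter_B x) auto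
    also have "\<dots> \<le> 1 / real (Suc n) * (\<Sum>k<Suc n. ?C)"
      by (intro mult_left_mono sum_mono LY_iter_V_uniform x) auto
    also have "\<dots> = ?C" by (simp add: field_simps)
    finally show ?thesis .
  qed
  have Anorm: "norm (A n) \<le> norm x" for n
  proof -
    have "norm (A n) = 1 / real (Suc n) * norm (\<Sum>k<Suc n. (P ^^ k) x)" unfolding A_def by simp
    also have "\<dots> \<le> 1 / real (Suc n) * (\<Sum>k<Suc n. norm ((P ^^ k) x))"
      by (intro mult_left_mono norm_sum) auto
    also have "\<dots> \<le> 1 / real (Suc n) * (\<Sum>k<Suc n. norm x)"
      by (intro mult_left_mono sum_mono LY_iter_norm) auto
    also have "\<dots> = norm x" by (simp add: field_simps)
    finally show ?thesis .
  qed
  have AI: "I (A n) = I x" for n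
    unfolding A_def using linear_I
    by (simp add: linear_scale linear_sum LY_iter_I field_simps del: sum.lessThan_Suc)
  have PA: "P (A n) - A n = (1 / real (Suc n)) *\<^sub>R ((P ^^ Suc n) x - x)" for n
  proof -
    have "P (A n) = (1 / real (Suc n)) *\<^sub>R (\<Sum>k<Suc n. (P ^^ Suc k) x)"
      unfolding A_def using LY_linear by (simp add: linear_scale linear_sum del: sum.lessThan_Suc)
    moreover have "(\<Sum>k<Suc n. (P ^^ Suc k) x) - (\<Sum>k<Suc n. (P ^^ k) x) = (P ^^ Suc n) x - x"
      using sum_lessThan_telescope[of "\<lambda>k. (P ^^ k) x" "Suc n"] by (simp add: sum_subtractf del: sum.lessThan_Suc)
    ultimately show ?thesis unfolding A_def by (metis scaleR_diff_right)
  qed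
  obtain h s where h: "h \<in> B" "strict_mono s" "(\<lambda>n. A (s n)) \<longlonglongrightarrow> h"
    using compact[of A ?C "norm x"] AB AV Anorm by blast
  have "(\<lambda>n. P (A n) - A n) \<longlonglongrightarrow> 0"
  proof (rule Lim_null_comparison)
    show "\<forall>\<^sub>F n in sequentially. norm (P (A n) - A n) \<le> 2 * norm x * (1 / real (Suc n))"
    proof (rule always_eventually, rule allI)
      fix n
      have "norm ((P ^^ Suc n) x - x) \<le> 2 * norm x"
        using LY_iter_norm[of "Suc n" x] norm_triangle_ineq4[of "(P ^^ Suc n) x" x] by linarith
      then have "1 / real (Suc n) * norm ((P ^^ Suc n) x - x) \<le> 1 / real (Suc n) * (2 * norm x)"
        by (intro mult_left_mono) auto
      then show "norm (P (A n) - A n) \<le> 2 * norm x * (1 / real (Suc n))"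
        by (simp add: PA mult.commute del: funpow.simps of_nat_Suc)
    qed
    show "(\<lambda>n. 2 * norm x * (1 / real (Suc n))) \<longlonglongrightarrow> 0"
      using tendsto_mult_right_zero[OF LIMSEQ_inverse_real_of_nat] by (simp add: inverse_eq_divide)
  qed
  then have "((\<lambda>n. P (A n) - A n) \<circ> s) \<longlonglongrightarrow> 0" using h(2) by (rule LIMSEQ_subseq_LIMSEQ)
  moreover have "(\<lambda>n. P (A (s n)) - A (s n)) \<longlonglongrightarrow> P h - h"
    by (intro tendsto_diff LY_tendsto h)
  ultimately have "P h - h = 0" unfolding o_def by (rule LIMSEQ_unique[rotated])
  moreover have "I h = I x"
    using tendsto_I[OF h(3)] by (simp add: AI LIMSEQ_const_iff)
  moreover have "norm h \<le> norm x"
    using tendsto_norm[OF h(3)] Anorm by (intro LIMSEQ_le_const2) auto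
  ultimately show ?thesis using h(1) by auto
qed

end

end

text \<open>
  The vector \<open>p(P) x\<close>, by Horner's scheme.
\<close>

definition poly_apply :: "('a::real_vector \<Rightarrow> 'a) \<Rightarrow> real poly \<Rightarrow> 'a \<Rightarrow> 'a"
  where "poly_apply P p x = fold_coeffs (\<lambda>c y. c *\<^sub>R x + P y) p 0"

lemma poly_apply_pCons:
  assumes "linear P"
  shows "poly_apply P (pCons c p) x = c *\<^sub>R x + P (poly_apply P p x)"
  using assms by (cases "p = 0 \<and> c = 0") (auto simp: poly_apply_def linear_0)

lemma poly_apply_0 [simp]: "poly_apply P 0 x = 0"
  by (simp add: poly_apply_def)

lemma poly_apply_add:
  assumes "linear P"
  shows "poly_apply P (p + q) x = poly_apply P p x + poly_apply P q x"
  by (induction p q rule: poly_induct2)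
    (simp_all add: poly_apply_pCons[OF assms] linear_add[OF assms] algebra_simps)

lemma poly_apply_smult:
  assumes "linear P"
  shows "poly_apply P (smult c p) x = c *\<^sub>R poly_apply P p x"
  by (induction p)
    (simp_all add: poly_apply_pCons[OF assms] linear_scale[OF assms] algebra_simps)

lemma poly_apply_diff:
  assumes "linear P"
  shows "poly_apply P (p - q) x = poly_apply P p x - poly_apply P q x"
  using poly_apply_add[OF assms, of "p - q" q x] by simp

text \<open>
  In complex notation \<open>P w = z w\<close> for \<open>w = u + \<i> v\<close>. If iterating \<open>P\<close> does not change the norms of
  \<open>u\<close> and \<open>v\<close>, then \<open>z ^ n\<close> is bounded above and away from zero, which forces modulus one. Working
  with pairs of real vectors avoids complexifying the space.
\<close>

lemma rotation_modulus_one: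
  fixes u v :: "'a::real_normed_vector"
  assumes P: "linear P"
    and Pu: "P u = Re z *\<^sub>R u - Im z *\<^sub>R v" and Pv: "P v = Im z *\<^sub>R u + Re z *\<^sub>R v"
    and iso: "\<And>n. norm ((P ^^ n) u) = norm u" "\<And>n. norm ((P ^^ n) v) = norm v"
    and nz: "u \<noteq> 0 \<or> v \<noteq> 0"
  shows "cmod z = 1"
proof -
  have pow: "(P ^^ n) u = Re (z ^ n) *\<^sub>R u - Im (z ^ n) *\<^sub>R v \<and>
    (P ^^ n) v = Im (z ^ n) *\<^sub>R u + Re (z ^ n) *\<^sub>R v" for n
  proof (induction n)
    case (Suc n)
    then have U: "(P ^^ n) u = Re (z ^ n) *\<^sub>R u - Im (z ^ n) *\<^sub>R v"
      and V: "(P ^^ n) v = Im (z ^ n) *\<^sub>R u + Re (z ^ n) *\<^sub>R v" by auto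
    have "P ((P ^^ n) u) = Re (z ^ Suc n) *\<^sub>R u - Im (z ^ Suc n) *\<^sub>R v"
      unfolding U by (simp add: linear_diff[OF P] linear_scale[OF P] Pu Pv algebra_simps)
    moreover have "P ((P ^^ n) v) = Im (z ^ Suc n) *\<^sub>R u + Re (z ^ Suc n) *\<^sub>R v"
      unfolding V by (simp add: linear_add[OF P] linear_scale[OF P] Pu Pv algebra_simps)
    ultimately show ?case by simp
  qed simp
  define t where "t = norm u + norm v"
  have t: "t > 0" using nz by (auto simp: t_def add_pos_nonneg add_nonneg_pos)
  have bounds: "1 \<le> 2 * cmod z ^ n \<and> cmod z ^ n \<le> 2" for n
  proof -
    define w where "w = z ^ n"
    have comb: "norm (r *\<^sub>R x + s *\<^sub>R y) \<le> cmod w * (norm x + norm y)"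
      if "\<bar>r\<bar> \<le> cmod w" "\<bar>s\<bar> \<le> cmod w" for r s and x y :: 'a
    proof -
      have "norm (r *\<^sub>R x + s *\<^sub>R y) \<le> \<bar>r\<bar> * norm x + \<bar>s\<bar> * norm y"
        by (metis norm_scaleR norm_triangle_ineq)
      also have "\<dots> \<le> cmod w * norm x + cmod w * norm y"
        by (intro add_mono mult_right_mono that) auto
      finally show ?thesis by (simp add: algebra_simps)
    qed
    have Re: "\<bar>Re w\<bar> \<le> cmod w" and Im: "\<bar>Im w\<bar> \<le> cmod w" by (auto simp: abs_Re_le_cmod abs_Im_le_cmod)
    have Im': "\<bar>- Im w\<bar> \<le> cmod w" using Im by simp
    have U: "(P ^^ n) u = Re w *\<^sub>R u + (- Im w) *\<^sub>R v" and V: "(P ^^ n) v = Im w *\<^sub>R u + Re w *\<^sub>R v"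
      using pow[of n] by (auto simp: w_def)
    have w2: "(cmod w)\<^sup>2 = Re w * Re w + Im w * Im w"
      by (subst cmod_power2) (simp add: power2_eq_square)
    have "norm u \<le> cmod w * t" "norm v \<le> cmod w * t"
      using comb[OF Re Im', of u v] comb[OF Im Re, of u v] U V iso[of n] by (auto simp: t_def)
    then have 1: "t * 1 \<le> t * (2 * cmod w)" by (simp add: t_def algebra_simps)
    \<comment> \<open>Solving for \<open>u\<close> and \<open>v\<close>, that is, multiplying by the conjugate of \<open>w\<close>, gives the upper bound.\<close>
    have "(cmod w)\<^sup>2 *\<^sub>R u = Re w *\<^sub>R (P ^^ n) u + Im w *\<^sub>R (P ^^ n) v"
      unfolding U V w2 by (simp add: algebra_simps)
    then have "(cmod w)\<^sup>2 * norm u \<le> cmod w * t"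
      using comb[OF Re Im, of "(P ^^ n) u" "(P ^^ n) v"] iso by (simp add: t_def) (metis norm_scaleR abs_power2 norm_ge_zero abs_of_nonneg)
    moreover have "(cmod w)\<^sup>2 *\<^sub>R v = (- Im w) *\<^sub>R (P ^^ n) u + Re w *\<^sub>R (P ^^ n) v"
      unfolding U V w2 by (simp add: algebra_simps)
    then have "(cmod w)\<^sup>2 * norm v \<le> cmod w * t"
      using comb[OF Im' Re, of "(P ^^ n) u" "(P ^^ n) v"] iso by (simp add: t_def) (metis norm_scaleR abs_power2 norm_ge_zero abs_of_nonneg)
    ultimately have 2: "(cmod w)\<^sup>2 * t \<le> cmod w * t * 2" by (simp add: t_def algebra_simps)
    have "cmod w \<noteq> 0" using 1 t by auto
    then have "cmod w * t * cmod w \<le> cmod w * t * 2" "cmod w * t > 0"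
      using 2 t by (simp_all add: power2_eq_square algebra_simps)
    then have "cmod w \<le> 2" by (meson mult_le_cancel_left_pos)
    moreover have "1 \<le> 2 * cmod w" using 1 t by (meson mult_le_cancel_left_pos)
    ultimately show ?thesis by (simp add: w_def norm_power)
  qed
  show ?thesis
  proof (rule ccontr)
    assume "cmod z \<noteq> 1"
    then consider "cmod z < 1" | "cmod z > 1" by linarith
    then show False
    proof cases
      case 1
      then obtain n where "cmod z ^ n < 1 / 2" using real_arch_pow_inv[of "1/2"] by auto
      then show False using bounds[of n] by simp
    next
      case 2
      then obtain n where "2 < cmod z ^ n" using real_arch_pow by blast
      then show False using bounds[of n] by simp
    qed
  qed
qed

text \<open>
  A nonzero complex polynomial of least degree that annihilates \<open>y\<close> has a linear factor \<open>X - z\<close>; the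
  complementary factor does not annihilate \<open>y\<close>, and applied to \<open>y\<close> it yields an eigenvector for \<open>z\<close>.
  Real and imaginary parts of coefficients are kept apart, so that only real combinations of the
  orbit occur.
\<close>

lemma real_annihilator_gives_eigenpair:
  fixes P :: "'a::real_vector \<Rightarrow> 'a"
  assumes P: "linear P" and y: "y \<noteq> 0" and p: "p \<noteq> 0" "poly_apply P p y = 0"
  shows "\<exists>z r s. let u = poly_apply P r y; v = poly_apply P s y in
    (u \<noteq> 0 \<or> v \<noteq> 0) \<and> P u = Re z *\<^sub>R u - Im z *\<^sub>R v \<and> P v = Im z *\<^sub>R u + Re z *\<^sub>R v"
proof -
  define R where "R q = poly_apply P (map_poly Re q) y" for q
  define J where "J q = poly_apply P (map_poly Im q) y" for q
  define S where "S = {q. q \<noteq> 0 \<and> R q = 0 \<and> J q = 0}"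
  have "map_poly complex_of_real p \<in> S"
  proof -
    have "map_poly Re (map_poly complex_of_real p) = p" "map_poly Im (map_poly complex_of_real p) = 0"
      by (auto intro!: poly_eqI simp: coeff_map_poly)
    moreover have "map_poly complex_of_real p \<noteq> 0" using p by (simp add: map_poly_eq_0_iff)
    ultimately show ?thesis using p by (simp add: S_def R_def J_def)
  qed
  then obtain q where q: "q \<in> S" and minimal: "\<And>q'. q' \<in> S \<Longrightarrow> degree q \<le> degree q'"
    using arg_min_natI[of "\<lambda>q. q \<in> S" _ degree] arg_min_nat_le[of "\<lambda>q. q \<in> S" _ degree] by metis
  have "degree q \<noteq> 0"
  proof
    assume "degree q = 0"
    then obtain c where c: "q = [:c:]" by (meson degree_eq_zeroE)
    have "map_poly Re [:c:] = [:Re c:]" "map_poly Im [:c:] = [:Im c:]"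
      by (auto intro!: poly_eqI simp: coeff_map_poly coeff_pCons split: nat.split)
    then show False using q y c by (auto simp: S_def R_def J_def poly_apply_pCons[OF P] linear_0[OF P] complex_eq_iff)
  qed
  then obtain z where "poly q z = 0"
    using fundamental_theorem_of_algebra[of q] by (auto simp: constant_degree)
  then obtain r where r: "q = [:- z, 1:] * r" by (metis poly_eq_0_iff_dvd dvdE)
  have "r \<noteq> 0" using r q by (auto simp: S_def)
  then have deg: "degree r < degree q" unfolding r by (subst degree_mult_eq) auto
  have q_eq: "q = pCons 0 r - smult z r" unfolding r by simp
  have "map_poly Re q = pCons 0 (map_poly Re r) - (smult (Re z) (map_poly Re r) - smult (Im z) (map_poly Im r))"
    "map_poly Im q = pCons 0 (map_poly Im r) - (smult (Im z) (map_poly Re r) + smult (Re z) (map_poly Im r))"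
    unfolding q_eq by (auto intro!: poly_eqI simp: coeff_map_poly coeff_pCons split: nat.split)
  then have "R q = P (R r) - (Re z *\<^sub>R R r - Im z *\<^sub>R J r)" "J q = P (J r) - (Im z *\<^sub>R R r + Re z *\<^sub>R J r)"
    unfolding R_def J_def
    by (simp_all add: poly_apply_diff[OF P] poly_apply_add[OF P] poly_apply_smult[OF P] poly_apply_pCons[OF P])
  moreover have "R r \<noteq> 0 \<or> J r \<noteq> 0"
    using minimal[of r] deg \<open>r \<noteq> 0\<close> by (auto simp: S_def)
  ultimately show ?thesis using q unfolding S_def Let_def
    by (intro exI[of _ z] exI[of _ "map_poly Re r"] exI[of _ "map_poly Im r"]) (auto simp: R_def J_def)
qed

context bv_space
begin

text \<open>
  The second conjunct says in real terms that \<open>u + \<i> v\<close> is not an eigenvector for \<open>z\<close>. The first one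
  combines simplicity of the eigenvalue 1 with the fact that its eigenvector has nonzero integral.
\<close>

definition peripherally_trivial :: "('a \<Rightarrow> 'a) \<Rightarrow> bool"
  where "peripherally_trivial P \<longleftrightarrow> (\<forall>x\<in>B. P x = x \<longrightarrow> I x = 0 \<longrightarrow> x = 0) \<and>
    (\<forall>u\<in>B. \<forall>v\<in>B. \<forall>z. cmod z = 1 \<longrightarrow> z \<noteq> 1 \<longrightarrow> P u = Re z *\<^sub>R u - Im z *\<^sub>R v \<longrightarrow>
      P v = Im z *\<^sub>R u + Re z *\<^sub>R v \<longrightarrow> u = 0 \<and> v = 0)"

context
  fixes a b :: real and P :: "'a \<Rightarrow> 'a"
  assumes P: "LY_op a b P" and trivial: "peripherally_trivial P"
begin

lemmas P_linear = LY_linear[OF P]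

text \<open>
  Let \<open>y\<close> be a limit point of the orbit, along times \<open>s k\<close>. The orbit returns to \<open>y\<close> from \<open>y\<close> after
  \<open>m k = s (2 * k) - s k\<close> steps, and so does every vector \<open>p(P) y\<close>. On the space of these recurrent
  vectors \<open>P\<close> is isometric and the variation is bounded by the norm. Hence finitely many functionals
  separate its points, some nonzero polynomial annihilates \<open>y\<close>, and unless \<open>y = 0\<close> there is an
  eigenvector of modulus one and integral zero.
\<close>

lemma iterates_tendsto_0:
  assumes x: "x \<in> B" and Ix: "I x = 0"
  shows "(\<lambda>n. (P ^^ n) x) \<longlonglongrightarrow> 0"
proof -
  obtain y s where y: "y \<in> B" and s: "strict_mono s" and lim: "(\<lambda>k. (P ^^ s k) x) \<longlonglongrightarrow> y"
    using compact[of "\<lambda>n. (P ^^ n) x" "V x + b / (1 - a) * norm x" "norm x"]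
      LY_iter_B[OF P x] LY_iter_V_uniform[OF P x] LY_iter_norm[OF P] by blast
  have Iy: "I y = 0"
    using tendsto_I[OF lim] by (simp add: LY_iter_I[OF P] Ix LIMSEQ_const_iff)
  define m where "m k = s (2 * k) - s k" for k
  have m_ge: "m k \<ge> k" for k
  proof -
    have "s k + j \<le> s (k + j)" for j
      by (induction j) (use s in \<open>auto simp: strict_mono_Suc_iff intro: less_le_trans Suc_leI le_less_trans\<close>)
    from this[of k] show ?thesis by (simp add: m_def mult_2)
  qed
  have m_top: "filterlim m at_top sequentially"
    using m_ge by (intro filterlim_at_top_mono[OF filterlim_ident]) auto
  \<comment> \<open>The recurrent vectors with return times \<open>m\<close>: an invariant subspace that contains \<open>y\<close>.\<close>
  define R where "R = {e \<in> B. (\<lambda>k. (P ^^ m k) e) \<longlonglongrightarrow> e}"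
  have "(\<lambda>k. (P ^^ m k) y - y) \<longlonglongrightarrow> 0"
  proof (rule Lim_null_comparison)
    show "\<forall>\<^sub>F k in sequentially. norm ((P ^^ m k) y - y) \<le> norm (y - (P ^^ s k) x) + norm ((P ^^ s (2 * k)) x - y)"
    proof (rule always_eventually, rule allI)
      fix k
      have "s k \<le> s (2 * k)" using s by (simp add: strict_mono_less_eq)
      then have "(P ^^ s (2 * k)) x = (P ^^ m k) ((P ^^ s k) x)"
        by (simp add: m_def flip: funpow_add[THEN fun_cong, simplified o_def])
      then have "(P ^^ m k) y - y = (P ^^ m k) (y - (P ^^ s k) x) + ((P ^^ s (2 * k)) x - y)"
        using LY_iter_linear[OF P] by (simp add: linear_diff)
      then have "norm ((P ^^ m k) y - y) = norm ((P ^^ m k) (y - (P ^^ s k) x) + ((P ^^ s (2 * k)) x - y))"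
        by (rule arg_cong)
      also have "\<dots> \<le> norm ((P ^^ m k) (y - (P ^^ s k) x)) + norm ((P ^^ s (2 * k)) x - y)"
        by (rule norm_triangle_ineq)
      also have "\<dots> \<le> norm (y - (P ^^ s k) x) + norm ((P ^^ s (2 * k)) x - y)"
        by (intro add_right_mono LY_iter_norm[OF P])
      finally show "norm ((P ^^ m k) y - y) \<le> norm (y - (P ^^ s k) x) + norm ((P ^^ s (2 * k)) x - y)" .
    qed
    have "(\<lambda>k. (P ^^ s (2 * k)) x) \<longlonglongrightarrow> y"
      using LIMSEQ_subseq_LIMSEQ[OF lim, of "\<lambda>k. 2 * k"] by (auto simp: o_def strict_mono_def)
    then have "(\<lambda>k. norm (y - (P ^^ s k) x) + norm ((P ^^ s (2 * k)) x - y)) \<longlonglongrightarrow> norm (y - y) + norm (y - y)"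
      by (intro tendsto_intros lim)
    then show "(\<lambda>k. norm (y - (P ^^ s k) x) + norm ((P ^^ s (2 * k)) x - y)) \<longlonglongrightarrow> 0" by simp
  qed
  then have yR: "y \<in> R" using y by (simp add: R_def LIM_zero_iff)
  have R_zero: "0 \<in> R" by (simp add: R_def B_closed linear_0[OF LY_iter_linear[OF P]])
  have R_comb: "c *\<^sub>R e + f \<in> R" if "e \<in> R" "f \<in> R" for c e f
    using that unfolding R_def
    by (auto intro!: B_closed tendsto_intros
        simp: linear_add[OF LY_iter_linear[OF P]] linear_scale[OF LY_iter_linear[OF P]])
  have R_P: "P e \<in> R" if "e \<in> R" for e
    using that LY_tendsto[OF P, of "\<lambda>k. (P ^^ m k) e" e sequentially] LY_pres_B[OF P]
    by (auto simp: R_def funpow_swap1)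
  have R_poly: "poly_apply P q y \<in> R" for q
    by (induction q) (auto simp: poly_apply_pCons[OF P_linear] R_zero intro!: R_comb yR R_P)
  have I_poly: "I (poly_apply P q y) = 0" for q
    using P by (induction q)
      (auto simp: poly_apply_pCons[OF P_linear] linear_add[OF linear_I] linear_scale[OF linear_I]
        linear_0[OF linear_I] Iy LY_op_def)
  have R_V: "V e \<le> b / (1 - a) * norm e" if "e \<in> R" for e
    using that LY_recurrent_V_le[OF P _ m_top] by (auto simp: R_def)
  \<comment> \<open>Norms cannot increase along an orbit, and on \<open>R\<close> they come back.\<close>
  have R_iso1: "norm (P e) = norm e" if "e \<in> R" for e
  proof (rule antisym)
    show "norm e \<le> norm (P e)"
    proof (rule LIMSEQ_le_const2[OF tendsto_norm])
      show "(\<lambda>k. (P ^^ m k) e) \<longlonglongrightarrow> e" using that by (simp add: R_def)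
      show "\<exists>N. \<forall>k\<ge>N. norm ((P ^^ m k) e) \<le> norm (P e)"
        using LY_iter_mono[OF P, of 1 _ e] m_ge by (intro exI[of _ 1]) (auto intro: order_trans)
    qed
  qed (rule LY_norm[OF P])
  have R_iter: "(P ^^ n) e \<in> R \<and> norm ((P ^^ n) e) = norm e" if "e \<in> R" for e n
    by (induction n) (use that R_P R_iso1 in auto)
  have "y = 0"
  proof (rule ccontr)
    assume y0: "y \<noteq> 0"
    define K where "K = b / (1 - a)"
    have K: "0 \<le> K" using LY_constants[OF P] by (simp add: K_def)
    obtain \<Phi> :: "('a \<Rightarrow> real) set" where \<Phi>: "finite \<Phi>" "\<forall>\<phi>\<in>\<Phi>. linear \<phi>"
      and sep: "\<forall>x\<in>B. (\<forall>\<phi>\<in>\<Phi>. \<phi> x = 0) \<longrightarrow> norm x \<le> 1 / (2 * (K + 1)) * V x"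
      using separating[of "1 / (2 * (K + 1))"] K by auto
    define \<Psi> where "\<Psi> = (\<lambda>\<phi> q. \<phi> (poly_apply P q y)) ` \<Phi>"
    have "\<exists>p. p \<noteq> 0 \<and> (\<forall>\<psi>\<in>\<Psi>. \<psi> p = 0)"
      by (rule exists_poly_in_common_kernel)
        (use \<Phi> in \<open>auto simp: \<Psi>_def poly_apply_add[OF P_linear] poly_apply_smult[OF P_linear] linear_add linear_scale\<close>)
    then obtain p where p: "p \<noteq> 0" "\<And>\<psi>. \<psi> \<in> \<Psi> \<Longrightarrow> \<psi> p = 0" by blast
    define e where "e = poly_apply P p y"
    have eR: "e \<in> R" by (simp add: e_def R_poly)
    have "norm e \<le> 1 / (2 * (K + 1)) * V e"
      using sep p(2) eR by (auto simp: \<Psi>_def e_def R_def)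
    also have "\<dots> \<le> 1 / (2 * (K + 1)) * (K * norm e)"
      using R_V[OF eR] K by (intro mult_left_mono) (auto simp: K_def)
    also have "\<dots> \<le> 1 / 2 * norm e"
      using K by (simp add: field_simps)
    finally have "e = 0" by simp
    then obtain z q r where u: "poly_apply P q y \<noteq> 0 \<or> poly_apply P r y \<noteq> 0"
      and Pu: "P (poly_apply P q y) = Re z *\<^sub>R poly_apply P q y - Im z *\<^sub>R poly_apply P r y"
      and Pv: "P (poly_apply P r y) = Im z *\<^sub>R poly_apply P q y + Re z *\<^sub>R poly_apply P r y"
      using real_annihilator_gives_eigenpair[OF P_linear y0 p(1)] unfolding e_def Let_def by blast
    have z: "cmod z = 1"
      by (rule rotation_modulus_one[OF P_linear Pu Pv _ _ u]) (use R_iter R_poly in auto)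
    have mem: "poly_apply P q y \<in> B" for q using R_poly by (auto simp: R_def)
    show False
    proof (cases "z = 1")
      case True
      then show False using u Pu Pv trivial mem I_poly by (auto simp: peripherally_trivial_def)
    next
      case False
      have "\<forall>u\<in>B. \<forall>v\<in>B. \<forall>z. cmod z = 1 \<longrightarrow> z \<noteq> 1 \<longrightarrow> P u = Re z *\<^sub>R u - Im z *\<^sub>R v \<longrightarrow>
          P v = Im z *\<^sub>R u + Re z *\<^sub>R v \<longrightarrow> u = 0 \<and> v = 0"
        using trivial by (simp add: peripherally_trivial_def)
      from this[rule_format, OF mem mem z False Pu Pv] show False using u by simp
    qed
  qed
  show ?thesis
  proof (rule LIMSEQ_I)
    fix \<delta> :: real assume "0 < \<delta>"
    then obtain k where "norm ((P ^^ s k) x) < \<delta>"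
      using LIMSEQ_D[OF lim, of \<delta>] \<open>y = 0\<close> by auto
    then show "\<exists>N. \<forall>n\<ge>N. norm ((P ^^ n) x - 0) < \<delta>"
      using LY_iter_mono[OF P, of "s k" _ x] by (intro exI[of _ "s k"]) (auto intro: le_less_trans)
  qed
qed

text \<open>
  Contractions that tend to zero pointwise do so uniformly on compact sets, here on the vectors of
  integral zero in a ball of \<open>V + norm\<close>.
\<close>

lemma iterates_uniformly_small:
  assumes \<delta>: "0 < \<delta>"
  shows "\<exists>n. \<forall>x\<in>B. I x = 0 \<longrightarrow> norm ((P ^^ n) x) \<le> \<delta> * (V x + norm x)"
proof (rule ccontr)
  assume "\<nexists>n. \<forall>x\<in>B. I x = 0 \<longrightarrow> norm ((P ^^ n) x) \<le> \<delta> * (V x + norm x)"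
  then have "\<forall>n. \<exists>x. x \<in> B \<and> I x = 0 \<and> \<delta> * (V x + norm x) < norm ((P ^^ n) x)" by (auto simp: not_le)
  then obtain X where X: "\<And>n. X n \<in> B" "\<And>n. I (X n) = 0"
    "\<And>n. \<delta> * (V (X n) + norm (X n)) < norm ((P ^^ n) (X n))" by metis
  define W where "W n = V (X n) + norm (X n)" for n
  have W: "0 < W n" for n
  proof -
    have "X n \<noteq> 0" using X(3)[of n] LY_iter_norm[OF P, of n 0] by (auto simp: V_zero)
    then show ?thesis using V_nonneg[OF X(1)[of n]] by (simp add: W_def add_nonneg_pos)
  qed
  define Y where "Y n = (1 / W n) *\<^sub>R X n" for n
  have Y: "Y n \<in> B" "I (Y n) = 0" for n
    using X by (auto simp: Y_def B_closed linear_scale[OF linear_I])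
  have "V (Y n) + norm (Y n) = 1" for n
  proof -
    have "V (Y n) = 1 / W n * V (X n)" "norm (Y n) = 1 / W n * norm (X n)"
      using W[of n] V_scale[OF X(1)[of n], of "1 / W n"] by (simp_all add: Y_def)
    then have "V (Y n) + norm (Y n) = 1 / W n * W n" by (simp add: W_def distrib_left add_divide_distrib)
    then show ?thesis using W[of n] by simp
  qed
  then have VY: "V (Y n) \<le> 1" "norm (Y n) \<le> 1" for n
    using V_nonneg[OF Y(1)[of n]] by (metis add_increasing le_numeral_extra(4) norm_ge_zero add_increasing2 order_refl)+
  have big: "\<delta> < norm ((P ^^ n) (Y n))" for n
    using X(3)[of n] W[of n] by (simp add: Y_def linear_scale[OF LY_iter_linear[OF P]] field_simps W_def)
  obtain x s where x: "x \<in> B" "strict_mono s" "(\<lambda>n. Y (s n)) \<longlonglongrightarrow> x"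
    using compact[of Y 1 1] Y VY by blast
  have "I x = 0" using tendsto_I[OF x(3)] by (simp add: Y LIMSEQ_const_iff)
  then have "(\<lambda>n. (P ^^ n) x) \<longlonglongrightarrow> 0" by (rule iterates_tendsto_0[OF x(1)])
  then have "(\<lambda>n. (P ^^ s n) x) \<longlonglongrightarrow> 0"
    using LIMSEQ_subseq_LIMSEQ[OF _ x(2)] by (auto simp: o_def)
  then have "(\<lambda>n. norm ((P ^^ s n) x) + norm (Y (s n) - x)) \<longlonglongrightarrow> norm (0::'a) + norm (x - x)"
    by (intro tendsto_intros x)
  then have "\<forall>\<^sub>F n in sequentially. norm ((P ^^ s n) x) + norm (Y (s n) - x) < \<delta>"
    using \<delta> by (auto dest: order_tendstoD(2))
  then obtain n where n: "norm ((P ^^ s n) x) + norm (Y (s n) - x) < \<delta>"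
    by (auto simp: eventually_sequentially)
  have "(P ^^ s n) (Y (s n)) = (P ^^ s n) x + (P ^^ s n) (Y (s n) - x)"
    by (simp add: linear_diff[OF LY_iter_linear[OF P]])
  then have "norm ((P ^^ s n) (Y (s n))) \<le> norm ((P ^^ s n) x) + norm (Y (s n) - x)"
    using LY_iter_norm[OF P, of "s n" "Y (s n) - x"]
      norm_triangle_ineq[of "(P ^^ s n) x" "(P ^^ s n) (Y (s n) - x)"] by simp
  then show False using n big[of "s n"] by simp
qed

text \<open>
  After \<open>m\<close> steps the norm is small, and \<open>n\<close> further steps make the variation small too. So a fixed
  number \<open>N\<close> of steps halves \<open>V + norm\<close>, and the decay is geometric.
\<close>

lemma iterates_summable:
  assumes x: "x \<in> B" and Ix: "I x = 0"
  shows "summable (\<lambda>n. norm ((P ^^ n) x))"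
proof -
  define K where "K = b / (1 - a)"
  define W where "W y = V y + norm y" for y
  have K: "0 \<le> K" using LY_constants[OF P] by (simp add: K_def)
  obtain m where m: "\<And>y. y \<in> B \<Longrightarrow> I y = 0 \<Longrightarrow> norm ((P ^^ m) y) \<le> 1 / (4 * (K + 1)) * W y"
    using iterates_uniformly_small[of "1 / (4 * (K + 1))"] K by (auto simp: W_def)
  have "(\<lambda>n. a ^ n) \<longlonglongrightarrow> 0" using LY_constants[OF P] by (intro LIMSEQ_power_zero) auto
  then have "\<forall>\<^sub>F n in sequentially. a ^ n < 1 / (4 * (K + 1))"
    using K by (auto intro: order_tendstoD(2))
  then obtain n where n: "a ^ n < 1 / (4 * (K + 1))" by (auto simp: eventually_sequentially)
  define N where "N = Suc (n + m)"
  have W0: "0 \<le> W y" if "y \<in> B" for y using V_nonneg[OF that] by (simp add: W_def)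
  have half: "W ((P ^^ N) y) \<le> 1 / 2 * W y" if y: "y \<in> B" and Iy: "I y = 0" for y
  proof -
    \<comment> \<open>The exponents add up to \<open>N\<close>, which is a successor so that blocks of length \<open>N\<close> are nonempty.\<close>
    have a': "a ^ Suc n \<le> 1 / (4 * (K + 1))"
      using n LY_constants[OF P] by (simp add: mult_le_cancel_right1 order_trans[OF mult_left_le_one_le])
    have "(P ^^ N) y = (P ^^ Suc n) ((P ^^ m) y)" by (simp add: N_def funpow_add)
    then have "V ((P ^^ N) y) \<le> a ^ Suc n * V ((P ^^ m) y) + K * norm ((P ^^ m) y)"
      using LY_iter_V[OF P LY_iter_B[OF P y], of "Suc n" m] by (simp add: K_def)
    also have "\<dots> \<le> 1 / (4 * (K + 1)) * (V y + K * norm y) + K * (1 / (4 * (K + 1)) * W y)"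
      using a' LY_iter_V_uniform[OF P y, of m] m[OF y Iy] K V_nonneg[OF LY_iter_B[OF P y]]
      by (intro add_mono mult_mono) (auto simp: K_def)
    also have "\<dots> \<le> 1 / (4 * (K + 1)) * ((K + 1) * W y) + K * (1 / (4 * (K + 1)) * W y)"
      using K V_nonneg[OF y] by (intro add_right_mono mult_left_mono) (auto simp: W_def algebra_simps)
    finally have 1: "V ((P ^^ N) y) \<le> 1 / (4 * (K + 1)) * ((2 * K + 1) * W y)"
      by (simp add: algebra_simps add_divide_distrib)
    have "norm ((P ^^ N) y) \<le> norm ((P ^^ m) y)" by (rule LY_iter_mono[OF P]) (simp add: N_def)
    also have "\<dots> \<le> 1 / (4 * (K + 1)) * W y" by (rule m[OF y Iy])
    finally have "W ((P ^^ N) y) \<le> 1 / (4 * (K + 1)) * ((2 * K + 1) * W y) + 1 / (4 * (K + 1)) * W y"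
      using 1 by (simp add: W_def)
    also have "\<dots> = 1 / (4 * (K + 1)) * (2 * (K + 1)) * W y"
      by (simp add: ring_distribs)
    also have "1 / (4 * (K + 1)) * (2 * (K + 1)) = 1 / 2" using K by (simp add: divide_simps)
    finally show ?thesis .
  qed
  have block: "norm ((P ^^ (q * N + r)) x) \<le> (1 / 2) ^ q * W x" for q r
  proof -
    have "W ((P ^^ (q * N)) x) \<le> (1 / 2) ^ q * W x"
    proof (induction q)
      case (Suc q)
      have "W ((P ^^ (Suc q * N)) x) = W ((P ^^ N) ((P ^^ (q * N)) x))" by (simp add: funpow_add)
      also have "\<dots> \<le> 1 / 2 * W ((P ^^ (q * N)) x)"
        by (rule half) (auto simp: LY_iter_B[OF P x] LY_iter_I[OF P] Ix)
      also have "\<dots> \<le> 1 / 2 * ((1 / 2) ^ q * W x)" using Suc by simp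
      finally show ?case by simp
    qed simp
    moreover have "norm ((P ^^ (q * N + r)) x) \<le> norm ((P ^^ (q * N)) x)"
      by (rule LY_iter_mono[OF P]) simp
    moreover have "norm ((P ^^ (q * N)) x) \<le> W ((P ^^ (q * N)) x)"
      using V_nonneg[OF LY_iter_B[OF P x]] by (simp add: W_def)
    ultimately show ?thesis by linarith
  qed
  \<comment> \<open>Blocks of length \<open>N\<close> turn the geometric decay along multiples of \<open>N\<close> into a bound on all partial sums.\<close>
  show ?thesis
  proof (rule bounded_imp_summable)
    show "0 \<le> norm ((P ^^ n) x)" for n by simp
    show "(\<Sum>k\<le>n. norm ((P ^^ k) x)) \<le> 2 * real N * W x" for n
    proof -
      have "(\<Sum>k\<le>n. norm ((P ^^ k) x)) \<le> (\<Sum>k<Suc n * N. norm ((P ^^ k) x))"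
        by (intro sum_mono2) (auto simp: N_def)
      also have "\<dots> = (\<Sum>q<Suc n. \<Sum>k\<in>{q * N..<q * N + N}. norm ((P ^^ k) x))"
        by (rule sum.nat_group[symmetric])
      also have "\<dots> \<le> (\<Sum>q<Suc n. \<Sum>k\<in>{q * N..<q * N + N}. (1 / 2) ^ q * W x)"
      proof (intro sum_mono)
        fix q k assume "k \<in> {q * N..<q * N + N}"
        then show "norm ((P ^^ k) x) \<le> (1 / 2) ^ q * W x"
          using block[of q "k - q * N"] by simp
      qed
      also have "\<dots> = real N * W x * (\<Sum>q<Suc n. (1 / 2) ^ q)"
        by (simp add: sum_distrib_left mult_ac del: sum.lessThan_Suc)
      also have "\<dots> \<le> real N * W x * 2"
      proof (intro mult_left_mono)
        show "(\<Sum>q<Suc n. (1 / 2 :: real) ^ q) \<le> 2"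
          by (subst sum_gp_strict) (simp add: field_simps)
      qed (use W0[OF x] in auto)
      finally show ?thesis by (simp add: mult_ac)
    qed
  qed
qed

end

text \<open>
  A sequence of perturbations \<open>Q k\<close> that share the Lasota-Yorke constants of \<open>P\<close> and converge to it as
  operators from \<open>B\<close>, normed by \<open>V + norm\<close>, to \<open>L\<^sup>1\<close>.
\<close>

context
  fixes a b :: real and P :: "'a \<Rightarrow> 'a" and Q :: "nat \<Rightarrow> 'a \<Rightarrow> 'a" and \<kappa> :: "nat \<Rightarrow> real"
  assumes P: "LY_op a b P" and Q: "\<And>k. LY_op a b (Q k)"
    and close: "\<And>k x. x \<in> B \<Longrightarrow> norm (Q k x - P x) \<le> \<kappa> k * (V x + norm x)"
    and \<kappa>0: "\<And>k. 0 \<le> \<kappa> k" and \<kappa>: "\<kappa> \<longlonglongrightarrow> 0"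
begin

lemma perturbed_iterates_close:
  assumes x: "x \<in> B"
  shows "norm ((Q k ^^ n) x - (P ^^ n) x) \<le> real n * (\<kappa> k * ((1 + b / (1 - a)) * (V x + norm x)))"
proof (induction n)
  case (Suc n)
  define y where "y = (P ^^ n) x"
  have K: "0 \<le> b / (1 - a)" using LY_constants[OF P] by simp
  have "(Q k ^^ Suc n) x - (P ^^ Suc n) x = Q k ((Q k ^^ n) x - y) + (Q k y - P y)"
    by (simp add: y_def linear_diff[OF LY_linear[OF Q]])
  then have "norm ((Q k ^^ Suc n) x - (P ^^ Suc n) x) \<le> norm (Q k ((Q k ^^ n) x - y)) + norm (Q k y - P y)"
    by (metis norm_triangle_ineq)
  also have "\<dots> \<le> norm ((Q k ^^ n) x - y) + \<kappa> k * (V y + norm y)"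
    by (intro add_mono LY_norm[OF Q] close) (simp add: y_def LY_iter_B[OF P x])
  also have "\<dots> \<le> real n * (\<kappa> k * ((1 + b / (1 - a)) * (V x + norm x))) + \<kappa> k * ((1 + b / (1 - a)) * (V x + norm x))"
  proof (intro add_mono mult_left_mono \<kappa>0)
    show "norm ((Q k ^^ n) x - y) \<le> real n * (\<kappa> k * ((1 + b / (1 - a)) * (V x + norm x)))"
      using Suc by (simp add: y_def)
    have "V y + norm y \<le> V x + b / (1 - a) * norm x + norm x"
      unfolding y_def by (intro add_mono LY_iter_V_uniform[OF P x] LY_iter_norm[OF P])
    also have "\<dots> \<le> (1 + b / (1 - a)) * (V x + norm x)"
      using mult_nonneg_nonneg[OF K V_nonneg[OF x]] by (simp add: ring_distribs)
    finally show "V y + norm y \<le> (1 + b / (1 - a)) * (V x + norm x)" .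
  qed
  finally show ?case unfolding of_nat_Suc distrib_right by simp
qed simp

lemma perturbed_iterates_tendsto:
  assumes x: "x \<in> B" and X: "X \<longlonglongrightarrow> x"
  shows "(\<lambda>k. (Q k ^^ n) (X k)) \<longlonglongrightarrow> (P ^^ n) x"
proof (rule LIM_zero_cancel, rule Lim_null_comparison)
  let ?c = "(1 + b / (1 - a)) * (V x + norm x)"
  show "\<forall>\<^sub>F k in sequentially. norm ((Q k ^^ n) (X k) - (P ^^ n) x) \<le> norm (X k - x) + real n * (\<kappa> k * ?c)"
  proof (rule always_eventually, rule allI)
    fix k
    have "(Q k ^^ n) (X k) - (P ^^ n) x = (Q k ^^ n) (X k - x) + ((Q k ^^ n) x - (P ^^ n) x)"
      by (simp add: linear_diff[OF LY_iter_linear[OF Q]])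
    then have "norm ((Q k ^^ n) (X k) - (P ^^ n) x) \<le> norm ((Q k ^^ n) (X k - x)) + norm ((Q k ^^ n) x - (P ^^ n) x)"
      by (metis norm_triangle_ineq)
    also have "\<dots> \<le> norm (X k - x) + real n * (\<kappa> k * ?c)"
      by (intro add_mono LY_iter_norm[OF Q] perturbed_iterates_close[OF x])
    finally show "norm ((Q k ^^ n) (X k) - (P ^^ n) x) \<le> norm (X k - x) + real n * (\<kappa> k * ?c)" .
  qed
  have "(\<lambda>k. norm (X k - x) + real n * (\<kappa> k * ?c)) \<longlonglongrightarrow> norm (x - x) + real n * (0 * ?c)"
    by (intro tendsto_intros X \<kappa>)
  then show "(\<lambda>k. norm (X k - x) + real n * (\<kappa> k * ?c)) \<longlonglongrightarrow> 0" by simp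
qed

context
  assumes trivial: "peripherally_trivial P"
begin

text \<open>
  For fixed points \<open>x - g = (Q\<^sup>n x - P\<^sup>n x) + P\<^sup>n (x - g)\<close>. The second summand is small for a suitable
  \<open>n\<close> because \<open>x - g\<close> has integral zero, and for that \<open>n\<close> the first one is small when \<open>k\<close> is large.
  The case \<open>g = 0\<close> will give uniqueness of the fixed point of \<open>Q k\<close>, and the case of the invariant
  density will give convergence.
\<close>

lemma perturbed_fixed_points_close:
  assumes \<delta>: "0 < \<delta>"
  shows "\<forall>\<^sub>F k in sequentially. \<forall>g\<in>B. \<forall>x\<in>B. P g = g \<longrightarrow> Q k x = x \<longrightarrow> I x = I g \<longrightarrow>
    norm (x - g) \<le> \<delta> * (norm x + norm g)"
proof -
  define K where "K = b / (1 - a)"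
  have K: "0 \<le> K" using LY_constants[OF P] by (simp add: K_def)
  obtain n where n: "\<And>x. x \<in> B \<Longrightarrow> I x = 0 \<Longrightarrow> norm ((P ^^ n) x) \<le> \<delta> / (2 * (1 + K)) * (V x + norm x)"
    using iterates_uniformly_small[OF P trivial, of "\<delta> / (2 * (1 + K))"] \<delta> K by auto
  have "(\<lambda>k. real n * (\<kappa> k * ((1 + K) * (1 + K)))) \<longlonglongrightarrow> real n * (0 * ((1 + K) * (1 + K)))"
    by (intro tendsto_intros \<kappa>)
  then have "\<forall>\<^sub>F k in sequentially. real n * (\<kappa> k * ((1 + K) * (1 + K))) < \<delta> / 2"
    by (rule order_tendstoD(2)) (use \<delta> in simp)
  then show ?thesis
  proof (eventually_elim, intro ballI impI)
    fix k g x
    assume small: "real n * (\<kappa> k * ((1 + K) * (1 + K))) < \<delta> / 2"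
      and g: "g \<in> B" "P g = g" and x: "x \<in> B" "Q k x = x" and Ixg: "I x = I g"
    have W: "V y + norm y \<le> (1 + K) * norm y" if "V y \<le> K * norm y" for y
      using that by (simp add: algebra_simps)
    have Vx: "V x \<le> K * norm x" unfolding K_def by (rule LY_fixed_V_le[OF Q x])
    have Vg: "V g \<le> K * norm g" unfolding K_def by (rule LY_fixed_V_le[OF P g])
    have fix_iter: "(Q k ^^ j) x = x" "(P ^^ j) g = g" for j
      by (induction j) (auto simp: x g)
    have "x - g = ((Q k ^^ n) x - (P ^^ n) x) + (P ^^ n) (x - g)"
      by (simp add: fix_iter linear_diff[OF LY_iter_linear[OF P]])
    then have "norm (x - g) \<le> norm ((Q k ^^ n) x - (P ^^ n) x) + norm ((P ^^ n) (x - g))"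
      by (metis norm_triangle_ineq)
    also have "\<dots> \<le> real n * (\<kappa> k * ((1 + K) * (V x + norm x))) + \<delta> / (2 * (1 + K)) * (V (x - g) + norm (x - g))"
      by (intro add_mono n) (use perturbed_iterates_close[OF x(1)] Ixg x g in
          \<open>auto simp: K_def B_closed linear_diff[OF linear_I]\<close>)
    also have "\<dots> \<le> real n * (\<kappa> k * ((1 + K) * ((1 + K) * norm x))) + \<delta> / (2 * (1 + K)) * ((1 + K) * (norm x + norm g))"
    proof (intro add_mono mult_left_mono W Vx)
      have "V (x - g) + norm (x - g) \<le> (V x + V g) + (norm x + norm g)"
        by (intro add_mono V_diff x g norm_triangle_ineq4)
      also have "\<dots> \<le> (1 + K) * (norm x + norm g)" using Vx Vg by (simp add: algebra_simps)
      finally show "V (x - g) + norm (x - g) \<le> (1 + K) * (norm x + norm g)" .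
    qed (use \<delta> K \<kappa>0 in auto)
    also have "\<dots> = real n * (\<kappa> k * ((1 + K) * (1 + K))) * norm x + \<delta> / 2 * (norm x + norm g)"
    proof -
      have c: "\<delta> / (2 * (1 + K)) * ((1 + K) * t) = \<delta> / 2 * t" for t using K by (simp add: field_simps)
      show ?thesis unfolding c by (simp add: mult_ac)
    qed
    also have "\<dots> \<le> \<delta> / 2 * (norm x + norm g) + \<delta> / 2 * (norm x + norm g)"
      using small \<delta> by (intro add_right_mono mult_mono) auto
    finally show "norm (x - g) \<le> \<delta> * (norm x + norm g)" by simp
  qed
qed

lemma perturbed_unique_fixed_point:
  assumes h: "h \<in> B" "P h = h" "I h = 1"
  shows "\<forall>\<^sub>F k in sequentially. \<exists>x\<in>B. Q k x = x \<and> I x = 1 \<and> norm x \<le> norm h \<and>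
    (\<forall>y\<in>B. Q k y = y \<longrightarrow> I y = 1 \<longrightarrow> y = x)"
proof -
  have "\<forall>\<^sub>F k in sequentially. \<forall>g\<in>B. \<forall>x\<in>B. P g = g \<longrightarrow> Q k x = x \<longrightarrow> I x = I g \<longrightarrow>
      norm (x - g) \<le> 1 / 2 * (norm x + norm g)"
    by (rule perturbed_fixed_points_close) simp
  then show ?thesis
  proof eventually_elim
    case (elim k)
    obtain x where x: "x \<in> B" "Q k x = x" "I x = I h" "norm x \<le> norm h"
      using LY_fixed_point_exists[OF Q h(1)] by blast
    have "y = x" if y: "y \<in> B" "Q k y = y" "I y = 1" for y
    proof -
      have "P 0 = 0" "Q k (y - x) = y - x" "I (y - x) = I 0"
        using x y h by (simp_all add: linear_0[OF LY_linear[OF P]] linear_0[OF linear_I]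
            linear_diff[OF LY_linear[OF Q]] linear_diff[OF linear_I])
      from elim[rule_format, OF B_closed(1) B_closed(4)[OF y(1) x(1)] this]
      show "y = x" by simp
    qed
    moreover have "I x = 1" using x(3) h(3) by simp
    ultimately show ?case using x by blast
  qed
qed

lemma perturbed_fixed_points_tendsto:
  assumes h: "h \<in> B" "P h = h" "I h = 1"
    and X: "\<forall>\<^sub>F k in sequentially. X k \<in> B \<and> Q k (X k) = X k \<and> I (X k) = 1 \<and> norm (X k) \<le> D"
  shows "X \<longlonglongrightarrow> h"
proof (rule tendstoI)
  fix e :: real assume e: "0 < e"
  define \<delta> where "\<delta> = e / (2 * (\<bar>D\<bar> + norm h + 1))"
  have \<delta>: "0 < \<delta>" using e by (simp add: \<delta>_def add_nonneg_pos)
  from perturbed_fixed_points_close[OF \<delta>] X show "\<forall>\<^sub>F k in sequentially. dist (X k) h < e"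
  proof eventually_elim
    case (elim k)
    then have "norm (X k - h) \<le> \<delta> * (norm (X k) + norm h)" using h by simp
    also have "\<dots> \<le> \<delta> * (\<bar>D\<bar> + norm h + 1)" using elim \<delta> by (intro mult_left_mono) auto
    also have "\<dots> = e / 2"
    proof -
      have "\<bar>D\<bar> + norm h + 1 > 0" by (simp add: add_nonneg_pos)
      then show ?thesis unfolding \<delta>_def by (simp add: divide_simps)
    qed
    finally show ?case using e by (simp add: dist_norm)
  qed
qed

end

end

end

section \<open>Variation by monotone majorants\<close>

text \<open>
  The increments of \<open>f\<close> are dominated by those of \<open>v\<close>. Stated through the monotone functions
  \<open>v + f\<close> and \<open>v - f\<close>, the condition passes through any linear operation that preserves
  monotonicity, such as averaging over intervals or taking limits.
\<close>

definition var_dominated :: "(real \<Rightarrow> real) \<Rightarrow> (real \<Rightarrow> real) \<Rightarrow> bool"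
  where "var_dominated f v \<longleftrightarrow> mono_on {0..1} (\<lambda>x. v x + f x) \<and> mono_on {0..1} (\<lambda>x. v x - f x)"

lemma var_dominated_iff:
  "var_dominated f v \<longleftrightarrow> (\<forall>x\<in>{0..1}. \<forall>y\<in>{0..1}. x \<le> y \<longrightarrow> \<bar>f y - f x\<bar> \<le> v y - v x)"
proof -
  have "\<bar>f y - f x\<bar> \<le> v y - v x \<longleftrightarrow> v x + f x \<le> v y + f y \<and> v x - f x \<le> v y - f y" for x y
    by linarith
  then show ?thesis unfolding var_dominated_def mono_on_def by blast
qed

lemma var_dominatedD:
  "var_dominated f v \<Longrightarrow> 0 \<le> x \<Longrightarrow> x \<le> y \<Longrightarrow> y \<le> 1 \<Longrightarrow> \<bar>f y - f x\<bar> \<le> v y - v x"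
  by (auto simp: var_dominated_iff)

lemma total_var_le_increment:
  fixes f :: "real \<Rightarrow> 'a::real_normed_vector"
  assumes le: "\<And>x y. 0 \<le> x \<Longrightarrow> x \<le> y \<Longrightarrow> y \<le> 1 \<Longrightarrow> norm (f y - f x) \<le> v y - v x"
  shows "total_var f \<le> ennreal (v 1 - v 0)"
  unfolding total_var_def
proof (intro SUP_least)
  fix n and x :: "nat \<Rightarrow> real" assume "x \<in> {x. mono x \<and> range x \<subseteq> {0..1}}"
  then have x: "mono x" "\<And>i. 0 \<le> x i" "\<And>i. x i \<le> 1" by (auto simp: image_subset_iff)
  have "(\<Sum>i<n. ennreal (norm (f (x (Suc i)) - f (x i)))) = ennreal (\<Sum>i<n. norm (f (x (Suc i)) - f (x i)))"
    by simp
  also have "\<dots> \<le> ennreal (\<Sum>i<n. v (x (Suc i)) - v (x i))"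
    using le x by (intro ennreal_leI sum_mono) (auto simp: mono_def)
  also have "(\<Sum>i<n. v (x (Suc i)) - v (x i)) = v (x n) - v (x 0)" by (rule sum_lessThan_telescope)
  also have "\<dots> \<le> v 1 - v 0"
    using order_trans[OF norm_ge_zero le[of 0 "x 0"]] order_trans[OF norm_ge_zero le[of "x n" 1]] x by auto
  finally show "(\<Sum>i<n. ennreal (norm (f (x (Suc i)) - f (x i)))) \<le> ennreal (v 1 - v 0)"
    by (simp add: ennreal_leI)
qed

lemma total_var_le_dominated:
  "var_dominated f v \<Longrightarrow> total_var f \<le> ennreal (v 1 - v 0)"
  by (rule total_var_le_increment) (auto dest: var_dominatedD)

text \<open>
  The majorant at \<open>x\<close> is the variation of \<open>f\<close> on \<open>[0, x]\<close>, written as the total variation of the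
  function stopped at \<open>x\<close>, so that chains in the unit interval serve for all \<open>x\<close>.
\<close>

lemma dominated_if_total_var_finite:
  fixes f :: "real \<Rightarrow> real"
  assumes fin: "total_var f \<le> ennreal C" and C: "0 \<le> C"
  shows "\<exists>v. var_dominated f v \<and> v 1 - v 0 \<le> C"
proof -
  define w where "w x = total_var (\<lambda>y. f (min y x))" for x
  have chain: "(\<Sum>i<n. ennreal (norm (f (min (z (Suc i)) x) - f (min (z i) x)))) + ennreal \<bar>f y - f x\<bar> \<le> w y"
    if xy: "0 \<le> x" "x \<le> y" "y \<le> 1" and z: "mono z" "range z \<subseteq> {0..1}" for x y n z
  proof -
    \<comment> \<open>A chain stopped at \<open>x\<close> is prolonged by the step from \<open>x\<close> to \<open>y\<close>.\<close>
    define u where "u i = (if i \<le> n then min (z i) x else if i = Suc n then x else y)" for i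
    have mono_z: "z i \<le> z j" if "i \<le> j" for i j using z(1) that by (simp add: mono_def)
    have z01: "0 \<le> z i" "z i \<le> 1" for i using z(2) by (auto simp: image_subset_iff)
    have u: "mono u" "range u \<subseteq> {0..1}"
    proof -
      show "mono u"
      proof (rule monoI)
        fix i j :: nat assume "i \<le> j"
        then show "u i \<le> u j" using mono_z[of i j] xy unfolding u_def by (auto simp: min_le_iff_disj)
      qed
      show "range u \<subseteq> {0..1}" using z01 xy by (auto simp: u_def min_le_iff_disj intro: order_trans)
    qed
    have "(\<Sum>i<n. ennreal (norm (f (min (z (Suc i)) x) - f (min (z i) x)))) + ennreal \<bar>f y - f x\<bar>
      = (\<Sum>i<n. ennreal (norm (f (min (u (Suc i)) y) - f (min (u i) y)))) + ennreal \<bar>f y - f x\<bar>"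
      using xy by (intro arg_cong2[where f = "(+)"] sum.cong) (auto simp: u_def min_def)
    also have "\<dots> \<le> (\<Sum>i<n + 2. ennreal (norm (f (min (u (Suc i)) y) - f (min (u i) y))))"
      using xy by (auto simp: numeral_2_eq_2 u_def add.assoc intro!: add_left_mono)
    also have "\<dots> \<le> w y"
      unfolding w_def total_var_def using u by (intro SUP_upper2[of "n + 2"] SUP_upper2[of u]) auto
    finally show ?thesis .
  qed
  have w_le: "w y \<le> ennreal C" if "0 \<le> y" "y \<le> 1" for y
  proof -
    have "w y \<le> total_var f" unfolding w_def total_var_def
    proof (intro SUP_least)
      fix n and z :: "nat \<Rightarrow> real" assume z: "z \<in> {x. mono x \<and> range x \<subseteq> {0..1}}"
      have "mono (\<lambda>i. min (z i) y)" using z by (auto simp: mono_def min_le_iff_disj)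
      moreover have "range (\<lambda>i. min (z i) y) \<subseteq> {0..1}" using z that by (auto simp: min_le_iff_disj)
      ultimately show "(\<Sum>i<n. ennreal (norm (f (min (z (Suc i)) y) - f (min (z i) y)))) \<le>
        (SUP n. SUP x\<in>{x. mono x \<and> range x \<subseteq> {0..1}}. \<Sum>i<n. ennreal (norm (f (x (Suc i)) - f (x i))))"
        by (intro SUP_upper2[of n] SUP_upper2[of "\<lambda>i. min (z i) y"]) auto
    qed
    then show ?thesis using fin by (rule order_trans)
  qed
  have add: "w x + ennreal \<bar>f y - f x\<bar> \<le> w y" if xy: "0 \<le> x" "x \<le> y" "y \<le> 1" for x y
  proof -
    have c: "ennreal \<bar>f y - f x\<bar> \<le> w y"
      using chain[OF xy, of "\<lambda>_. 0" 0] by (simp add: mono_def)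
    have "w x \<le> w y - ennreal \<bar>f y - f x\<bar>"
      unfolding w_def[of x] total_var_def
    proof (intro SUP_least)
      fix n and z :: "nat \<Rightarrow> real" assume z: "z \<in> {x. mono x \<and> range x \<subseteq> {0..1}}"
      then have "(\<Sum>i<n. ennreal (norm (f (min (z (Suc i)) x) - f (min (z i) x)))) + ennreal \<bar>f y - f x\<bar> \<le> w y"
        by (intro chain xy) auto
      then show "(\<Sum>i<n. ennreal (norm (f (min (z (Suc i)) x) - f (min (z i) x)))) \<le> w y - ennreal \<bar>f y - f x\<bar>"
        by (subst ennreal_le_minus_iff) blast
    qed
    then show ?thesis using c by (metis add_right_mono diff_add_cancel_ennreal)
  qed
  define v where "v x = enn2real (w x)" for x
  have wv: "w x = ennreal (v x)" if "0 \<le> x" "x \<le> 1" for x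
    using w_le[OF that] unfolding v_def by (intro ennreal_enn2real[symmetric]) (auto simp: less_top[symmetric] top_unique)
  have v0: "0 \<le> v x" for x by (simp add: v_def)
  have "\<bar>f y - f x\<bar> \<le> v y - v x" if "0 \<le> x" "x \<le> y" "y \<le> 1" for x y
    using add[OF that] wv[of x] wv[of y] that v0[of x] v0[of y]
    by (simp add: ennreal_plus[symmetric] del: ennreal_plus)
  moreover have "v 1 \<le> C" using w_le[of 1] wv[of 1] C by simp
  ultimately show ?thesis using v0[of 0] by (intro exI[of _ v]) (auto simp: var_dominated_iff)
qed

lemma ess_var_le_dominated:
  assumes "AE x in leb01. g x = f x" "var_dominated g v"
  shows "ess_var f \<le> ennreal (v 1 - v 0)"
  unfolding ess_var_def using assms by (intro INF_lower2[of g] total_var_le_dominated) auto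

lemma dominated_representative:
  fixes f :: "real \<Rightarrow> real"
  assumes "ess_var f < ennreal C"
  shows "\<exists>g v. (AE x in leb01. g x = f x) \<and> var_dominated g v \<and> v 1 - v 0 \<le> C"
proof -
  obtain g where g: "AE x in leb01. g x = f x" "total_var g < ennreal C"
    using assms by (auto simp: ess_var_def INF_less_iff)
  moreover have "0 \<le> C" using g(2) by (metis ennreal_neg linear not_less_zero)
  ultimately show ?thesis using dominated_if_total_var_finite[of g C] by (meson order_less_imp_le)
qed

lemma ess_var_cong:
  assumes "AE x in leb01. f x = g x"
  shows "ess_var f = ess_var g"
proof -
  have "(AE x in leb01. h x = f x) \<longleftrightarrow> (AE x in leb01. h x = g x)" for h
    using assms by (auto elim: AE_mp intro: AE_I2)
  then show ?thesis by (simp add: ess_var_def)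
qed

abbreviation Var :: "(real \<Rightarrow> real) \<Rightarrow> real"
  where "Var f \<equiv> enn2real (ess_var f)"

lemma ess_var_less_ennreal:
  assumes "ess_var f < \<infinity>" "0 < e"
  shows "ess_var f < ennreal (Var f + e)"
proof -
  have "ess_var f = ennreal (Var f)"
    using assms(1) by (intro ennreal_enn2real[symmetric]) simp
  also have "\<dots> < ennreal (Var f + e)" using assms(2) by (intro ennreal_lessI) (auto intro: add_nonneg_pos)
  finally show ?thesis .
qed

lemma Var_representative:
  assumes "ess_var f < \<infinity>" "0 < e"
  shows "\<exists>g v. (AE x in leb01. g x = f x) \<and> var_dominated g v \<and> v 1 - v 0 \<le> Var f + e"
  by (rule dominated_representative[OF ess_var_less_ennreal[OF assms]])

lemma var_dominated_nonneg: "var_dominated g v \<Longrightarrow> 0 \<le> v 1 - v 0"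
  using var_dominatedD[of g v 0 1] by auto

lemma Var_leI:
  assumes "AE x in leb01. g x = f x" "var_dominated g v"
  shows "ess_var f < \<infinity>" "Var f \<le> v 1 - v 0"
  using ess_var_le_dominated[OF assms] var_dominated_nonneg[OF assms(2)]
  by (auto intro: le_less_trans enn2real_leI)

lemma var_dominated_add:
  "var_dominated f v \<Longrightarrow> var_dominated g w \<Longrightarrow> var_dominated (\<lambda>x. f x + g x) (\<lambda>x. v x + w x)"
  unfolding var_dominated_iff
proof (intro ballI impI)
  fix x y :: real
  assume "\<forall>x\<in>{0..1}. \<forall>y\<in>{0..1}. x \<le> y \<longrightarrow> \<bar>f y - f x\<bar> \<le> v y - v x"
    "\<forall>x\<in>{0..1}. \<forall>y\<in>{0..1}. x \<le> y \<longrightarrow> \<bar>g y - g x\<bar> \<le> w y - w x"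
    and "x \<in> {0..1}" "y \<in> {0..1}" "x \<le> y"
  then have "\<bar>f y - f x\<bar> \<le> v y - v x" "\<bar>g y - g x\<bar> \<le> w y - w x" by blast+
  then show "\<bar>f y + g y - (f x + g x)\<bar> \<le> v y + w y - (v x + w x)" by linarith
qed

lemma var_dominated_scale:
  assumes "var_dominated f v"
  shows "var_dominated (\<lambda>x. c * f x) (\<lambda>x. \<bar>c\<bar> * v x)"
  unfolding var_dominated_iff
proof (intro ballI impI)
  fix x y :: real assume "x \<in> {0..1}" "y \<in> {0..1}" "x \<le> y"
  then have "\<bar>f y - f x\<bar> \<le> v y - v x" using assms by (auto simp: var_dominated_iff)
  then have "\<bar>c\<bar> * \<bar>f y - f x\<bar> \<le> \<bar>c\<bar> * (v y - v x)" by (intro mult_left_mono) auto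
  then show "\<bar>c * f y - c * f x\<bar> \<le> \<bar>c\<bar> * v y - \<bar>c\<bar> * v x"
    by (simp add: abs_mult[symmetric] right_diff_distrib)
qed

lemma Var_add:
  assumes f: "ess_var f < \<infinity>" and g: "ess_var g < \<infinity>"
  shows "ess_var (\<lambda>x. f x + g x) < \<infinity>" "Var (\<lambda>x. f x + g x) \<le> Var f + Var g"
proof -
  have *: "ess_var (\<lambda>x. f x + g x) < \<infinity> \<and> Var (\<lambda>x. f x + g x) \<le> Var f + Var g + e" if e: "0 < e" for e
  proof -
    obtain f' v where f': "AE x in leb01. f' x = f x" "var_dominated f' v" "v 1 - v 0 \<le> Var f + e / 2"
      using Var_representative[OF f, of "e / 2"] e by auto
    obtain g' w where g': "AE x in leb01. g' x = g x" "var_dominated g' w" "w 1 - w 0 \<le> Var g + e / 2"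
      using Var_representative[OF g, of "e / 2"] e by auto
    have "AE x in leb01. f' x + g' x = f x + g x" using f'(1) g'(1) by eventually_elim simp
    from Var_leI[OF this var_dominated_add[OF f'(2) g'(2)]] f'(3) g'(3)
    show ?thesis by auto
  qed
  show "ess_var (\<lambda>x. f x + g x) < \<infinity>" using *[of 1] by simp
  show "Var (\<lambda>x. f x + g x) \<le> Var f + Var g" by (rule field_le_epsilon) (use * in blast)
qed

lemma Var_scale_le:
  assumes f: "ess_var f < \<infinity>"
  shows "ess_var (\<lambda>x. c * f x) < \<infinity>" "Var (\<lambda>x. c * f x) \<le> \<bar>c\<bar> * Var f"
proof -
  have *: "ess_var (\<lambda>x. c * f x) < \<infinity> \<and> Var (\<lambda>x. c * f x) \<le> \<bar>c\<bar> * Var f + e" if e: "0 < e" for e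
  proof -
    obtain f' v where f': "AE x in leb01. f' x = f x" "var_dominated f' v" "v 1 - v 0 \<le> Var f + e / (\<bar>c\<bar> + 1)"
      using Var_representative[OF f, of "e / (\<bar>c\<bar> + 1)"] e by auto
    have "AE x in leb01. c * f' x = c * f x" using f'(1) by eventually_elim simp
    note le = Var_leI[OF this var_dominated_scale[OF f'(2)]]
    have "\<bar>c\<bar> * v 1 - \<bar>c\<bar> * v 0 = \<bar>c\<bar> * (v 1 - v 0)" by (simp add: right_diff_distrib)
    also have "\<dots> \<le> \<bar>c\<bar> * (Var f + e / (\<bar>c\<bar> + 1))"
      using f'(3) by (rule mult_left_mono) simp
    also have "\<dots> = \<bar>c\<bar> * Var f + \<bar>c\<bar> * (e / (\<bar>c\<bar> + 1))" by (rule distrib_left)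
    also have "\<bar>c\<bar> * (e / (\<bar>c\<bar> + 1)) \<le> e"
      using e by (simp add: divide_simps)
    finally show ?thesis using le by simp
  qed
  show "ess_var (\<lambda>x. c * f x) < \<infinity>" using *[of 1] by simp
  show "Var (\<lambda>x. c * f x) \<le> \<bar>c\<bar> * Var f" by (rule field_le_epsilon) (use * in blast)
qed

text \<open>
  Only the inequality is immediate; the converse is the inequality for the inverse factor.
\<close>

lemma Var_scale:
  assumes f: "ess_var f < \<infinity>"
  shows "Var (\<lambda>x. c * f x) = \<bar>c\<bar> * Var f"
proof (cases "c = 0")
  case True
  have "Var (\<lambda>x. 0::real) \<le> 0" using Var_scale_le(2)[OF f, of 0] by simp
  then have "Var (\<lambda>x. 0::real) = 0" using enn2real_nonneg by (rule order_antisym)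
  then show ?thesis using True by simp
next
  case False
  have "Var (\<lambda>x. inverse c * (c * f x)) \<le> \<bar>inverse c\<bar> * Var (\<lambda>x. c * f x)"
    by (rule Var_scale_le(2)[OF Var_scale_le(1)[OF f]])
  then have "\<bar>c\<bar> * Var f \<le> Var (\<lambda>x. c * f x)"
    using False by (simp add: field_simps flip: mult.assoc)
  then show ?thesis using Var_scale_le(2)[OF f, of c] by simp
qed

lemma var_dominated_osc:
  assumes "var_dominated f v" "x \<in> {0..1}" "y \<in> {0..1}"
  shows "\<bar>f x - f y\<bar> \<le> v 1 - v 0"
proof -
  have "\<bar>f (max x y) - f (min x y)\<bar> \<le> v (max x y) - v (min x y)"
    using assms by (intro var_dominatedD) auto
  moreover have "\<bar>f 1 - f (max x y)\<bar> \<le> v 1 - v (max x y)" "\<bar>f (min x y) - f 0\<bar> \<le> v (min x y) - v 0"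
    using assms by (intro var_dominatedD[OF assms(1)]; auto)+
  moreover have "\<bar>f x - f y\<bar> = \<bar>f (max x y) - f (min x y)\<bar>" by (auto simp: max_def min_def)
  ultimately show ?thesis by linarith
qed

lemma var_dominated_bounded:
  assumes "var_dominated f v" "x \<in> {0..1}"
  shows "\<bar>f x\<bar> \<le> \<bar>f 0\<bar> + (v 1 - v 0)"
  using var_dominated_osc[OF assms(1,2), of 0] by auto

lemma var_dominated_mult:
  assumes f: "var_dominated f v" and g: "var_dominated g w"
  shows "\<exists>u. var_dominated (\<lambda>x. f x * g x) u"
proof -
  define M where "M = \<bar>f 0\<bar> + (v 1 - v 0)"
  define N where "N = \<bar>g 0\<bar> + (w 1 - w 0)"
  have "var_dominated (\<lambda>x. f x * g x) (\<lambda>x. M * w x + N * v x)"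
    unfolding var_dominated_iff
  proof (intro ballI impI)
    fix x y :: real assume xy: "x \<in> {0..1}" "y \<in> {0..1}" "x \<le> y"
    have "f y * g y - f x * g x = f y * (g y - g x) + g x * (f y - f x)" by (simp add: algebra_simps)
    then have "\<bar>f y * g y - f x * g x\<bar> \<le> \<bar>f y\<bar> * \<bar>g y - g x\<bar> + \<bar>g x\<bar> * \<bar>f y - f x\<bar>"
      by (metis abs_mult abs_triangle_ineq)
    also have "\<dots> \<le> M * (w y - w x) + N * (v y - v x)"
      using xy f g var_dominated_bounded[OF f xy(2)] var_dominated_bounded[OF g xy(1)]
      unfolding M_def N_def by (intro add_mono mult_mono) (auto simp: var_dominated_iff)
    finally show "\<bar>f y * g y - f x * g x\<bar> \<le> M * w y + N * v y - (M * w x + N * v x)"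
      by (simp add: algebra_simps)
  qed
  then show ?thesis by blast
qed

lemma ess_var_mult_finite:
  fixes f g :: "real \<Rightarrow> real"
  assumes "ess_var f < \<infinity>" "ess_var g < \<infinity>"
  shows "ess_var (\<lambda>x. f x * g x :: real) < \<infinity>"
proof -
  obtain f' v where f': "AE x in leb01. f' x = f x" "var_dominated f' v"
    using Var_representative[OF assms(1), of 1] by auto
  obtain g' w where g': "AE x in leb01. g' x = g x" "var_dominated g' w"
    using Var_representative[OF assms(2), of 1] by auto
  obtain u where "var_dominated (\<lambda>x. f' x * g' x) u" using var_dominated_mult[OF f'(2) g'(2)] by blast
  moreover have "AE x in leb01. f' x * g' x = f x * g x" using f'(1) g'(1) by eventually_elim simp
  ultimately show ?thesis by (intro Var_leI)
qed

lemma ess_var_bounded: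
  fixes f :: "real \<Rightarrow> real"
  assumes "ess_var f < \<infinity>"
  shows "\<exists>C. AE x in leb01. \<bar>f x\<bar> \<le> (C::real)"
proof -
  obtain f' v where f': "AE x in leb01. f' x = f x" "var_dominated f' v"
    using Var_representative[OF assms, of 1] by auto
  have "AE x in leb01. \<bar>f' x\<bar> \<le> \<bar>f' 0\<bar> + (v 1 - v 0)"
    using var_dominated_bounded[OF f'(2)] by (intro AE_I2) simp
  then have "AE x in leb01. \<bar>f x\<bar> \<le> \<bar>f' 0\<bar> + (v 1 - v 0)" using f'(1) by eventually_elim simp
  then show ?thesis by blast
qed

lemma mono_on_borel_measurable_leb01:
  fixes f :: "real \<Rightarrow> real"
  assumes "mono_on {0..1::real} f"
  shows "f \<in> borel_measurable leb01"
proof -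
  define F where "F x = f (max 0 (min 1 x))" for x
  have "mono F" using assms by (auto simp: F_def mono_on_def mono_def max_def min_def)
  then have "F \<in> borel_measurable borel" by (rule borel_measurable_mono)
  then have "F \<in> borel_measurable leb01"
    by (intro measurable_restrict_space1 measurable_completion) simp
  then show ?thesis by (rule measurable_cong[THEN iffD1, rotated]) (auto simp: F_def)
qed

lemma var_dominated_measurable:
  assumes "var_dominated f v"
  shows "f \<in> borel_measurable leb01" "v \<in> borel_measurable leb01"
proof -
  have *: "(\<lambda>x. v x + f x) \<in> borel_measurable leb01" "(\<lambda>x. v x - f x) \<in> borel_measurable leb01"
    using assms by (auto simp: var_dominated_def intro: mono_on_borel_measurable_leb01)
  have "(\<lambda>x. ((v x + f x) - (v x - f x)) / 2) \<in> borel_measurable leb01"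
    "(\<lambda>x. ((v x + f x) + (v x - f x)) / 2) \<in> borel_measurable leb01"
    by (intro borel_measurable_divide borel_measurable_diff borel_measurable_add * borel_measurable_const)+
  then show "f \<in> borel_measurable leb01" "v \<in> borel_measurable leb01" by simp_all
qed

interpretation leb01: finite_measure leb01
  by (rule finite_measure_lebesgue_on) simp

lemma measure_leb01_UNIV [simp]: "measure leb01 {0..1} = 1"
  by (simp add: measure_restrict_space)

lemma bounded_integrable_leb01:
  assumes "f \<in> borel_measurable leb01" "AE x in leb01. \<bar>f x\<bar> \<le> (C::real)"
  shows "integrable leb01 f"
  using assms by (intro leb01.integrable_const_bound[where B = C]) auto

lemma var_dominated_integrable:
  assumes "var_dominated f v"
  shows "integrable leb01 f" "integrable leb01 v"
proof -
  show "integrable leb01 f"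
    by (rule bounded_integrable_leb01[OF var_dominated_measurable(1)[OF assms], of "\<bar>f 0\<bar> + (v 1 - v 0)"])
      (use var_dominated_bounded[OF assms] in \<open>auto intro!: AE_I2\<close>)
  have "\<bar>v x\<bar> \<le> \<bar>v 0\<bar> + \<bar>v 1\<bar>" if "x \<in> {0..1}" for x
    using var_dominatedD[OF assms, of 0 x] var_dominatedD[OF assms, of x 1] that by auto
  then show "integrable leb01 v"
    by (intro bounded_integrable_leb01[OF var_dominated_measurable(2)[OF assms]] AE_I2) simp
qed

section \<open>Averages over partitions into intervals\<close>

context
  fixes \<eta> :: "real set set" and \<epsilon> :: real
  assumes \<eta>: "interval_partition \<epsilon> \<eta>"
begin

lemma partition_finite: "finite \<eta>" and partition_Union: "\<Union>\<eta> = {0..1}"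
  and partition_disjoint: "J \<in> \<eta> \<Longrightarrow> J' \<in> \<eta> \<Longrightarrow> x \<in> J \<Longrightarrow> x \<in> J' \<Longrightarrow> J = J'"
  and partition_nonempty: "J \<in> \<eta> \<Longrightarrow> J \<noteq> {}" and partition_interval: "J \<in> \<eta> \<Longrightarrow> is_interval J"
  and partition_measure: "J \<in> \<eta> \<Longrightarrow> measure leb01 J \<le> \<epsilon>"
  using \<eta> by (auto simp: interval_partition_def partition_on_def disjoint_def)

lemma partition_subset: "J \<in> \<eta> \<Longrightarrow> J \<subseteq> {0..1}"
  using partition_Union by auto

lemma partition_sets: "J \<in> \<eta> \<Longrightarrow> J \<in> sets leb01"
  using partition_subset[of J] is_interval_convex[OF partition_interval[of J]]
  by (auto simp: sets_restrict_space_iff intro!: measurable_convex fmeasurableD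
      bounded_subset[OF bounded_closed_interval])

end

text \<open>
  On a cell of measure zero the value at an arbitrary point stands in for the mean. Then averaging
  preserves monotonicity at every point, and not merely up to a null set.
\<close>

definition average :: "real set \<Rightarrow> (real \<Rightarrow> real) \<Rightarrow> real"
  where "average J f = (if measure leb01 J = 0 then f (SOME x. x \<in> J)
    else (LINT x|leb01. indicator J x * f x) / measure leb01 J)"

definition step_average :: "real set set \<Rightarrow> (real \<Rightarrow> real) \<Rightarrow> real \<Rightarrow> real"
  where "step_average \<eta> f x = (\<Sum>J\<in>\<eta>. indicator J x * average J f)"

lemma integrable_indicator_mult:
  fixes f :: "real \<Rightarrow> real"
  shows "J \<in> sets leb01 \<Longrightarrow> integrable leb01 f \<Longrightarrow> integrable leb01 (\<lambda>x. indicator J x * f x)"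
  using integrable_mult_indicator[of J leb01 f] by simp

lemma integral_indicator_const:
  "J \<in> sets leb01 \<Longrightarrow> (LINT x|leb01. indicator J x * (c::real)) = c * measure leb01 J"
  using sets.sets_into_space[of J leb01] by (simp add: Int_absorb2)

lemma average_add_diff:
  assumes "J \<in> sets leb01" "integrable leb01 f" "integrable leb01 g"
  shows "average J (\<lambda>x. f x + g x) = average J f + average J g"
    and "average J (\<lambda>x. f x - g x) = average J f - average J g"
  using assms integrable_indicator_mult[OF assms(1)]
  by (auto simp: average_def add_divide_distrib diff_divide_distrib distrib_left right_diff_distrib)

lemma average_le:
  assumes J: "J \<in> sets leb01" "J \<noteq> {}" and f: "integrable leb01 f" and le: "\<And>x. x \<in> J \<Longrightarrow> f x \<le> c"
  shows "average J f \<le> c"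
proof (cases "measure leb01 J = 0")
  case True
  then show ?thesis using le some_in_eq[of J] J(2) by (auto simp: average_def)
next
  case False
  have "(LINT x|leb01. indicator J x * f x) \<le> (LINT x|leb01. indicator J x * c)"
    using le by (intro integral_mono integrable_indicator_mult J f) (auto simp: indicator_def)
  also have "\<dots> = c * measure leb01 J" by (rule integral_indicator_const[OF J(1)])
  finally show ?thesis using False measure_nonneg[of leb01 J]
    by (simp add: average_def divide_le_eq less_le)
qed

lemma average_ge:
  assumes J: "J \<in> sets leb01" "J \<noteq> {}" and f: "integrable leb01 f" and le: "\<And>x. x \<in> J \<Longrightarrow> c \<le> f x"
  shows "c \<le> average J f"
proof (cases "measure leb01 J = 0")
  case True
  then show ?thesis using le some_in_eq[of J] J(2) by (auto simp: average_def)
next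
  case False
  have "c * measure leb01 J = (LINT x|leb01. indicator J x * c)"
    by (rule integral_indicator_const[OF J(1), symmetric])
  also have "\<dots> \<le> (LINT x|leb01. indicator J x * f x)"
    using le by (intro integral_mono integrable_indicator_mult J f) (auto simp: indicator_def)
  finally show ?thesis using False measure_nonneg[of leb01 J]
    by (simp add: average_def le_divide_eq less_le)
qed

lemma integral_eq_average:
  assumes "J \<in> sets leb01" "integrable leb01 f"
  shows "(LINT x|leb01. indicator J x * f x) = average J f * measure leb01 J"
proof (cases "measure leb01 J = 0")
  case True
  then have "J \<in> null_sets leb01" using assms by (simp add: null_sets_def leb01.emeasure_eq_measure)
  then have "AE x in leb01. indicator J x * f x = 0" by (rule AE_I') (auto simp: indicator_def)
  then have "(LINT x|leb01. indicator J x * f x) = 0" by (rule integral_eq_zero_AE)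
  then show ?thesis using True by simp
qed (simp add: average_def)

lemma intervals_ordered:
  fixes J J' :: "real set"
  assumes "is_interval J" "is_interval J'" "J \<inter> J' = {}" "x \<in> J" "y \<in> J'" "x \<le> y" "u \<in> J" "w \<in> J'"
  shows "u \<le> w"
proof (rule ccontr)
  assume "\<not> u \<le> w"
  then show False
    using assms mem_is_interval_1_I[of J x u w] mem_is_interval_1_I[of J' w y x] by (cases "w \<le> x") auto
qed

text \<open>
  Induction over the cells from left to right: all cells before the last one lie to the left of its
  infimum. Cells are ordered by chosen points because degenerate cells may share their end points with
  others.
\<close>

lemma telescoping_oscillation:
  fixes \<J> :: "real set set" and w :: "real \<Rightarrow> real"
  assumes "finite \<J>" "\<And>J. J \<in> \<J> \<Longrightarrow> is_interval J \<and> J \<noteq> {}" "disjoint \<J>"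
    "\<And>J. J \<in> \<J> \<Longrightarrow> J \<subseteq> {a..b}" "mono_on {a..b} w" "a \<le> b"
  shows "(\<Sum>J\<in>\<J>. w (Sup J) - w (Inf J)) \<le> w b - w a"
  using assms
proof (induction \<J> arbitrary: b rule: finite_ranking_induct[where f = "\<lambda>J. SOME x. x \<in> J"])
  case empty
  then show ?case by (simp add: mono_on_def)
next
  case (insert J \<J>)
  let ?p = "\<lambda>J. SOME x::real. x \<in> J"
  have p: "?p J' \<in> J'" if "J' \<in> insert J \<J>" for J' using insert.prems(1)[OF that] some_in_eq by blast
  have J: "J \<noteq> {}" "J \<subseteq> {a..b}" using insert.prems by auto
  have bdd: "bdd_above J" "bdd_below J" using J by (auto intro: bdd_above_mono bdd_below_mono)
  have range: "a \<le> Inf J" "Inf J \<le> Sup J" "Sup J \<le> b"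
    using J bdd by (auto intro!: cInf_greatest cSup_least cInf_le_cSup)
  show ?case
  proof (cases "J \<in> \<J>")
    case True
    then show ?thesis using insert.IH insert.prems by (simp add: insert_absorb)
  next
    case False
    have "(\<Sum>J\<in>\<J>. w (Sup J) - w (Inf J)) \<le> w (Inf J) - w a"
    proof (rule insert.IH)
      show "J' \<subseteq> {a..Inf J}" if "J' \<in> \<J>" for J'
      proof
        fix u assume u: "u \<in> J'"
        have "J' \<inter> J = {}" by (rule disjointD[OF insert.prems(2)]) (use that False in auto)
        then have "u \<le> x" if "x \<in> J" for x
          using intervals_ordered[of J' J "?p J'" "?p J" u x] insert.prems(1) insert.hyps(2) p u that \<open>J' \<in> \<J>\<close> by auto
        then have "u \<le> Inf J" using J by (intro cInf_greatest) auto
        moreover have "J' \<subseteq> {a..b}" using insert.prems(3) that by blast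
        ultimately show "u \<in> {a..Inf J}" using u by auto
      qed
      show "mono_on {a..Inf J} w" using insert.prems(4) range by (auto simp: mono_on_def)
    qed (use insert.prems range in \<open>auto simp: pairwise_insert\<close>)
    moreover have "w (Sup J) \<le> w b" using insert.prems(4) range by (auto simp: mono_on_def)
    ultimately show ?thesis using insert.hyps(1) False by simp
  qed
qed

context
  fixes \<eta> :: "real set set" and \<epsilon> :: real
  assumes \<eta>: "interval_partition \<epsilon> \<eta>"
begin

lemmas partition_facts = partition_finite[OF \<eta>] partition_sets[OF \<eta>] partition_nonempty[OF \<eta>]

lemma step_average_eq:
  assumes "J \<in> \<eta>" "x \<in> J"
  shows "step_average \<eta> f x = average J f"
proof -
  have "step_average \<eta> f x = (\<Sum>J'\<in>\<eta>. if J' = J then average J f else 0)"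
    unfolding step_average_def
    by (intro sum.cong) (use assms partition_disjoint[OF \<eta>] in \<open>auto simp: indicator_def\<close>)
  then show ?thesis using assms partition_facts(1) by simp
qed

lemma partition_cover: "x \<in> {0..1} \<Longrightarrow> \<exists>J\<in>\<eta>. x \<in> J"
  using partition_Union[OF \<eta>] by blast

text \<open>
  Of two different cells one lies entirely before the other, and a mean lies between the bounds of the
  values.
\<close>

lemma step_average_mono:
  assumes f: "mono_on {0..1} f" "integrable leb01 f"
  shows "mono_on {0..1} (step_average \<eta> f)"
proof (rule mono_onI)
  fix x y :: real assume xy: "x \<in> {0..1}" "y \<in> {0..1}" "x \<le> y"
  obtain J where J: "J \<in> \<eta>" "x \<in> J" using partition_cover[OF xy(1)] by blast
  obtain J' where J': "J' \<in> \<eta>" "y \<in> J'" using partition_cover[OF xy(2)] by blast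
  have "average J f \<le> average J' f"
  proof (cases "J = J'")
    case False
    then have disj: "J \<inter> J' = {}" using partition_disjoint[OF \<eta> J(1) J'(1)] by blast
    have "f u \<le> f w" if "u \<in> J" "w \<in> J'" for u w
      by (rule mono_onD[OF f(1)])
        (use intervals_ordered[OF partition_interval[OF \<eta> J(1)] partition_interval[OF \<eta> J'(1)] disj J(2) J'(2) xy(3) that]
          that partition_subset[OF \<eta> J(1)] partition_subset[OF \<eta> J'(1)] in auto)
    then show ?thesis
      by (intro average_ge average_le partition_facts J J' f)
  qed simp
  then show "step_average \<eta> f x \<le> step_average \<eta> f y"
    by (simp add: step_average_eq[OF J] step_average_eq[OF J'])
qed

lemma step_average_add_diff:
  assumes "integrable leb01 f" "integrable leb01 g"
  shows "step_average \<eta> (\<lambda>x. f x + g x) = (\<lambda>x. step_average \<eta> f x + step_average \<eta> g x)"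
    "step_average \<eta> (\<lambda>x. f x - g x) = (\<lambda>x. step_average \<eta> f x - step_average \<eta> g x)"
  by (auto simp: step_average_def average_add_diff[OF partition_facts(2)] assms distrib_left right_diff_distrib
      sum.distrib sum_subtractf)

lemma step_average_dominated:
  assumes fv: "var_dominated f v"
  shows "var_dominated (step_average \<eta> f) (step_average \<eta> v)"
    and "step_average \<eta> v 1 - step_average \<eta> v 0 \<le> v 1 - v 0"
proof -
  note int = var_dominated_integrable[OF fv]
  show "var_dominated (step_average \<eta> f) (step_average \<eta> v)"
    using fv step_average_mono[of "\<lambda>x. v x + f x"] step_average_mono[of "\<lambda>x. v x - f x"] int
    by (simp add: var_dominated_def step_average_add_diff[OF int(2,1)])
  have v: "v 0 \<le> v x" "v x \<le> v 1" if "x \<in> {0..1}" for x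
    using var_dominatedD[OF fv, of 0 x] var_dominatedD[OF fv, of x 1] that by auto
  have le: "v 0 \<le> step_average \<eta> v x \<and> step_average \<eta> v x \<le> v 1" if x: "x \<in> {0..1}" for x
  proof -
    obtain J where J: "J \<in> \<eta>" "x \<in> J" using partition_cover[OF x] by blast
    then show ?thesis
      using v partition_subset[OF \<eta> J(1)] int
      by (auto simp: step_average_eq[OF J] intro!: average_ge average_le partition_facts)
  qed
  show "step_average \<eta> v 1 - step_average \<eta> v 0 \<le> v 1 - v 0"
    using le[of 0] le[of 1] by simp
qed

text \<open>
  On each cell \<open>f\<close> differs from its mean by at most the increment of \<open>v\<close> over the cell. These
  increments add up to at most \<open>v 1 - v 0\<close>, and a cell has measure at most \<open>\<epsilon>\<close>.
\<close>

lemma step_average_L1_close: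
  assumes fv: "var_dominated f v"
  shows "(LINT x|leb01. \<bar>step_average \<eta> f x - f x\<bar>) \<le> \<epsilon> * (v 1 - v 0)"
proof -
  note int = var_dominated_integrable[OF fv]
  note bd = var_dominatedD[OF fv]
  have vmono: "v x \<le> v y" if "0 \<le> x" "x \<le> y" "y \<le> 1" for x y using bd[OF that] by auto
  define osc where "osc J = v (Sup J) - v (Inf J)" for J
  have osc: "\<bar>f x - f y\<bar> \<le> osc J" if J: "J \<in> \<eta>" "x \<in> J" "y \<in> J" for J x y
  proof -
    have sub: "J \<subseteq> {0..1}" by (rule partition_subset[OF \<eta> J(1)])
    have bdd: "bdd_above J" "bdd_below J" using sub by (auto intro: bdd_above_mono bdd_below_mono)
    have m: "max x y \<in> J" "min x y \<in> J" using J by (auto simp: max_def min_def)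
    then have 1: "max x y \<le> Sup J" "Inf J \<le> min x y"
      using cSup_upper[OF m(1) bdd(1)] cInf_lower[OF m(2) bdd(2)] by blast+
    have 2: "0 \<le> Inf J" "Sup J \<le> 1" using sub J by (auto intro!: cInf_greatest cSup_least)
    have "\<bar>f (max x y) - f (min x y)\<bar> \<le> v (max x y) - v (min x y)" using m sub by (intro bd) auto
    also have "\<dots> \<le> osc J" unfolding osc_def
      using 1 2 m sub by (intro diff_mono vmono) auto
    finally show ?thesis by (auto simp: max_def min_def split: if_splits)
  qed
  have osc0: "0 \<le> osc J" if "J \<in> \<eta>" for J
    using partition_nonempty[OF \<eta> that] osc[OF that] by (metis abs_ge_zero all_not_in_conv order_trans)
  have "(LINT x|leb01. \<bar>step_average \<eta> f x - f x\<bar>) \<le> (LINT x|leb01. (\<Sum>J\<in>\<eta>. indicator J x * osc J))"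
  proof (rule integral_mono)
    show "integrable leb01 (\<lambda>x. \<bar>step_average \<eta> f x - f x\<bar>)"
      using step_average_dominated(1)[OF fv] int
      by (intro integrable_abs Bochner_Integration.integrable_diff) (auto intro: var_dominated_integrable)
    show "integrable leb01 (\<lambda>x. \<Sum>J\<in>\<eta>. indicator J x * osc J)"
      by (intro Bochner_Integration.integrable_sum integrable_indicator_mult partition_facts) simp_all
    fix x :: real assume "x \<in> space leb01"
    then obtain J where J: "J \<in> \<eta>" "x \<in> J" using partition_cover[of x] by auto
    have "\<bar>average J f - f x\<bar> \<le> osc J"
    proof -
      have near: "f x - osc J \<le> f y \<and> f y \<le> f x + osc J" if "y \<in> J" for y
        using osc[OF J(1) that J(2)] by (simp add: abs_le_iff algebra_simps)
      have "f x - osc J \<le> average J f" "average J f \<le> f x + osc J"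
        by (rule average_ge average_le; use near partition_facts J int in simp)+
      then show ?thesis by (simp add: abs_le_iff)
    qed
    then have "\<bar>step_average \<eta> f x - f x\<bar> \<le> indicator J x * osc J" using J by (simp add: step_average_eq)
    also have "\<dots> \<le> (\<Sum>J\<in>\<eta>. indicator J x * osc J)"
      by (rule member_le_sum[OF J(1)]) (use osc0 partition_facts in auto)
    finally show "\<bar>step_average \<eta> f x - f x\<bar> \<le> (\<Sum>J\<in>\<eta>. indicator J x * osc J)" .
  qed
  also have "\<dots> = (\<Sum>J\<in>\<eta>. osc J * measure leb01 J)"
  proof -
    have "(LINT x|leb01. (\<Sum>J\<in>\<eta>. indicator J x * osc J)) = (\<Sum>J\<in>\<eta>. LINT x|leb01. indicator J x * osc J)"
      by (intro Bochner_Integration.integral_sum integrable_indicator_mult partition_facts) simp_all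
    also have "\<dots> = (\<Sum>J\<in>\<eta>. osc J * measure leb01 J)"
      by (intro sum.cong integral_indicator_const partition_facts) simp_all
    finally show ?thesis .
  qed
  also have "\<dots> \<le> (\<Sum>J\<in>\<eta>. osc J * \<epsilon>)"
    by (intro sum_mono mult_left_mono partition_measure[OF \<eta>] osc0)
  also have "\<dots> = \<epsilon> * (\<Sum>J\<in>\<eta>. osc J)" by (simp add: sum_distrib_left mult.commute)
  also have "\<dots> \<le> \<epsilon> * (v 1 - v 0)"
  proof (rule mult_left_mono)
    show "(\<Sum>J\<in>\<eta>. osc J) \<le> v 1 - v 0" unfolding osc_def
      by (rule telescoping_oscillation[of \<eta> 0 1 v])
        (use \<eta> partition_subset[OF \<eta>] vmono in \<open>auto simp: interval_partition_def partition_on_def mono_on_def\<close>)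
    obtain J where "J \<in> \<eta>" using partition_cover[of 0] by auto
    from partition_measure[OF \<eta> this] show "0 \<le> \<epsilon>" by (rule order_trans[OF measure_nonneg])
  qed
  finally show ?thesis .
qed

lemma subalgebra_partition: "subalgebra leb01 (sigma {0..1} \<eta>)"
proof -
  have "sigma_sets (space leb01) \<eta> \<subseteq> sets leb01"
    by (rule sets.sigma_sets_subset) (use partition_facts in auto)
  moreover have "\<eta> \<subseteq> Pow {0..1}" using partition_subset[OF \<eta>] by auto
  ultimately show ?thesis by (simp add: subalgebra_def sets_measure_of)
qed

text \<open>
  Every set in the generated \<open>\<sigma>\<close>-algebra is a union of cells, so the defining property of conditional
  expectation needs to be checked on single cells only.
\<close>

lemma ulam_projection_eq_step_average:
  assumes f: "integrable leb01 f"
  shows "AE x in leb01. ulam_projection \<eta> f x = step_average \<eta> f x"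
proof -
  interpret finite_measure_subalgebra leb01 "sigma {0..1} \<eta>"
    by unfold_locales (rule subalgebra_partition)
  have sets: "sets (sigma {0..1} \<eta>) = sigma_sets {0..1} \<eta>"
    using partition_subset[OF \<eta>] by (intro sets_measure_of) auto
  have atoms: "\<forall>J\<in>\<eta>. J \<subseteq> A \<or> J \<inter> A = {}" if "A \<in> sigma_sets {0..1} \<eta>" for A
    using that
  proof (induction rule: sigma_sets.induct)
    case (Basic A)
    then show ?case using partition_disjoint[OF \<eta>] by blast
  next
    case (Compl A)
    then show ?case using partition_subset[OF \<eta>] by blast
  next
    case (Union A)
    show ?case
    proof
      fix J assume "J \<in> \<eta>"
      then have "\<And>i. J \<subseteq> A i \<or> J \<inter> A i = {}" using Union.IH by blast
      then show "J \<subseteq> (\<Union>i. A i) \<or> J \<inter> (\<Union>i. A i) = {}" by (cases "\<exists>i. J \<subseteq> A i") blast+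
    qed
  qed simp
  have step_meas: "step_average \<eta> f \<in> borel_measurable (sigma {0..1} \<eta>)"
  proof -
    have "J \<in> sets (sigma {0..1} \<eta>)" if "J \<in> \<eta>" for J using that by (simp add: sets sigma_sets.Basic)
    then show ?thesis unfolding step_average_def
      by (intro borel_measurable_sum borel_measurable_times borel_measurable_indicator borel_measurable_const)
  qed
  have step_int: "integrable leb01 (step_average \<eta> f)"
    unfolding step_average_def
    by (intro Bochner_Integration.integrable_sum integrable_indicator_mult partition_facts) simp_all
  show ?thesis unfolding ulam_projection_def
  proof (rule real_cond_exp_charact[OF _ f step_int step_meas])
    fix A assume "A \<in> sets (sigma {0..1} \<eta>)"
    then have at: "\<And>J. J \<in> \<eta> \<Longrightarrow> J \<subseteq> A \<or> J \<inter> A = {}" using atoms sets by auto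
    have A: "A \<in> sets leb01" using \<open>A \<in> sets (sigma {0..1} \<eta>)\<close> subalg by (auto simp: subalgebra_def)
    have split: "(LINT x|leb01. indicator A x * g x) = (\<Sum>J\<in>{J\<in>\<eta>. J \<subseteq> A}. LINT x|leb01. indicator J x * g x)"
      if g: "integrable leb01 g" for g :: "real \<Rightarrow> real"
    proof -
      have "(LINT x|leb01. indicator A x * g x) = (LINT x|leb01. (\<Sum>J\<in>{J\<in>\<eta>. J \<subseteq> A}. indicator J x * g x))"
      proof (rule Bochner_Integration.integral_cong)
        fix x assume "x \<in> space leb01"
        then obtain J where J: "J \<in> \<eta>" "x \<in> J" using partition_cover[of x] by auto
        have "(\<Sum>J\<in>{J\<in>\<eta>. J \<subseteq> A}. indicator J x * g x) = (\<Sum>J'\<in>{J\<in>\<eta>. J \<subseteq> A}. if J' = J then g x else 0)"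
          by (intro sum.cong) (use J partition_disjoint[OF \<eta>] in \<open>auto simp: indicator_def\<close>)
        also have "\<dots> = indicator A x * g x"
          using at[OF J(1)] J partition_facts(1) by (auto simp: indicator_def)
        finally show "indicator A x * g x = (\<Sum>J\<in>{J\<in>\<eta>. J \<subseteq> A}. indicator J x * g x)" by simp
      qed simp
      also have "\<dots> = (\<Sum>J\<in>{J\<in>\<eta>. J \<subseteq> A}. LINT x|leb01. indicator J x * g x)"
        by (intro Bochner_Integration.integral_sum integrable_indicator_mult partition_facts g) auto
      finally show ?thesis .
    qed
    have "(LINT x|leb01. indicator J x * f x) = (LINT x|leb01. indicator J x * step_average \<eta> f x)" if J: "J \<in> \<eta>" for J
    proof -
      have "(LINT x|leb01. indicator J x * step_average \<eta> f x) = (LINT x|leb01. indicator J x * average J f)"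
        by (intro Bochner_Integration.integral_cong) (auto simp: indicator_def step_average_eq[OF J])
      then show ?thesis
        by (simp only: integral_eq_average[OF partition_facts(2)[OF J] f] integral_indicator_const[OF partition_facts(2)[OF J]])
    qed
    then show "(LINT x:A|leb01. f x) = (LINT x:A|leb01. step_average \<eta> f x)"
      by (simp add: set_lebesgue_integral_def split[OF f] split[OF step_int])
  qed
qed

end

section \<open>Compactness of bounded variation\<close>

text \<open>
  Helly's selection theorem concerns right-continuous functions. A monotone function agrees with its
  right-continuous version at its points of continuity.
\<close>

definition right_limit :: "(real \<Rightarrow> real) \<Rightarrow> real \<Rightarrow> real"
  where "right_limit p x = (INF y\<in>{x<..}. p y)"

lemma right_limit_props:
  assumes p: "mono p" and M: "\<And>x. \<bar>p x\<bar> \<le> M"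
  shows "x < y \<Longrightarrow> right_limit p x \<le> p y" "p x \<le> right_limit p x" "mono (right_limit p)"
    "\<bar>right_limit p x\<bar> \<le> M" "continuous (at_right x) (right_limit p)"
    "isCont p x \<Longrightarrow> right_limit p x = p x"
proof -
  have bdd: "bdd_below (p ` A)" for A
    using M by (intro bdd_belowI2[of _ "-M"]) (auto simp: abs_le_iff minus_le_iff)
  show upper: "right_limit p x \<le> p y" if "x < y" for x y
    unfolding right_limit_def using that by (intro cINF_lower bdd) auto
  have ge: "c \<le> right_limit p x" if "\<And>y. x < y \<Longrightarrow> c \<le> p y" for c x
    unfolding right_limit_def using that by (intro cINF_greatest) auto
  show lower: "p x \<le> right_limit p x" for x
    using p by (intro ge) (auto simp: mono_def)
  show mono: "mono (right_limit p)"
    by (intro monoI ge upper) auto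
  have "right_limit p x \<le> p (x + 1)" by (rule upper) simp
  then show "\<bar>right_limit p x\<bar> \<le> M" using lower[of x] M[of x] M[of "x + 1"] by (simp add: abs_le_iff)
  show "continuous (at_right x) (right_limit p)"
  proof (subst continuous_at_right_real_increasing)
    show "right_limit p x \<le> right_limit p y" if "x \<le> y" for x y using mono that by (simp add: mono_def)
    show "\<forall>e>0. \<exists>d>0. right_limit p (x + d) - right_limit p x < e"
    proof (intro allI impI)
      fix e :: real assume "0 < e"
      then obtain y where y: "x < y" "p y < right_limit p x + e"
        using ge[of x "right_limit p x + e"] by (force simp: not_le)
      have "right_limit p (x + (y - x) / 2) \<le> p y" using y by (intro upper) (simp add: field_simps)
      then show "\<exists>d>0. right_limit p (x + d) - right_limit p x < e"
        using y by (intro exI[of _ "(y - x) / 2"]) auto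
    qed
  qed
  show "right_limit p x = p x" if "isCont p x"
  proof (rule antisym[OF _ lower])
    have "(p \<longlongrightarrow> p x) (at_right x)"
      using that by (simp add: isCont_def filterlim_at_split)
    then show "right_limit p x \<le> p x"
      by (rule tendsto_lowerbound) (auto simp: eventually_at_right_field intro!: exI[of _ "x + 1"] upper)
  qed
qed

lemma monotone_selection:
  fixes p :: "nat \<Rightarrow> real \<Rightarrow> real"
  assumes p: "\<And>n. mono (p n)" and M: "\<And>n x. \<bar>p n x\<bar> \<le> M"
  shows "\<exists>s P D. strict_mono s \<and> mono P \<and> countable D \<and> (\<forall>x. x \<notin> D \<longrightarrow> (\<lambda>n. p (s n) x) \<longlonglongrightarrow> P x)"
proof -
  obtain s P where s: "strict_mono s" and P: "mono P"
    and lim: "\<And>x. isCont P x \<Longrightarrow> (\<lambda>n. right_limit (p (s n)) x) \<longlonglongrightarrow> P x"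
    using Helly_selection[of "\<lambda>n. right_limit (p n)" M] right_limit_props[OF p M] by blast
  define D where "D = {x. \<not> isCont P x} \<union> (\<Union>n. {x. \<not> isCont (p n) x})"
  have "countable D" unfolding D_def using mono_ctble_discont[OF P] mono_ctble_discont[OF p] by auto
  moreover have "(\<lambda>n. p (s n) x) \<longlonglongrightarrow> P x" if "x \<notin> D" for x
    using lim[of x] that right_limit_props(6)[OF p M] by (simp add: D_def)
  ultimately show ?thesis using s P by blast
qed

lemma AE_leb01_not_countable: "countable D \<Longrightarrow> AE x in leb01. x \<notin> D"
proof -
  assume "countable D"
  then have "D \<in> null_sets lebesgue" using countable_imp_null_set_lborel null_sets_completionI by blast
  then have "AE x in lebesgue. x \<notin> D" by (rule AE_not_in)
  then show ?thesis by (subst AE_restrict_space_iff) auto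
qed

text \<open>
  The sum and the difference of majorant and function are monotone and bounded, so both have
  subsequences that converge off a countable set. The limits recombine to a function with a majorant, and
  dominated convergence gives convergence in \<open>L\<^sup>1\<close>.
\<close>

lemma BV_selection:
  fixes f :: "nat \<Rightarrow> real \<Rightarrow> real"
  assumes int: "\<And>n. integrable leb01 (f n)" and fin: "\<And>n. ess_var (f n) < \<infinity>"
    and C: "\<And>n. Var (f n) \<le> C" and D: "\<And>n. (LINT x|leb01. \<bar>f n x\<bar>) \<le> D"
  shows "\<exists>s g. strict_mono s \<and> integrable leb01 g \<and> ess_var g < \<infinity> \<and> Var g \<le> C \<and>
    (\<lambda>n. LINT x|leb01. \<bar>f (s n) x - g x\<bar>) \<longlonglongrightarrow> 0"
proof -
  have "\<forall>n. \<exists>g v. (AE x in leb01. g x = f n x) \<and> var_dominated g v \<and> v 1 - v 0 \<le> Var (f n) + 1 / real (Suc n)"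
    by (intro allI Var_representative fin) simp
  then obtain g v where g: "\<And>n. AE x in leb01. g n x = f n x" and dom: "\<And>n. var_dominated (g n) (v n)"
    and v: "\<And>n. v n 1 - v n 0 \<le> Var (f n) + 1 / real (Suc n)" by metis
  have vC: "v n 1 - v n 0 \<le> C + 1 / real (Suc n)" for n using v[of n] C[of n] by simp
  have vC1: "v n 1 - v n 0 \<le> C + 1" for n
  proof -
    have "1 / real (Suc n) \<le> 1" by simp
    then show ?thesis using vC[of n] by linarith
  qed
  \<comment> \<open>The oscillation bound turns the bound on the mean of \<open>\<bar>g n\<bar>\<close> into one at every point.\<close>
  have g_bound: "\<bar>g n x\<bar> \<le> D + (C + 1)" if x: "x \<in> {0..1}" for n x
  proof -
    have "(LINT y|leb01. \<bar>g n x\<bar> - (C + 1)) \<le> (LINT y|leb01. \<bar>g n y\<bar>)"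
    proof (rule integral_mono)
      show "\<bar>g n x\<bar> - (C + 1) \<le> \<bar>g n y\<bar>" if "y \<in> space leb01" for y
        using var_dominated_osc[OF dom x, of y n] vC1[of n] that by auto
    qed (use var_dominated_integrable[OF dom] in auto)
    also have "(LINT y|leb01. \<bar>g n y\<bar>) = (LINT y|leb01. \<bar>f n y\<bar>)"
      by (rule integral_cong_AE) (use g[of n] int[of n] var_dominated_integrable[OF dom] in auto)
    finally show ?thesis using D[of n] by simp
  qed
  \<comment> \<open>Majorants are normalized at 0, and everything is extended by constants to the whole line.\<close>
  define w where "w n x = v n x - v n 0" for n x
  define cl where "cl x = max 0 (min 1 x)" for x :: real
  have cl: "cl x \<in> {0..1}" "x \<le> y \<Longrightarrow> cl x \<le> cl y" for x y by (auto simp: cl_def)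
  have cl_id: "x \<in> {0..1} \<Longrightarrow> cl x = x" for x by (auto simp: cl_def)
  have w: "0 \<le> w n x" "w n x \<le> C + 1" if "x \<in> {0..1}" for n x
    using var_dominatedD[OF dom, of 0 x n] var_dominatedD[OF dom, of x 1 n] that vC1[of n] by (auto simp: w_def)
  define p where "p n x = w n (cl x) + g n (cl x)" for n x
  define q where "q n x = w n (cl x) - g n (cl x)" for n x
  define M where "M = (C + 1) + (D + (C + 1))"
  have mono_pq: "mono (p n)" "mono (q n)" for n
    using dom[of n] cl unfolding var_dominated_def mono_on_def mono_def p_def q_def w_def by auto
  have bound_pq: "\<bar>p n x\<bar> \<le> M" "\<bar>q n x\<bar> \<le> M" for n x
    using w[OF cl(1), of n x] g_bound[OF cl(1), of n x] by (auto simp: p_def q_def M_def abs_le_iff)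
  obtain s1 P D1 where s1: "strict_mono s1" and P: "mono P" and D1: "countable D1"
    and lim1: "\<And>x. x \<notin> D1 \<Longrightarrow> (\<lambda>n. p (s1 n) x) \<longlonglongrightarrow> P x"
    using monotone_selection[of p M] mono_pq bound_pq by blast
  obtain s2 Q D2 where s2: "strict_mono s2" and Q: "mono Q" and D2: "countable D2"
    and lim2: "\<And>x. x \<notin> D2 \<Longrightarrow> (\<lambda>n. q (s1 (s2 n)) x) \<longlonglongrightarrow> Q x"
    using monotone_selection[of "\<lambda>n. q (s1 n)" M] mono_pq bound_pq by blast
  define s where "s n = s1 (s2 n)" for n
  have s: "strict_mono s" using s1 s2 by (auto simp: s_def strict_mono_def)
  have limP: "(\<lambda>n. p (s n) x) \<longlonglongrightarrow> P x" if "x \<notin> D1" for x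
    using LIMSEQ_subseq_LIMSEQ[OF lim1[OF that] s2] by (simp add: s_def o_def)
  have limQ: "(\<lambda>n. q (s n) x) \<longlonglongrightarrow> Q x" if "x \<notin> D2" for x
    using lim2[OF that] by (simp add: s_def)
  define h where "h x = (P x - Q x) / 2" for x
  define u where "u x = (P x + Q x) / 2" for x
  have hu: "var_dominated h u"
  proof -
    have "(\<lambda>x. u x + h x) = P" "(\<lambda>x. u x - h x) = Q" by (auto simp: h_def u_def field_simps)
    then show ?thesis using P Q by (auto simp: var_dominated_def intro: mono_imp_mono_on)
  qed
  \<comment> \<open>The limits may jump at the end points, so the total increment is read off at points of
    convergence outside the unit interval.\<close>
  have u_le: "u 1 - u 0 \<le> C"
  proof -
    have "\<exists>x. a < x \<and> x < b \<and> x \<notin> D1 \<union> D2" if "a < b" for a b :: real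
    proof (rule ccontr)
      assume "\<nexists>x. a < x \<and> x < b \<and> x \<notin> D1 \<union> D2"
      then have "{a<..<b} \<subseteq> D1 \<union> D2" by auto
      then have "countable {a<..<b}" using D1 D2 by (meson countable_Un countable_subset)
      then show False using uncountable_open_interval[of a b] that by simp
    qed
    from this[of "-1" 0] this[of 1 2] obtain x0 x1 where
      x0: "x0 < 0" "x0 \<notin> D1" "x0 \<notin> D2" and x1: "1 < x1" "x1 \<notin> D1" "x1 \<notin> D2" by auto
    have inc: "(\<lambda>n. ((p (s n) x1 + q (s n) x1) - (p (s n) x0 + q (s n) x0)) / 2) \<longlonglongrightarrow> ((P x1 + Q x1) - (P x0 + Q x0)) / 2"
      by (intro tendsto_intros limP limQ x0 x1) simp
    have bd: "(\<lambda>n. C + 1 / real (Suc n)) \<longlonglongrightarrow> C + 0"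
      using LIMSEQ_inverse_real_of_nat by (intro tendsto_intros) (simp add: inverse_eq_divide)
    have inc_le: "((p (s n) x1 + q (s n) x1) - (p (s n) x0 + q (s n) x0)) / 2 \<le> C + 1 / real (Suc n)" for n
    proof -
      have "cl x1 = 1" "cl x0 = 0" using x0 x1 by (auto simp: cl_def)
      then have "((p (s n) x1 + q (s n) x1) - (p (s n) x0 + q (s n) x0)) / 2 = v (s n) 1 - v (s n) 0"
        by (simp add: p_def q_def w_def field_simps)
      also have "\<dots> \<le> C + 1 / real (Suc (s n))" by (rule vC)
      also have "\<dots> \<le> C + 1 / real (Suc n)"
        using seq_suble[OF s, of n] by (intro add_left_mono divide_left_mono) auto
      finally show ?thesis .
    qed
    have "((P x1 + Q x1) - (P x0 + Q x0)) / 2 \<le> C + 0"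
      by (rule LIMSEQ_le[OF inc bd]) (use inc_le in blast)
    moreover have "P 1 \<le> P x1" "Q 1 \<le> Q x1" "P x0 \<le> P 0" "Q x0 \<le> Q 0"
      using x0 x1 monoD[OF P, of 1 x1] monoD[OF Q, of 1 x1] monoD[OF P, of x0 0] monoD[OF Q, of x0 0] by auto
    ultimately show ?thesis by (simp add: u_def field_simps)
  qed
  have "(\<lambda>n. LINT x|leb01. \<bar>f (s n) x - h x\<bar>) \<longlonglongrightarrow> (LINT x|leb01. 0)"
  proof (rule integral_dominated_convergence[where w = "\<lambda>x. D + (C + 1) + \<bar>h x\<bar>"])
    have AE_g: "AE x in leb01. \<forall>n. g n x = f n x" using g by (simp add: AE_all_countable)
    show "AE x in leb01. (\<lambda>n. \<bar>f (s n) x - h x\<bar>) \<longlonglongrightarrow> 0"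
      using AE_g AE_leb01_not_countable[OF D1] AE_leb01_not_countable[OF D2] AE_space
    proof eventually_elim
      case (elim x)
      then have "(\<lambda>n. (p (s n) x - q (s n) x) / 2) \<longlonglongrightarrow> h x"
        unfolding h_def by (intro tendsto_intros limP limQ) auto
      moreover have "(p (s n) x - q (s n) x) / 2 = f (s n) x" for n
        using elim by (simp add: p_def q_def cl_id)
      ultimately have "(\<lambda>n. f (s n) x) \<longlonglongrightarrow> h x" by simp
      then show ?case by (intro tendsto_rabs_zero LIM_zero)
    qed
    show "AE x in leb01. norm \<bar>f (s n) x - h x\<bar> \<le> D + (C + 1) + \<bar>h x\<bar>" for n
      using AE_g AE_space
    proof eventually_elim
      case (elim x)
      then show ?case using g_bound[of x "s n"] by auto
    qed
    show "(\<lambda>x. \<bar>f (s n) x - h x\<bar>) \<in> borel_measurable leb01" for n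
      using int[of "s n"] var_dominated_integrable[OF hu] by measurable
    show "integrable leb01 (\<lambda>x. D + (C + 1) + \<bar>h x\<bar>)"
      using var_dominated_integrable[OF hu] by simp
  qed simp
  then show ?thesis
    using s Var_leI[of h h u] hu u_le var_dominated_integrable[OF hu]
    by (intro exI[of _ s] exI[of _ h]) auto
qed

section \<open>The normed space of integrable functions\<close>

text \<open>
  Restricting a partial equivalence to integrable functions makes the quotient a real normed space, to
  which the abstract results apply.
\<close>

definition L1_rel :: "(real \<Rightarrow> real) \<Rightarrow> (real \<Rightarrow> real) \<Rightarrow> bool"
  where "L1_rel f g \<longleftrightarrow> integrable leb01 f \<and> integrable leb01 g \<and> (AE x in leb01. f x = g x)"

quotient_type L1 = "real \<Rightarrow> real" / partial: L1_rel
proof (rule part_equivpI)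
  show "\<exists>f. L1_rel f f" by (rule exI[of _ "\<lambda>_. 0"]) (simp add: L1_rel_def)
  show "symp L1_rel" by (auto simp: L1_rel_def intro!: sympI elim: AE_mp)
  show "transp L1_rel"
  proof (rule transpI)
    fix f g h assume "L1_rel f g" "L1_rel g h"
    then show "L1_rel f h" unfolding L1_rel_def by (auto elim: eventually_elim2)
  qed
qed

lemma integrable_rep_L1 [simp, intro]: "integrable leb01 (rep_L1 x)"
  using Quotient3_rep_reflp[OF Quotient3_L1, of x] by (simp add: L1_rel_def)

lemma measurable_rep_L1 [simp, measurable]: "rep_L1 x \<in> borel_measurable leb01"
  using integrable_rep_L1 by (rule borel_measurable_integrable)

lemma abs_rep_L1 [simp]: "abs_L1 (rep_L1 x) = x"
  by (rule Quotient3_abs_rep[OF Quotient3_L1])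

lemma abs_L1_eqI:
  assumes "integrable leb01 f" "integrable leb01 g" "AE t in leb01. f t = g t"
  shows "abs_L1 f = abs_L1 g"
  using assms Quotient3_rel_abs[OF Quotient3_L1, of f g] by (simp add: L1_rel_def)

lemma rep_abs_L1:
  assumes "integrable leb01 f"
  shows "AE t in leb01. rep_L1 (abs_L1 f) t = f t"
  using rep_abs_rsp_left[OF Quotient3_L1, of f f] assms by (simp add: L1_rel_def)

lemma L1_eqI: "(AE t in leb01. rep_L1 x t = rep_L1 y t) \<Longrightarrow> x = y"
  by (metis abs_L1_eqI abs_rep_L1 integrable_rep_L1)

instantiation L1 :: real_normed_vector
begin

definition "0 = abs_L1 (\<lambda>_. 0)"
definition "x + y = abs_L1 (\<lambda>t. rep_L1 x t + rep_L1 y t)"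
definition "x - y = abs_L1 (\<lambda>t. rep_L1 x t - rep_L1 y t)"
definition "- x = abs_L1 (\<lambda>t. - rep_L1 x t)"
definition "c *\<^sub>R x = abs_L1 (\<lambda>t. c * rep_L1 x t)"
definition "norm x = (LINT t|leb01. \<bar>rep_L1 x t\<bar>)"
definition "sgn x = inverse (norm x) *\<^sub>R x" for x :: L1
definition "dist x y = norm (x - y)" for x y :: L1
definition "(uniformity :: (L1 \<times> L1) filter) = (INF e\<in>{0<..}. principal {(x, y). dist x y < e})"
definition "open U \<longleftrightarrow> (\<forall>x\<in>U. eventually (\<lambda>(x', y). x' = x \<longrightarrow> y \<in> U) uniformity)" for U :: "L1 set"

lemma rep_L1_arith:
  "AE t in leb01. rep_L1 0 t = 0"
  "AE t in leb01. rep_L1 (x + y) t = rep_L1 x t + rep_L1 y t"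
  "AE t in leb01. rep_L1 (x - y) t = rep_L1 x t - rep_L1 y t"
  "AE t in leb01. rep_L1 (- x) t = - rep_L1 x t"
  "AE t in leb01. rep_L1 (c *\<^sub>R x) t = c * rep_L1 x t"
  unfolding zero_L1_def plus_L1_def minus_L1_def uminus_L1_def scaleR_L1_def
  by (intro rep_abs_L1; simp)+

instance
proof
  fix x y z :: L1 and a b :: real
  show "x + y + z = x + (y + z)"
    by (rule L1_eqI) (use rep_L1_arith(2)[of "x + y" z] rep_L1_arith(2)[of x y] rep_L1_arith(2)[of x "y + z"] rep_L1_arith(2)[of y z] in \<open>eventually_elim, simp\<close>)
  show "x + y = y + x"
    by (rule L1_eqI) (use rep_L1_arith(2)[of x y] rep_L1_arith(2)[of y x] in \<open>eventually_elim, simp\<close>)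
  show "0 + x = x"
    by (rule L1_eqI) (use rep_L1_arith(2)[of 0 x] rep_L1_arith(1) in \<open>eventually_elim, simp\<close>)
  show "- x + x = 0"
    by (rule L1_eqI) (use rep_L1_arith(2)[of "- x" x] rep_L1_arith(4)[of x] rep_L1_arith(1) in \<open>eventually_elim, simp\<close>)
  show "x - y = x + - y"
    by (rule L1_eqI) (use rep_L1_arith(2)[of x "- y"] rep_L1_arith(4)[of y] rep_L1_arith(3)[of x y] in \<open>eventually_elim, simp\<close>)
  show "a *\<^sub>R (x + y) = a *\<^sub>R x + a *\<^sub>R y"
    by (rule L1_eqI) (use rep_L1_arith(5)[of a "x + y"] rep_L1_arith(2)[of x y] rep_L1_arith(2)[of "a *\<^sub>R x" "a *\<^sub>R y"]
      rep_L1_arith(5)[of a x] rep_L1_arith(5)[of a y] in \<open>eventually_elim, simp add: distrib_left\<close>)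
  show "(a + b) *\<^sub>R x = a *\<^sub>R x + b *\<^sub>R x"
    by (rule L1_eqI) (use rep_L1_arith(5)[of "a + b" x] rep_L1_arith(2)[of "a *\<^sub>R x" "b *\<^sub>R x"]
      rep_L1_arith(5)[of a x] rep_L1_arith(5)[of b x] in \<open>eventually_elim, simp add: distrib_right\<close>)
  show "a *\<^sub>R b *\<^sub>R x = (a * b) *\<^sub>R x"
    by (rule L1_eqI) (use rep_L1_arith(5)[of a "b *\<^sub>R x"] rep_L1_arith(5)[of b x] rep_L1_arith(5)[of "a * b" x] in \<open>eventually_elim, simp\<close>)
  show "1 *\<^sub>R x = x"
    by (rule L1_eqI) (use rep_L1_arith(5)[of 1 x] in \<open>eventually_elim, simp\<close>)
  show "norm x = 0 \<longleftrightarrow> x = 0"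
  proof
    assume "norm x = 0"
    then have zero: "AE t in leb01. \<bar>rep_L1 x t\<bar> = 0"
      by (subst (asm) norm_L1_def, subst (asm) integral_nonneg_eq_0_iff_AE) auto
    show "x = 0" by (rule L1_eqI) (use zero rep_L1_arith(1) in \<open>eventually_elim, simp\<close>)
  next
    assume "x = 0"
    then have "AE t in leb01. \<bar>rep_L1 x t\<bar> = 0" using rep_L1_arith(1) by (auto elim: eventually_mono)
    then show "norm x = 0" unfolding norm_L1_def by (rule integral_eq_zero_AE)
  qed
  show "norm (x + y) \<le> norm x + norm y"
  proof -
    have "norm (x + y) \<le> (LINT t|leb01. \<bar>rep_L1 x t\<bar> + \<bar>rep_L1 y t\<bar>)"
      unfolding norm_L1_def
    proof (rule integral_mono_AE)
      show "AE t in leb01. \<bar>rep_L1 (x + y) t\<bar> \<le> \<bar>rep_L1 x t\<bar> + \<bar>rep_L1 y t\<bar>"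
        using rep_L1_arith(2)[of x y] by eventually_elim simp
    qed auto
    then show ?thesis by (simp add: norm_L1_def)
  qed
  show "norm (a *\<^sub>R x) = \<bar>a\<bar> * norm x"
  proof -
    have "norm (a *\<^sub>R x) = (LINT t|leb01. \<bar>a\<bar> * \<bar>rep_L1 x t\<bar>)"
      unfolding norm_L1_def
    proof (rule integral_cong_AE)
      show "AE t in leb01. \<bar>rep_L1 (a *\<^sub>R x) t\<bar> = \<bar>a\<bar> * \<bar>rep_L1 x t\<bar>"
        using rep_L1_arith(5)[of a x] by eventually_elim (simp add: abs_mult)
    qed auto
    then show ?thesis by (simp add: norm_L1_def)
  qed
qed (fact dist_L1_def sgn_L1_def uniformity_L1_def open_L1_def)+

end

lemma norm_abs_L1:
  assumes "integrable leb01 f"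
  shows "norm (abs_L1 f) = (LINT t|leb01. \<bar>f t\<bar>)"
  unfolding norm_L1_def
  by (rule integral_cong_AE) (use rep_abs_L1[OF assms] assms in \<open>auto elim!: eventually_mono\<close>)

lemma abs_L1_diff:
  assumes "integrable leb01 f" "integrable leb01 g"
  shows "abs_L1 f - abs_L1 g = abs_L1 (\<lambda>t. f t - g t)"
  unfolding minus_L1_def
  by (rule abs_L1_eqI) (use assms rep_abs_L1[OF assms(1)] rep_abs_L1[OF assms(2)] in \<open>auto elim: eventually_elim2\<close>)

definition BV_L1 :: "L1 set"
  where "BV_L1 = {x. ess_var (rep_L1 x) < \<infinity>}"

definition Var_L1 :: "L1 \<Rightarrow> real"
  where "Var_L1 x = Var (rep_L1 x)"

definition integral_L1 :: "L1 \<Rightarrow> real"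
  where "integral_L1 x = (LINT t|leb01. rep_L1 x t)"

lemma ess_var_rep_abs_L1: "integrable leb01 f \<Longrightarrow> ess_var (rep_L1 (abs_L1 f)) = ess_var f"
  by (intro ess_var_cong rep_abs_L1)

lemma integral_abs_L1: "integrable leb01 f \<Longrightarrow> integral_L1 (abs_L1 f) = (LINT t|leb01. f t)"
  unfolding integral_L1_def by (rule integral_cong_AE) (use rep_abs_L1 in auto)

lemma exists_interval_partition:
  assumes "0 < \<epsilon>"
  shows "\<exists>\<eta>. interval_partition \<epsilon> \<eta>"
proof -
  obtain n :: nat where n: "inverse (real (Suc n)) < \<epsilon>" using reals_Archimedean[OF assms] by blast
  define N where "N = real (Suc n)"
  have N: "0 < N" "1 / N < \<epsilon>" using n by (auto simp: N_def inverse_eq_divide)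
  define cell where "cell k = {x \<in> {0..1}. \<lfloor>N * x\<rfloor> = k}" for k
  define \<eta> where "\<eta> = (\<lambda>y. cell \<lfloor>N * y\<rfloor>) ` {0..1}"
  have "(\<lambda>y. \<lfloor>N * y\<rfloor>) ` {0..1} \<subseteq> {0..\<lfloor>N\<rfloor>}"
    using N by (auto intro!: floor_mono simp: mult_left_le)
  then have "finite ((\<lambda>y. \<lfloor>N * y\<rfloor>) ` {0..1})" by (rule finite_subset) simp
  then have "finite \<eta>" unfolding \<eta>_def by (metis finite_imageI image_image)
  moreover have "partition_on {0..1} \<eta>"
    by (rule partition_onI) (auto simp: \<eta>_def cell_def disjnt_def)
  moreover have "is_interval J \<and> measure leb01 J \<le> \<epsilon>" if "J \<in> \<eta>" for J
  proof -
    obtain k where k: "J = cell k" using \<open>J \<in> \<eta>\<close> by (auto simp: \<eta>_def)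
    have int: "is_interval J" unfolding is_interval_1
    proof (intro ballI allI impI)
      fix a b x assume ab: "a \<in> J" "b \<in> J" "a \<le> x \<and> x \<le> b"
      then have "\<lfloor>N * a\<rfloor> \<le> \<lfloor>N * x\<rfloor>" "\<lfloor>N * x\<rfloor> \<le> \<lfloor>N * b\<rfloor>"
        using N by (auto intro!: floor_mono)
      then show "x \<in> J" using ab by (auto simp: k cell_def)
    qed
    have sub: "J \<subseteq> {k / N..(k + 1) / N}"
    proof
      fix x assume "x \<in> J"
      then have "\<lfloor>N * x\<rfloor> = k" by (simp add: k cell_def)
      then have "k \<le> N * x" "N * x \<le> k + 1" by linarith+
      then show "x \<in> {k / N..(k + 1) / N}" using N by (simp add: field_simps)
    qed
    have "J \<subseteq> {0..1}" by (auto simp: k cell_def)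
    then have "measure leb01 J = measure lebesgue J" by (intro measure_restrict_space) auto
    also have "\<dots> \<le> measure lebesgue {k / N..(k + 1) / N}"
      by (rule measure_mono_fmeasurable[OF sub])
        (use int sub in \<open>auto intro!: fmeasurableD measurable_convex is_interval_convex bounded_subset[OF bounded_closed_interval]\<close>)
    also have "\<dots> = 1 / N" using N by (simp add: field_simps)
    finally show ?thesis using int N by simp
  qed
  ultimately show ?thesis unfolding interval_partition_def by blast
qed

lemma step_average_integrable:
  assumes "interval_partition \<epsilon> \<eta>"
  shows "integrable leb01 (step_average \<eta> f)"
  unfolding step_average_def
  by (intro Bochner_Integration.integrable_sum integrable_indicator_mult partition_sets[OF assms]) simp_all

text \<open>
  The bound serves twice: it makes averaging a contraction, and it shows that the average vanishes in
  norm when the integrals over all cells vanish.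
\<close>

lemma step_average_L1_le:
  assumes \<eta>: "interval_partition \<epsilon> \<eta>" and f: "integrable leb01 f"
  shows "(LINT x|leb01. \<bar>step_average \<eta> f x\<bar>) \<le> (\<Sum>J\<in>\<eta>. \<bar>LINT x|leb01. indicator J x * f x\<bar>)"
proof -
  have "(LINT x|leb01. \<bar>step_average \<eta> f x\<bar>) \<le> (LINT x|leb01. (\<Sum>J\<in>\<eta>. indicator J x * \<bar>average J f\<bar>))"
  proof (rule integral_mono)
    show "integrable leb01 (\<lambda>x. \<bar>step_average \<eta> f x\<bar>)" by (intro integrable_abs step_average_integrable[OF \<eta>])
    show "integrable leb01 (\<lambda>x. \<Sum>J\<in>\<eta>. indicator J x * \<bar>average J f\<bar>)"
      by (intro Bochner_Integration.integrable_sum integrable_indicator_mult partition_sets[OF \<eta>]) simp_all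
    show "\<bar>step_average \<eta> f x\<bar> \<le> (\<Sum>J\<in>\<eta>. indicator J x * \<bar>average J f\<bar>)" for x
      unfolding step_average_def by (rule order_trans[OF sum_abs]) (simp add: abs_mult)
  qed
  also have "\<dots> = (\<Sum>J\<in>\<eta>. LINT x|leb01. indicator J x * \<bar>average J f\<bar>)"
    by (intro Bochner_Integration.integral_sum integrable_indicator_mult partition_sets[OF \<eta>]) simp_all
  also have "\<dots> = (\<Sum>J\<in>\<eta>. \<bar>LINT x|leb01. indicator J x * f x\<bar>)"
  proof (rule sum.cong)
    fix J assume "J \<in> \<eta>"
    then have J: "J \<in> sets leb01" by (rule partition_sets[OF \<eta>])
    show "(LINT x|leb01. indicator J x * \<bar>average J f\<bar>) = \<bar>LINT x|leb01. indicator J x * f x\<bar>"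
      unfolding integral_indicator_const[OF J] integral_eq_average[OF J f] by (simp add: abs_mult)
  qed simp
  finally show ?thesis .
qed

lemma partition_sum_indicator:
  assumes \<eta>: "interval_partition \<epsilon> \<eta>" and x: "x \<in> {0..1}"
  shows "(\<Sum>J\<in>\<eta>. indicator J x * (c::real)) = c"
proof -
  obtain J where J: "J \<in> \<eta>" "x \<in> J" using partition_cover[OF \<eta> x] by blast
  have "(\<Sum>J'\<in>\<eta>. indicator J' x * c) = (\<Sum>J'\<in>\<eta>. if J' = J then c else 0)"
    by (intro sum.cong) (use J partition_disjoint[OF \<eta>] in \<open>auto simp: indicator_def\<close>)
  then show ?thesis using J partition_finite[OF \<eta>] by simp
qed

lemma step_average_L1_contraction:
  assumes \<eta>: "interval_partition \<epsilon> \<eta>" and f: "integrable leb01 f"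
  shows "(LINT x|leb01. \<bar>step_average \<eta> f x\<bar>) \<le> (LINT x|leb01. \<bar>f x\<bar>)"
proof -
  have "(\<Sum>J\<in>\<eta>. \<bar>LINT x|leb01. indicator J x * f x\<bar>) \<le> (\<Sum>J\<in>\<eta>. LINT x|leb01. indicator J x * \<bar>f x\<bar>)"
  proof (rule sum_mono)
    fix J
    have "\<bar>LINT x|leb01. indicator J x * f x\<bar> \<le> (LINT x|leb01. \<bar>indicator J x * f x\<bar>)"
      by (rule integral_abs_bound)
    then show "\<bar>LINT x|leb01. indicator J x * f x\<bar> \<le> (LINT x|leb01. indicator J x * \<bar>f x\<bar>)"
      by (simp add: abs_mult)
  qed
  also have "\<dots> = (LINT x|leb01. (\<Sum>J\<in>\<eta>. indicator J x * \<bar>f x\<bar>))"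
    by (intro Bochner_Integration.integral_sum[symmetric] integrable_indicator_mult partition_sets[OF \<eta>] integrable_abs f)
  also have "\<dots> = (LINT x|leb01. \<bar>f x\<bar>)"
    by (intro Bochner_Integration.integral_cong) (simp_all add: partition_sum_indicator[OF \<eta>])
  finally show ?thesis using step_average_L1_le[OF \<eta> f] by simp
qed

lemma L1_BV_representative:
  assumes "x \<in> BV_L1" "0 < e"
  shows "\<exists>g v. x = abs_L1 g \<and> integrable leb01 g \<and> var_dominated g v \<and> v 1 - v 0 \<le> Var_L1 x + e"
proof -
  obtain g v where g: "AE t in leb01. g t = rep_L1 x t" "var_dominated g v" "v 1 - v 0 \<le> Var_L1 x + e"
    using Var_representative[of "rep_L1 x" e] assms by (auto simp: BV_L1_def Var_L1_def)
  moreover have "integrable leb01 g" by (rule var_dominated_integrable[OF g(2)])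
  ultimately show ?thesis by (metis abs_L1_eqI abs_rep_L1 integrable_rep_L1)
qed

lemma BV_L1_absI:
  assumes "AE t in leb01. g t = f t" "var_dominated g v" "integrable leb01 f"
  shows "abs_L1 f \<in> BV_L1" "Var_L1 (abs_L1 f) \<le> v 1 - v 0"
  using Var_leI[OF assms(1,2)] by (simp_all add: BV_L1_def Var_L1_def ess_var_rep_abs_L1[OF assms(3)])

lemma one_BV_L1: "abs_L1 (\<lambda>_. 1) \<in> BV_L1"
  by (rule BV_L1_absI[of "\<lambda>_. 1" _ "\<lambda>_. 0"]) (auto simp: var_dominated_iff)

text \<open>
  The functionals required by \<open>separating\<close> are the integrals over the cells of a fine partition: if
  they all vanish, then so does the average, which is within mesh times variation of the function.
\<close>

interpretation L1: bv_space BV_L1 Var_L1 integral_L1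
proof (rule bv_space.intro)
  have zero: "0 \<in> BV_L1"
    unfolding zero_L1_def by (rule BV_L1_absI[of "\<lambda>_. 0" _ "\<lambda>_. 0"]) (auto simp: var_dominated_iff)
  have add: "x + y \<in> BV_L1 \<and> Var_L1 (x + y) \<le> Var_L1 x + Var_L1 y" if "x \<in> BV_L1" "y \<in> BV_L1" for x y
    using Var_add[of "rep_L1 x" "rep_L1 y"] that ess_var_cong[OF rep_L1_arith(2)[of x y]]
    by (simp add: BV_L1_def Var_L1_def)
  have scale: "c *\<^sub>R x \<in> BV_L1 \<and> Var_L1 (c *\<^sub>R x) = \<bar>c\<bar> * Var_L1 x" if "x \<in> BV_L1" for c x
    using Var_scale[of "rep_L1 x" c] Var_scale_le(1)[of "rep_L1 x" c] that ess_var_cong[OF rep_L1_arith(5)[of c x]]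
    by (simp add: BV_L1_def Var_L1_def)
  show "subspace BV_L1" using zero add scale by (auto simp: subspace_def)
  show "0 \<le> Var_L1 x" for x by (simp add: Var_L1_def)
  show "Var_L1 (x + y) \<le> Var_L1 x + Var_L1 y" if "x \<in> BV_L1" "y \<in> BV_L1" for x y using add that by blast
  show "Var_L1 (c *\<^sub>R x) = \<bar>c\<bar> * Var_L1 x" if "x \<in> BV_L1" for c x using scale that by blast
  show "linear integral_L1"
  proof (rule linearI)
    show "integral_L1 (x + y) = integral_L1 x + integral_L1 y" for x y
      unfolding plus_L1_def by (subst integral_abs_L1) (auto simp: integral_L1_def)
    show "integral_L1 (c *\<^sub>R x) = c *\<^sub>R integral_L1 x" for c x
      unfolding scaleR_L1_def by (subst integral_abs_L1) (auto simp: integral_L1_def)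
  qed
  show "\<bar>integral_L1 x\<bar> \<le> norm x" for x
    unfolding integral_L1_def norm_L1_def by (rule integral_abs_bound)
  show "\<exists>x\<in>BV_L1. \<exists>s. strict_mono s \<and> Var_L1 x \<le> C \<and> (\<lambda>n. X (s n)) \<longlonglongrightarrow> x"
    if "\<And>n. X n \<in> BV_L1" "\<And>n::nat. Var_L1 (X n) \<le> C" "\<And>n. norm (X n) \<le> D" for X C D
  proof -
    have "\<exists>s g. strict_mono s \<and> integrable leb01 g \<and> ess_var g < \<infinity> \<and> Var g \<le> C \<and>
        (\<lambda>n. LINT t|leb01. \<bar>rep_L1 (X (s n)) t - g t\<bar>) \<longlonglongrightarrow> 0"
      by (rule BV_selection[where D = D]) (use that in \<open>simp_all add: BV_L1_def Var_L1_def norm_L1_def\<close>)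
    then obtain s g where g: "strict_mono s" "integrable leb01 g" "ess_var g < \<infinity>" "Var g \<le> C"
      "(\<lambda>n. LINT t|leb01. \<bar>rep_L1 (X (s n)) t - g t\<bar>) \<longlonglongrightarrow> 0"
      by blast
    have "norm (X (s n) - abs_L1 g) = (LINT t|leb01. \<bar>rep_L1 (X (s n)) t - g t\<bar>)" for n
      using abs_L1_diff[of "rep_L1 (X (s n))" g] g(2) by (simp add: norm_abs_L1)
    then have "(\<lambda>n. norm (X (s n) - abs_L1 g)) \<longlonglongrightarrow> 0" using g(5) by simp
    then have "(\<lambda>n. X (s n)) \<longlonglongrightarrow> abs_L1 g" by (rule LIM_zero_cancel[OF tendsto_norm_zero_cancel])
    then show ?thesis using g
      by (intro bexI[of _ "abs_L1 g"] exI[of _ s]) (auto simp: BV_L1_def Var_L1_def ess_var_rep_abs_L1)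
  qed
  show "\<exists>\<Phi>::(L1 \<Rightarrow> real) set. finite \<Phi> \<and> (\<forall>\<phi>\<in>\<Phi>. linear \<phi>) \<and>
    (\<forall>x\<in>BV_L1. (\<forall>\<phi>\<in>\<Phi>. \<phi> x = 0) \<longrightarrow> norm x \<le> \<delta> * Var_L1 x)" if \<delta>: "0 < \<delta>" for \<delta>
  proof -
    obtain \<eta> where \<eta>: "interval_partition \<delta> \<eta>" using exists_interval_partition[OF \<delta>] by blast
    define \<phi> where "\<phi> J x = (LINT t|leb01. indicator J t * rep_L1 x t)" for J x
    have \<phi>_abs: "\<phi> J (abs_L1 f) = (LINT t|leb01. indicator J t * f t)" if "J \<in> \<eta>" "integrable leb01 f" for J f
      unfolding \<phi>_def
      by (rule integral_cong_AE)
        (use rep_abs_L1[OF that(2)] integrable_indicator_mult[OF partition_sets[OF \<eta> that(1)]] that(2)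
          in \<open>auto elim!: eventually_mono\<close>)
    have lin: "linear (\<phi> J)" if J: "J \<in> \<eta>" for J
    proof (rule linearI)
      note int = integrable_indicator_mult[OF partition_sets[OF \<eta> J]]
      show "\<phi> J (x + y) = \<phi> J x + \<phi> J y" for x y
        unfolding plus_L1_def by (subst \<phi>_abs[OF J]) (auto simp: \<phi>_def distrib_left int)
      show "\<phi> J (c *\<^sub>R x) = c *\<^sub>R \<phi> J x" for c x
        unfolding scaleR_L1_def by (subst \<phi>_abs[OF J]) (auto simp: \<phi>_def mult.left_commute)
    qed
    have "norm x \<le> \<delta> * Var_L1 x" if x: "x \<in> BV_L1" and ker: "\<forall>J\<in>\<eta>. \<phi> J x = 0" for x
    proof (rule field_le_epsilon)
      fix e :: real assume e: "0 < e"
      obtain g v where g: "x = abs_L1 g" "integrable leb01 g" "var_dominated g v" "v 1 - v 0 \<le> Var_L1 x + e / \<delta>"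
        using L1_BV_representative[OF x, of "e / \<delta>"] e \<delta> by auto
      note int = step_average_integrable[OF \<eta>, of g]
      have "(LINT t|leb01. \<bar>step_average \<eta> g t\<bar>) \<le> 0"
        using step_average_L1_le[OF \<eta> g(2)] ker \<phi>_abs[OF _ g(2)] by (simp add: g(1))
      moreover have "norm x \<le> (LINT t|leb01. \<bar>step_average \<eta> g t - g t\<bar> + \<bar>step_average \<eta> g t\<bar>)"
        unfolding g(1) norm_abs_L1[OF g(2)] by (rule integral_mono) (use g(2) int in auto)
      moreover have "\<dots> = (LINT t|leb01. \<bar>step_average \<eta> g t - g t\<bar>) + (LINT t|leb01. \<bar>step_average \<eta> g t\<bar>)"
        by (rule Bochner_Integration.integral_add) (use g(2) int in auto)
      moreover have "(LINT t|leb01. \<bar>step_average \<eta> g t - g t\<bar>) \<le> \<delta> * (v 1 - v 0)"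
        by (rule step_average_L1_close[OF \<eta> g(3)])
      moreover have "\<delta> * (v 1 - v 0) \<le> \<delta> * (Var_L1 x + e / \<delta>)"
        using g(4) \<delta> by (intro mult_left_mono) auto
      moreover have "\<delta> * (Var_L1 x + e / \<delta>) = \<delta> * Var_L1 x + e" using \<delta> by (simp add: field_simps)
      ultimately show "norm x \<le> \<delta> * Var_L1 x + e" by linarith
    qed
    then show ?thesis using lin partition_finite[OF \<eta>] by (intro exI[of _ "\<phi> ` \<eta>"]) auto
  qed
qed

definition projection_L1 :: "real set set \<Rightarrow> L1 \<Rightarrow> L1"
  where "projection_L1 \<eta> x = abs_L1 (ulam_projection \<eta> (rep_L1 x))"

lemma ulam_projection_integrable:
  assumes \<eta>: "interval_partition \<epsilon> \<eta>" and f: "integrable leb01 f"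
  shows "integrable leb01 (ulam_projection \<eta> f)"
proof -
  interpret finite_measure_subalgebra leb01 "sigma {0..1} \<eta>"
    by unfold_locales (rule subalgebra_partition[OF \<eta>])
  show ?thesis unfolding ulam_projection_def by (rule real_cond_exp_int[OF f])
qed

lemma abs_ulam_projection:
  assumes \<eta>: "interval_partition \<epsilon> \<eta>" and f: "integrable leb01 f"
  shows "abs_L1 (ulam_projection \<eta> f) = projection_L1 \<eta> (abs_L1 f)"
    and "abs_L1 (ulam_projection \<eta> f) = abs_L1 (step_average \<eta> f)"
proof -
  interpret finite_measure_subalgebra leb01 "sigma {0..1} \<eta>"
    by unfold_locales (rule subalgebra_partition[OF \<eta>])
  show "abs_L1 (ulam_projection \<eta> f) = projection_L1 \<eta> (abs_L1 f)"
    unfolding projection_L1_def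
    by (rule abs_L1_eqI[OF ulam_projection_integrable[OF \<eta> f] ulam_projection_integrable[OF \<eta>]])
      (use real_cond_exp_cong[OF rep_abs_L1[OF f]] f in \<open>auto simp: ulam_projection_def elim: eventually_mono\<close>)
  show "abs_L1 (ulam_projection \<eta> f) = abs_L1 (step_average \<eta> f)"
    by (rule abs_L1_eqI[OF ulam_projection_integrable[OF \<eta> f] step_average_integrable[OF \<eta>]
          ulam_projection_eq_step_average[OF \<eta> f]])
qed

lemma projection_abs_L1:
  assumes "interval_partition \<epsilon> \<eta>" "integrable leb01 f"
  shows "projection_L1 \<eta> (abs_L1 f) = abs_L1 (step_average \<eta> f)"
  using abs_ulam_projection[OF assms] by simp

lemma projection_L1_eq:
  assumes \<eta>: "interval_partition \<epsilon> \<eta>"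
  shows "projection_L1 \<eta> x = abs_L1 (step_average \<eta> (rep_L1 x))"
  using projection_abs_L1[OF \<eta>, of "rep_L1 x"] by simp

text \<open>
  Estimates in terms of the variation of a class are proved for representatives with a majorant of
  almost minimal increment \<open>Var_L1 x + e\<close>, and \<open>e\<close> is sent to zero.
\<close>

lemma projection_L1_props:
  assumes \<eta>: "interval_partition \<epsilon> \<eta>"
  shows "linear (projection_L1 \<eta>)" "norm (projection_L1 \<eta> x) \<le> norm x"
    "integral_L1 (projection_L1 \<eta> x) = integral_L1 x"
    "x \<in> BV_L1 \<Longrightarrow> projection_L1 \<eta> x \<in> BV_L1"
    "x \<in> BV_L1 \<Longrightarrow> Var_L1 (projection_L1 \<eta> x) \<le> Var_L1 x"
    "x \<in> BV_L1 \<Longrightarrow> norm (projection_L1 \<eta> x - x) \<le> \<epsilon> * Var_L1 x"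
proof -
  note int = step_average_integrable[OF \<eta>]
  show "linear (projection_L1 \<eta>)"
  proof (rule linearI)
    fix x y :: L1 and c :: real
    have "projection_L1 \<eta> (x + y) = abs_L1 (step_average \<eta> (\<lambda>t. rep_L1 x t + rep_L1 y t))"
      unfolding plus_L1_def by (rule projection_abs_L1[OF \<eta>]) simp
    also have "\<dots> = abs_L1 (\<lambda>t. step_average \<eta> (rep_L1 x) t + step_average \<eta> (rep_L1 y) t)"
      by (simp add: step_average_add_diff[OF \<eta>])
    also have "\<dots> = projection_L1 \<eta> x + projection_L1 \<eta> y"
      unfolding plus_L1_def projection_L1_eq[OF \<eta>]
      by (rule abs_L1_eqI)
        (use int rep_abs_L1[OF int, of "rep_L1 x"] rep_abs_L1[OF int, of "rep_L1 y"] in \<open>auto elim: eventually_elim2\<close>)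
    finally show "projection_L1 \<eta> (x + y) = projection_L1 \<eta> x + projection_L1 \<eta> y" .
    have "average J (\<lambda>t. c * f t) = c * average J f" for J f
      by (simp add: average_def mult.left_commute)
    then have scale: "step_average \<eta> (\<lambda>t. c * f t) = (\<lambda>t. c * step_average \<eta> f t)" for f
      by (auto simp: step_average_def sum_distrib_left mult.left_commute)
    have "projection_L1 \<eta> (c *\<^sub>R x) = abs_L1 (step_average \<eta> (\<lambda>t. c * rep_L1 x t))"
      unfolding scaleR_L1_def by (rule projection_abs_L1[OF \<eta>]) simp
    also have "\<dots> = c *\<^sub>R projection_L1 \<eta> x"
      unfolding scaleR_L1_def projection_L1_eq[OF \<eta>] scale
    proof (rule abs_L1_eqI)
      show "AE t in leb01. c * step_average \<eta> (rep_L1 x) t = c * rep_L1 (abs_L1 (step_average \<eta> (rep_L1 x))) t"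
        using rep_abs_L1[OF int, of "rep_L1 x"] by eventually_elim simp
    qed (use int in simp_all)
    finally show "projection_L1 \<eta> (c *\<^sub>R x) = c *\<^sub>R projection_L1 \<eta> x" .
  qed
  show "norm (projection_L1 \<eta> x) \<le> norm x"
    unfolding projection_L1_eq[OF \<eta>] norm_abs_L1[OF int]
    using step_average_L1_contraction[OF \<eta>, of "rep_L1 x"] by (simp add: norm_L1_def)
  interpret finite_measure_subalgebra leb01 "sigma {0..1} \<eta>"
    by unfold_locales (rule subalgebra_partition[OF \<eta>])
  show "integral_L1 (projection_L1 \<eta> x) = integral_L1 x"
    unfolding projection_L1_def integral_abs_L1[OF ulam_projection_integrable[OF \<eta> integrable_rep_L1]]
    by (simp add: ulam_projection_def integral_L1_def real_cond_exp_int(2))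
  assume x: "x \<in> BV_L1"
  have main: "projection_L1 \<eta> x \<in> BV_L1 \<and> Var_L1 (projection_L1 \<eta> x) \<le> Var_L1 x + e \<and>
    norm (projection_L1 \<eta> x - x) \<le> \<epsilon> * (Var_L1 x + e)" if e: "0 < e" for e
  proof -
    obtain g v where g: "x = abs_L1 g" "integrable leb01 g" "var_dominated g v" "v 1 - v 0 \<le> Var_L1 x + e"
      using L1_BV_representative[OF x e] by auto
    have px: "projection_L1 \<eta> x = abs_L1 (step_average \<eta> g)"
      unfolding g(1) by (rule projection_abs_L1[OF \<eta> g(2)])
    note dom = step_average_dominated[OF \<eta> g(3)]
    have "projection_L1 \<eta> x \<in> BV_L1" "Var_L1 (projection_L1 \<eta> x) \<le> step_average \<eta> v 1 - step_average \<eta> v 0"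
      unfolding px by (rule BV_L1_absI[OF _ dom(1) int]; simp)+
    moreover have "norm (projection_L1 \<eta> x - x) = (LINT t|leb01. \<bar>step_average \<eta> g t - g t\<bar>)"
      unfolding px unfolding g(1) abs_L1_diff[OF int g(2)] by (rule norm_abs_L1) (use int g(2) in auto)
    moreover have "\<dots> \<le> \<epsilon> * (v 1 - v 0)" by (rule step_average_L1_close[OF \<eta> g(3)])
    moreover have "\<epsilon> * (v 1 - v 0) \<le> \<epsilon> * (Var_L1 x + e)"
    proof (rule mult_left_mono[OF g(4)])
      obtain J where "J \<in> \<eta>" using partition_cover[OF \<eta>, of 0] by auto
      from partition_measure[OF \<eta> this] show "0 \<le> \<epsilon>" by (rule order_trans[OF measure_nonneg])
    qed
    ultimately show ?thesis using dom(2) g(4) by linarith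
  qed
  show "projection_L1 \<eta> x \<in> BV_L1" using main[of 1] by simp
  show "Var_L1 (projection_L1 \<eta> x) \<le> Var_L1 x" by (rule field_le_epsilon) (use main in blast)
  have "(\<lambda>n. \<epsilon> * (Var_L1 x + inverse (real (Suc n)))) \<longlonglongrightarrow> \<epsilon> * (Var_L1 x + 0)"
    by (intro tendsto_intros LIMSEQ_inverse_real_of_nat)
  then show "norm (projection_L1 \<eta> x - x) \<le> \<epsilon> * Var_L1 x"
    by (intro LIMSEQ_le_const[where X = "\<lambda>n. \<epsilon> * (Var_L1 x + inverse (real (Suc n)))"])
      (use main in \<open>auto intro!: exI[of _ 0]\<close>)
qed

section \<open>The transfer operator\<close>

text \<open>
  Such maps push absolutely continuous measures to absolutely continuous ones, so densities can be
  transported.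
\<close>

definition nonsingular :: "(real \<Rightarrow> real) \<Rightarrow> bool"
  where "nonsingular T \<longleftrightarrow> T \<in> measurable leb01 leb01 \<and> (\<forall>N\<in>null_sets leb01. T -` N \<inter> {0..1} \<in> null_sets leb01)"

lemma null_sets_leb01_iff: "N \<in> null_sets leb01 \<longleftrightarrow> N \<subseteq> {0..1} \<and> negligible N"
  by (subst null_sets_restrict_space) (auto simp: negligible_iff_null_sets)

text \<open>
  By the mean value theorem the branch does not shrink distances. So its inverse is Lipschitz and maps
  null sets to null sets.
\<close>

lemma expanding_branch_preimage_negligible:
  fixes T :: "real \<Rightarrow> real"
  assumes J: "open J" "is_interval J" and diff: "T differentiable_on J"
    and exp: "\<And>x. x \<in> J \<Longrightarrow> \<theta> \<le> \<bar>deriv T x\<bar>" and \<theta>: "1 < \<theta>" and N: "negligible N"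
  shows "negligible (J \<inter> T -` N)"
proof -
  have der: "(T has_real_derivative deriv T x) (at x)" if "x \<in> J" for x
  proof -
    have "T differentiable (at x)"
      using diff that J(1) by (simp add: differentiable_on_eq_differentiable_at)
    then show ?thesis by (simp add: DERIV_deriv_iff_real_differentiable)
  qed
  have expand: "\<bar>y - x\<bar> \<le> \<bar>T y - T x\<bar>" if xy: "x \<in> J" "y \<in> J" for x y
  proof -
    have less: "\<bar>y - x\<bar> \<le> \<bar>T y - T x\<bar>" if "x \<in> J" "y \<in> J" "x < y" for x y
    proof -
      have "\<exists>z. x < z \<and> z < y \<and> T y - T x = (y - x) * deriv T z"
        by (rule MVT2[OF \<open>x < y\<close>]) (use der mem_is_interval_1_I[OF J(2) that(1,2)] in auto)
      then obtain z where z: "x < z" "z < y" "T y - T x = (y - x) * deriv T z" by blast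
      have "z \<in> J" using mem_is_interval_1_I[OF J(2) that(1,2)] z by auto
      then have "1 \<le> \<bar>deriv T z\<bar>" using exp[of z] \<theta> by linarith
      then have "\<bar>y - x\<bar> * 1 \<le> \<bar>y - x\<bar> * \<bar>deriv T z\<bar>" by (intro mult_left_mono) auto
      then show ?thesis by (simp add: z(3) abs_mult)
    qed
    consider "x < y" | "y < x" | "x = y" by linarith
    then show ?thesis using less[of x y] less[of y x] xy by cases (auto simp: abs_minus_commute)
  qed
  have inj: "inj_on T J" using expand by (force intro: inj_onI)
  define g where "g = inv_into J T"
  have g: "g (T x) = x" if "x \<in> J" for x using inj that by (simp add: g_def)
  have "negligible (g ` (T ` J \<inter> N))"
  proof (rule negligible_locally_Lipschitz_image)
    show "negligible (T ` J \<inter> N)" using N by (rule negligible_subset) auto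
    fix x assume "x \<in> T ` J \<inter> N"
    then show "\<exists>U C. open U \<and> x \<in> U \<and> (\<forall>y\<in>(T ` J \<inter> N) \<inter> U. norm (g y - g x) \<le> C * norm (y - x))"
      using expand g by (intro exI[of _ UNIV] exI[of _ 1]) auto
  qed simp
  moreover have "J \<inter> T -` N \<subseteq> g ` (T ` J \<inter> N)"
  proof
    fix x assume x: "x \<in> J \<inter> T -` N"
    then have "x = g (T x)" using g by simp
    then show "x \<in> g ` (T ` J \<inter> N)" using x by (intro image_eqI[of _ _ "T x"]) auto
  qed
  ultimately show ?thesis by (rule negligible_subset)
qed

text \<open>
  Measurability for Lebesgue measurable sets does not follow from continuity of the branches alone:
  preimages of null sets have to be null as well.
\<close>

lemma piecewise_expanding_nonsingular:
  assumes "piecewise_C2_expanding T"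
  shows "nonsingular T"
proof -
  obtain \<J> \<theta> where T: "T \<in> {0..1} \<rightarrow> {0..1}" and \<J>: "countable \<J>" and \<theta>: "1 < \<theta>"
    and J: "\<And>J. J \<in> \<J> \<Longrightarrow> open J \<and> is_interval J \<and> J \<subseteq> {0..1}"
    and rest: "negligible ({0..1} - \<Union>\<J>)"
    and diff: "\<And>J. J \<in> \<J> \<Longrightarrow> T differentiable_on J"
    and exp: "\<And>J x. J \<in> \<J> \<Longrightarrow> x \<in> J \<Longrightarrow> \<theta> \<le> \<bar>deriv T x\<bar>"
    using assms unfolding piecewise_C2_expanding_def by auto
  have decomp: "T -` A \<inter> {0..1} = (\<Union>J\<in>\<J>. J \<inter> T -` A) \<union> (T -` A \<inter> ({0..1} - \<Union>\<J>))" for A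
    using J by auto
  have rest': "negligible (T -` A \<inter> ({0..1} - \<Union>\<J>))" for A
    by (rule negligible_subset[OF rest]) auto
  have null: "negligible (T -` N \<inter> {0..1})" if "negligible N" for N
  proof -
    have "negligible (\<Union>J\<in>\<J>. J \<inter> T -` N)"
      using J diff exp \<theta> that \<J>
      by (intro negligible_countable_Union) (auto intro!: expanding_branch_preimage_negligible[where \<theta> = \<theta>])
    then show ?thesis unfolding decomp using rest' by (rule negligible_Un)
  qed
  have borel: "T -` A \<inter> {0..1} \<in> sets lebesgue" if A: "A \<in> sets borel" for A
  proof -
    have "J \<inter> T -` A \<in> sets lebesgue" if "J \<in> \<J>" for J
    proof -
      have "continuous_on J T" using diff[OF that] by (rule differentiable_imp_continuous_on)
      then have "T \<in> borel_measurable (restrict_space borel J)" by (rule borel_measurable_continuous_on_restrict)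
      then have "T -` A \<inter> J \<in> sets (restrict_space borel J)"
        using measurable_sets[of T "restrict_space borel J" borel A] A by (simp add: space_restrict_space)
      then have "T -` A \<inter> J \<in> sets borel" using J[OF that] by (auto simp: sets_restrict_space_iff)
      then show ?thesis by (simp add: Int_commute)
    qed
    then have "(\<Union>J\<in>\<J>. J \<inter> T -` A) \<in> sets lebesgue" using \<J> by (intro sets.countable_UN'') auto
    moreover have "T -` A \<inter> ({0..1} - \<Union>\<J>) \<in> sets lebesgue" using rest'[of A] by (rule negligible_imp_sets)
    ultimately show ?thesis unfolding decomp by (rule sets.Un)
  qed
  have leb: "T -` A \<inter> {0..1} \<in> sets lebesgue" if A_leb: "A \<in> sets lebesgue" for A
  proof -
    obtain S N N' where A: "A = S \<union> N" "N \<subseteq> N'" "N' \<in> null_sets lborel" "S \<in> sets lborel"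
      by (rule sets_completionE[OF A_leb])
    have "N' \<in> null_sets lebesgue" using A(3) by (rule null_sets_completionI)
    then have "negligible N" using A(2) by (meson negligible_iff_null_sets negligible_subset)
    then have "T -` N \<inter> {0..1} \<in> sets lebesgue" by (intro negligible_imp_sets null)
    moreover have "T -` S \<inter> {0..1} \<in> sets lebesgue" using A(4) by (intro borel) simp
    ultimately show ?thesis unfolding A(1) by (simp add: Int_Un_distrib2)
  qed
  show ?thesis unfolding nonsingular_def
  proof (intro conjI ballI)
    show "T \<in> measurable leb01 leb01"
    proof (rule measurableI)
      show "T x \<in> space leb01" if "x \<in> space leb01" for x using T that by auto
      show "T -` A \<inter> space leb01 \<in> sets leb01" if "A \<in> sets leb01" for A
        using that leb[of A] by (simp add: sets_restrict_space_iff)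
    qed
    show "T -` N \<inter> {0..1} \<in> null_sets leb01" if "N \<in> null_sets leb01" for N
      using that null[of N] by (auto simp: null_sets_leb01_iff)
  qed
qed

definition is_transfer :: "(real \<Rightarrow> real) \<Rightarrow> (real \<Rightarrow> 'a) \<Rightarrow> (real \<Rightarrow> 'a::{real_normed_field, banach, second_countable_topology}) \<Rightarrow> bool"
  where "is_transfer T f F \<longleftrightarrow> integrable leb01 F \<and>
    (\<forall>g\<in>L_infinity. (LINT x|leb01. f x * g (T x)) = (LINT x|leb01. F x * g x))"

lemma is_transferD:
  "is_transfer T f F \<Longrightarrow> g \<in> L_infinity \<Longrightarrow> (LINT x|leb01. f x * g (T x)) = (LINT x|leb01. F x * g x)"
  by (simp add: is_transfer_def)

lemma transfer_operator_alt: "transfer_operator T f = (SOME F. is_transfer T f F)"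
  by (simp add: transfer_operator_def is_transfer_def)

lemma L_infinity_mult_integrable:
  fixes f g :: "real \<Rightarrow> 'a::{real_normed_field, banach, second_countable_topology}"
  assumes f: "integrable leb01 f" and g: "g \<in> L_infinity"
  shows "integrable leb01 (\<lambda>x. f x * g x)"
proof -
  obtain C where g: "g \<in> borel_measurable leb01" "AE x in leb01. norm (g x) \<le> C"
    using g by (auto simp: L_infinity_def)
  show ?thesis
  proof (rule Bochner_Integration.integrable_bound)
    show "integrable leb01 (\<lambda>x. C * norm (f x))" using f by simp
    show "AE x in leb01. norm (f x * g x) \<le> norm (C * norm (f x))"
      using g(2)
    proof eventually_elim
      case (elim x)
      then have "norm (g x) * norm (f x) \<le> C * norm (f x)" by (intro mult_right_mono) auto
      then show ?case by (simp add: norm_mult mult.commute abs_mult) (meson abs_ge_self mult_right_mono norm_ge_zero order_trans)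
    qed
  qed (use f g in measurable)
qed

text \<open>
  The sign of \<open>F\<close> is a bounded test function.
\<close>

lemma real_L_infinity_determines:
  fixes F :: "real \<Rightarrow> real"
  assumes F: "integrable leb01 F" and zero: "\<And>g. g \<in> L_infinity \<Longrightarrow> (LINT x|leb01. F x * g x) = 0"
  shows "AE x in leb01. F x = 0"
proof -
  have "(\<lambda>x. sgn (F x)) \<in> L_infinity"
    using F by (auto simp: L_infinity_def sgn_real_def intro!: exI[of _ 1] AE_I2)
  from zero[OF this] have "(LINT x|leb01. \<bar>F x\<bar>) = 0" by (simp add: abs_sgn)
  then have "AE x in leb01. \<bar>F x\<bar> = 0" using F by (subst (asm) integral_nonneg_eq_0_iff_AE) auto
  then show ?thesis by simp
qed

lemma is_transfer_unique_real:
  fixes f :: "real \<Rightarrow> real"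
  assumes "is_transfer T f F" "is_transfer T f F'"
  shows "AE x in leb01. F x = F' x"
proof -
  have F: "integrable leb01 F" "integrable leb01 F'" using assms by (auto simp: is_transfer_def)
  have "AE x in leb01. F x - F' x = 0"
  proof (rule real_L_infinity_determines)
    fix g :: "real \<Rightarrow> real" assume g: "g \<in> L_infinity"
    have "(LINT x|leb01. (F x - F' x) * g x) = (LINT x|leb01. F x * g x) - (LINT x|leb01. F' x * g x)"
      using L_infinity_mult_integrable[OF F(1) g] L_infinity_mult_integrable[OF F(2) g]
      by (simp add: left_diff_distrib)
    then show "(LINT x|leb01. (F x - F' x) * g x) = 0" using assms g by (simp add: is_transfer_def)
  qed (use F in simp)
  then show ?thesis by simp
qed

lemma is_transfer_unique_complex:
  fixes f :: "real \<Rightarrow> complex"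
  assumes "is_transfer T f F" "is_transfer T f F'"
  shows "AE x in leb01. F x = F' x"
proof -
  have F: "integrable leb01 F" "integrable leb01 F'" using assms by (auto simp: is_transfer_def)
  have zero: "(LINT x|leb01. (F x - F' x) * complex_of_real (g x)) = 0"
    and int: "integrable leb01 (\<lambda>x. (F x - F' x) * complex_of_real (g x))"
    if g: "g \<in> L_infinity" for g :: "real \<Rightarrow> real"
  proof -
    have g': "(\<lambda>x. complex_of_real (g x)) \<in> L_infinity" using g by (auto simp: L_infinity_def)
    note i = L_infinity_mult_integrable[OF F(1) g'] L_infinity_mult_integrable[OF F(2) g']
    have "(LINT x|leb01. (F x - F' x) * complex_of_real (g x)) =
      (LINT x|leb01. F x * complex_of_real (g x)) - (LINT x|leb01. F' x * complex_of_real (g x))"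
      using i by (simp add: left_diff_distrib)
    also have "\<dots> = 0" using assms g' by (simp add: is_transfer_def)
    finally show "(LINT x|leb01. (F x - F' x) * complex_of_real (g x)) = 0" .
    show "integrable leb01 (\<lambda>x. (F x - F' x) * complex_of_real (g x))" using i by (simp add: left_diff_distrib)
  qed
  have "AE x in leb01. Re (F x - F' x) = 0"
  proof (rule real_L_infinity_determines)
    fix g :: "real \<Rightarrow> real" assume g: "g \<in> L_infinity"
    show "(LINT x|leb01. Re (F x - F' x) * g x) = 0"
      using integral_Re[OF int[OF g]] zero[OF g] by simp
  qed (use F in simp)
  moreover have "AE x in leb01. Im (F x - F' x) = 0"
  proof (rule real_L_infinity_determines)
    fix g :: "real \<Rightarrow> real" assume g: "g \<in> L_infinity"
    show "(LINT x|leb01. Im (F x - F' x) * g x) = 0"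
      using integral_Im[OF int[OF g]] zero[OF g] by simp
  qed (use F in simp)
  ultimately show ?thesis by eventually_elim (simp add: complex_eq_iff)
qed

context
  fixes T :: "real \<Rightarrow> real"
  assumes T: "nonsingular T"
begin

lemma nonsingular_measurable [measurable]: "T \<in> measurable leb01 leb01"
  using T by (simp add: nonsingular_def)

lemma nonsingular_null: "N \<in> null_sets leb01 \<Longrightarrow> T -` N \<inter> {0..1} \<in> null_sets leb01"
  using T by (simp add: nonsingular_def)

lemma AE_compose_T: "AE x in leb01. P x \<Longrightarrow> AE x in leb01. P (T x)"
proof -
  assume "AE x in leb01. P x"
  then obtain N where N: "{x \<in> space leb01. \<not> P x} \<subseteq> N" "N \<in> null_sets leb01"
    by (auto elim!: AE_E2 AE_E simp: null_sets_def)
  have "{x \<in> space leb01. \<not> P (T x)} \<subseteq> T -` N \<inter> {0..1}"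
  proof
    fix x assume x: "x \<in> {x \<in> space leb01. \<not> P (T x)}"
    then have "T x \<in> space leb01" by (intro measurable_space[OF nonsingular_measurable]) simp
    then show "x \<in> T -` N \<inter> {0..1}" using N(1) x by auto
  qed
  then show "AE x in leb01. P (T x)" by (rule AE_I'[OF nonsingular_null[OF N(2)]])
qed

lemma L_infinity_compose_T:
  assumes "g \<in> L_infinity"
  shows "(\<lambda>x. g (T x)) \<in> L_infinity"
  using assms AE_compose_T unfolding L_infinity_def by (auto intro: measurable_compose[OF nonsingular_measurable])

text \<open>
  The image under the map of the measure with density \<open>f\<close> is absolutely continuous by nonsingularity.
  Its Radon-Nikodym density is the required function.
\<close>

lemma transfer_exists_nonneg:
  fixes f :: "real \<Rightarrow> real"
  assumes f: "integrable leb01 f" and pos: "\<And>x. 0 \<le> f x"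
  shows "\<exists>F. is_transfer T f F"
proof -
  define D where "D = density leb01 (\<lambda>x. ennreal (f x))"
  define M where "M = distr D leb01 T"
  have [measurable]: "f \<in> borel_measurable leb01" using f by simp
  have TD[measurable]: "T \<in> measurable D leb01" by (simp add: D_def)
  have fin: "emeasure M {0..1} < \<infinity>"
  proof -
    have sets: "T -` {0..1} \<inter> space D \<in> sets leb01"
      using measurable_sets[OF nonsingular_measurable, of "{0..1}"] by (simp add: D_def)
    have "emeasure M {0..1} = emeasure D (T -` {0..1} \<inter> space D)"
      unfolding M_def by (rule emeasure_distr[OF TD]) simp
    also have "\<dots> = (\<integral>\<^sup>+x. ennreal (f x) * indicator (T -` {0..1} \<inter> space D) x \<partial>leb01)"
      using sets unfolding D_def by (subst emeasure_density) auto
    also have "\<dots> \<le> (\<integral>\<^sup>+x. ennreal (f x) \<partial>leb01)"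
      by (intro nn_integral_mono) (auto simp: indicator_def)
    also have "\<dots> = ennreal (LINT x|leb01. f x)" by (rule nn_integral_eq_integral[OF f]) (simp add: pos)
    finally show ?thesis by (simp add: le_less_trans)
  qed
  have "absolutely_continuous leb01 M" unfolding absolutely_continuous_def
  proof
    fix N assume N: "N \<in> null_sets leb01"
    then have "T -` N \<inter> {0..1} \<in> null_sets leb01" by (rule nonsingular_null)
    then have "T -` N \<inter> {0..1} \<in> sets leb01" "AE x in leb01. x \<notin> T -` N \<inter> {0..1}"
      by (rule null_setsD2, intro AE_not_in)
    then have "T -` N \<inter> {0..1} \<in> null_sets D"
      unfolding D_def by (subst null_sets_density_iff) auto
    then show "N \<in> null_sets M"
      using N unfolding M_def by (subst null_sets_distr_iff) (auto simp: D_def Int_commute)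
  qed
  then obtain H where H: "H \<in> borel_measurable leb01" "density leb01 H = M"
    using leb01.Radon_Nikodym[of M] by (auto simp: M_def)
  define F where "F x = enn2real (H x)" for x
  have [measurable]: "H \<in> borel_measurable leb01" by (rule H(1))
  have [measurable]: "F \<in> borel_measurable leb01" unfolding F_def by measurable
  have int_H: "(\<integral>\<^sup>+x. H x \<partial>leb01) < \<infinity>"
  proof -
    have "(\<integral>\<^sup>+x. H x \<partial>leb01) = emeasure (density leb01 H) {0..1}"
      by (subst emeasure_density) (auto intro!: nn_integral_cong)
    then show ?thesis using fin H(2) by simp
  qed
  have "AE x in leb01. H x \<noteq> \<infinity>" by (rule nn_integral_PInf_AE) (use int_H in auto)
  then have HF: "AE x in leb01. H x = ennreal (F x)"
    by eventually_elim (simp add: F_def less_top)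
  have F: "integrable leb01 F"
  proof (rule integrableI_nonneg)
    have "(\<integral>\<^sup>+x. ennreal (F x) \<partial>leb01) = (\<integral>\<^sup>+x. H x \<partial>leb01)"
      by (rule nn_integral_cong_AE) (use HF in \<open>auto elim: eventually_mono\<close>)
    then show "(\<integral>\<^sup>+x. ennreal (F x) \<partial>leb01) < \<infinity>" using int_H by simp
  qed (auto simp: F_def)
  have MF: "M = density leb01 (\<lambda>x. ennreal (F x))"
    unfolding H(2)[symmetric] by (rule density_cong) (use HF in auto)
  have "(LINT x|leb01. f x * g (T x)) = (LINT x|leb01. F x * g x)" if "g \<in> L_infinity" for g
  proof -
    have [measurable]: "g \<in> borel_measurable leb01" using that by (simp add: L_infinity_def)
    have "(LINT x|leb01. f x * g (T x)) = (LINT x|D. g (T x))"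
      unfolding D_def by (subst integral_real_density) (auto simp: pos)
    also have "\<dots> = (LINT x|M. g x)" unfolding M_def by (rule integral_distr[symmetric]) auto
    also have "\<dots> = (LINT x|leb01. F x * g x)"
      unfolding MF by (subst integral_real_density) (auto simp: F_def)
    finally show ?thesis .
  qed
  then show ?thesis using F by (auto simp: is_transfer_def)
qed

lemma is_transfer_linear:
  fixes f f' :: "real \<Rightarrow> real"
  assumes "integrable leb01 f" "integrable leb01 f'" "is_transfer T f F" "is_transfer T f' F'"
  shows "is_transfer T (\<lambda>x. c * f x + d * f' x) (\<lambda>x. c * F x + d * F' x)"
  unfolding is_transfer_def
proof (intro conjI ballI)
  have F: "integrable leb01 F" "integrable leb01 F'" using assms by (auto simp: is_transfer_def)
  then show "integrable leb01 (\<lambda>x. c * F x + d * F' x)" by simp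
  fix g :: "real \<Rightarrow> real" assume g: "g \<in> L_infinity"
  note gT = L_infinity_compose_T[OF g]
  have "(LINT x|leb01. (c * f x + d * f' x) * g (T x)) = (LINT x|leb01. c * (f x * g (T x)) + d * (f' x * g (T x)))"
    by (simp add: algebra_simps)
  also have "\<dots> = c * (LINT x|leb01. f x * g (T x)) + d * (LINT x|leb01. f' x * g (T x))"
    using L_infinity_mult_integrable[OF assms(1) gT] L_infinity_mult_integrable[OF assms(2) gT] by simp
  also have "\<dots> = c * (LINT x|leb01. F x * g x) + d * (LINT x|leb01. F' x * g x)"
    using assms(3,4) g by (simp add: is_transfer_def)
  also have "\<dots> = (LINT x|leb01. c * (F x * g x) + d * (F' x * g x))"
    using L_infinity_mult_integrable[OF F(1) g] L_infinity_mult_integrable[OF F(2) g] by simp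
  also have "\<dots> = (LINT x|leb01. (c * F x + d * F' x) * g x)" by (simp add: algebra_simps)
  finally show "(LINT x|leb01. (c * f x + d * f' x) * g (T x)) = (LINT x|leb01. (c * F x + d * F' x) * g x)" .
qed

lemma transfer_exists_real:
  fixes f :: "real \<Rightarrow> real"
  assumes f: "integrable leb01 f"
  shows "\<exists>F. is_transfer T f F"
proof -
  have int: "integrable leb01 (\<lambda>x. max 0 (f x))" "integrable leb01 (\<lambda>x. max 0 (- f x))" using f by auto
  obtain F where F: "is_transfer T (\<lambda>x. max 0 (f x)) F" using transfer_exists_nonneg[OF int(1)] by auto
  obtain F' where F': "is_transfer T (\<lambda>x. max 0 (- f x)) F'" using transfer_exists_nonneg[OF int(2)] by auto
  have "(\<lambda>x. 1 * max 0 (f x) + (-1) * max 0 (- f x)) = f" by (auto simp: max_def)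
  then show ?thesis using is_transfer_linear[OF int F F', of 1 "-1"] by auto
qed

lemma transfer_operator_real:
  fixes f :: "real \<Rightarrow> real"
  assumes "integrable leb01 f"
  shows "is_transfer T f (transfer_operator T f)"
  unfolding transfer_operator_alt using transfer_exists_real[OF assms] by (rule someI_ex)

text \<open>
  The spectral assumption concerns complex functions while all estimates are real. This is the link:
  the transfer operator acts on real and imaginary parts separately.
\<close>

lemma complex_transfer:
  fixes u v :: "real \<Rightarrow> real"
  assumes u: "integrable leb01 u" and v: "integrable leb01 v" and U: "is_transfer T u U" and V: "is_transfer T v V"
  shows "is_transfer T (\<lambda>x. Complex (u x) (v x)) (\<lambda>x. Complex (U x) (V x))"
proof -
  have cplx_int: "integrable leb01 (\<lambda>x. Complex (a x) (b x))" if "integrable leb01 a" "integrable leb01 b" for a b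
    using that by (simp add: Complex_eq)
  have UV: "integrable leb01 U" "integrable leb01 V" using U V by (auto simp: is_transfer_def)
  have prod: "(LINT x|leb01. Complex (a x) (b x) * k x) =
      Complex ((LINT x|leb01. a x * Re (k x)) - (LINT x|leb01. b x * Im (k x)))
        ((LINT x|leb01. a x * Im (k x)) + (LINT x|leb01. b x * Re (k x)))"
    if a: "integrable leb01 a" and b: "integrable leb01 b" and k: "k \<in> L_infinity"
    for a b :: "real \<Rightarrow> real" and k :: "real \<Rightarrow> complex"
  proof -
    have kRe: "(\<lambda>x. Re (k x)) \<in> L_infinity" and kIm: "(\<lambda>x. Im (k x)) \<in> L_infinity"
      using k unfolding L_infinity_def
      by (auto elim!: eventually_mono intro: order_trans[OF abs_Re_le_cmod] order_trans[OF abs_Im_le_cmod])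
    note i = L_infinity_mult_integrable[OF a kRe] L_infinity_mult_integrable[OF a kIm]
      L_infinity_mult_integrable[OF b kRe] L_infinity_mult_integrable[OF b kIm]
    have int: "integrable leb01 (\<lambda>x. Complex (a x) (b x) * k x)"
      by (rule L_infinity_mult_integrable[OF cplx_int[OF a b] k])
    show ?thesis
    proof (rule complex_eqI)
      show "Re (LINT x|leb01. Complex (a x) (b x) * k x) =
        Re (Complex ((LINT x|leb01. a x * Re (k x)) - (LINT x|leb01. b x * Im (k x)))
        ((LINT x|leb01. a x * Im (k x)) + (LINT x|leb01. b x * Re (k x))))"
        unfolding integral_Re[OF int, symmetric] using i by simp
      show "Im (LINT x|leb01. Complex (a x) (b x) * k x) =
        Im (Complex ((LINT x|leb01. a x * Re (k x)) - (LINT x|leb01. b x * Im (k x)))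
        ((LINT x|leb01. a x * Im (k x)) + (LINT x|leb01. b x * Re (k x))))"
        unfolding integral_Im[OF int, symmetric] using i by simp
    qed
  qed
  show ?thesis unfolding is_transfer_def
  proof (intro conjI ballI)
    show "integrable leb01 (\<lambda>x. Complex (U x) (V x))" by (rule cplx_int[OF UV])
    fix k :: "real \<Rightarrow> complex" assume k: "k \<in> L_infinity"
    have kRe: "(\<lambda>x. Re (k x)) \<in> L_infinity" and kIm: "(\<lambda>x. Im (k x)) \<in> L_infinity"
      using k unfolding L_infinity_def
      by (auto elim!: eventually_mono intro: order_trans[OF abs_Re_le_cmod] order_trans[OF abs_Im_le_cmod])
    show "(LINT x|leb01. Complex (u x) (v x) * k (T x)) = (LINT x|leb01. Complex (U x) (V x) * k x)"
      unfolding prod[OF u v L_infinity_compose_T[OF k]] prod[OF UV k]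
      by (simp add: is_transferD[OF U kRe] is_transferD[OF U kIm] is_transferD[OF V kRe] is_transferD[OF V kIm])
  qed
qed

lemma transfer_operator_complex:
  fixes u v :: "real \<Rightarrow> real"
  assumes u: "integrable leb01 u" and v: "integrable leb01 v"
  shows "AE x in leb01. transfer_operator T (\<lambda>x. Complex (u x) (v x)) x =
    Complex (transfer_operator T u x) (transfer_operator T v x)"
proof -
  note uv = complex_transfer[OF u v transfer_operator_real[OF u] transfer_operator_real[OF v]]
  have "is_transfer T (\<lambda>x. Complex (u x) (v x)) (transfer_operator T (\<lambda>x. Complex (u x) (v x)))"
    unfolding transfer_operator_alt[of T "\<lambda>x. Complex (u x) (v x)"]
    by (rule someI[where P = "is_transfer T (\<lambda>x. Complex (u x) (v x))", OF uv])
  then show ?thesis using uv by (rule is_transfer_unique_complex)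
qed

lemma is_transfer_cong:
  fixes f f' :: "real \<Rightarrow> real"
  assumes ae: "AE x in leb01. f x = f' x" and f: "f \<in> borel_measurable leb01" "f' \<in> borel_measurable leb01"
    and F: "is_transfer T f F"
  shows "is_transfer T f' F"
proof -
  have "(LINT x|leb01. f' x * g (T x)) = (LINT x|leb01. f x * g (T x))" if "g \<in> L_infinity" for g
  proof (rule integral_cong_AE)
    have [measurable]: "g \<in> borel_measurable leb01" using that by (simp add: L_infinity_def)
    show "(\<lambda>x. f' x * g (T x)) \<in> borel_measurable leb01" "(\<lambda>x. f x * g (T x)) \<in> borel_measurable leb01"
      using f by measurable
    show "AE x in leb01. f' x * g (T x) = f x * g (T x)" using ae by eventually_elim simp
  qed
  then show ?thesis using F by (simp add: is_transfer_def)
qed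

lemma is_transfer_contraction:
  fixes f :: "real \<Rightarrow> real"
  assumes f: "integrable leb01 f" and F: "is_transfer T f F"
  shows "(LINT x|leb01. \<bar>F x\<bar>) \<le> (LINT x|leb01. \<bar>f x\<bar>)"
proof -
  have iF: "integrable leb01 F" using F by (simp add: is_transfer_def)
  have g: "(\<lambda>x. sgn (F x)) \<in> L_infinity"
    using iF by (auto simp: L_infinity_def sgn_real_def intro!: exI[of _ 1] AE_I2)
  have "(LINT x|leb01. \<bar>F x\<bar>) = (LINT x|leb01. F x * sgn (F x))" by (simp add: abs_sgn)
  also have "\<dots> = (LINT x|leb01. f x * sgn (F (T x)))" by (rule is_transferD[OF F g, symmetric])
  also have "\<dots> \<le> (LINT x|leb01. \<bar>f x\<bar>)"
  proof (rule integral_mono)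
    show "integrable leb01 (\<lambda>x. f x * sgn (F (T x)))"
      by (rule L_infinity_mult_integrable[OF f L_infinity_compose_T[OF g]])
    show "f x * sgn (F (T x)) \<le> \<bar>f x\<bar>" for x by (auto simp: sgn_real_def)
  qed (use f in simp)
  finally show ?thesis .
qed

end

definition transfer_L1 :: "(real \<Rightarrow> real) \<Rightarrow> L1 \<Rightarrow> L1"
  where "transfer_L1 T x = abs_L1 (transfer_operator T (rep_L1 x))"

context
  fixes T :: "real \<Rightarrow> real"
  assumes T: "nonsingular T"
begin

lemma transfer_operator_integrable:
  "integrable leb01 f \<Longrightarrow> integrable leb01 (transfer_operator T f :: real \<Rightarrow> real)"
  using transfer_operator_real[OF T] by (simp add: is_transfer_def)

lemma is_transfer_imp_L1:
  fixes f :: "real \<Rightarrow> real"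
  assumes f: "integrable leb01 f" and F: "is_transfer T f F"
  shows "transfer_L1 T (abs_L1 f) = abs_L1 F"
  unfolding transfer_L1_def
proof (rule abs_L1_eqI)
  have "is_transfer T f (transfer_operator T (rep_L1 (abs_L1 f)))"
    by (rule is_transfer_cong[OF T rep_abs_L1[OF f] _ _ transfer_operator_real[OF T]]) (use f in auto)
  then show "AE t in leb01. transfer_operator T (rep_L1 (abs_L1 f)) t = F t"
    using F by (rule is_transfer_unique_real)
  show "integrable leb01 F" using F by (simp add: is_transfer_def)
qed (simp add: transfer_operator_integrable)

lemma abs_transfer_operator:
  "integrable leb01 f \<Longrightarrow> abs_L1 (transfer_operator T f) = transfer_L1 T (abs_L1 f)"
  by (rule is_transfer_imp_L1[OF _ transfer_operator_real[OF T], symmetric])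

lemma transfer_L1_props:
  shows "linear (transfer_L1 T)" "norm (transfer_L1 T x) \<le> norm x"
    "integral_L1 (transfer_L1 T x) = integral_L1 x"
proof -
  have comb: "transfer_L1 T (abs_L1 (\<lambda>t. c * rep_L1 x t + d * rep_L1 y t)) =
    abs_L1 (\<lambda>t. c * transfer_operator T (rep_L1 x) t + d * transfer_operator T (rep_L1 y) t)" for x y c d
    by (rule is_transfer_imp_L1) (auto intro!: is_transfer_linear[OF T] transfer_operator_real[OF T])
  have rep_P: "AE t in leb01. rep_L1 (transfer_L1 T x) t = transfer_operator T (rep_L1 x) t" for x
    unfolding transfer_L1_def by (rule rep_abs_L1) (simp add: transfer_operator_integrable)
  show "linear (transfer_L1 T)"
  proof (rule linearI)
    fix x y :: L1 and c :: real
    show "transfer_L1 T (x + y) = transfer_L1 T x + transfer_L1 T y"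
      using comb[of 1 x 1 y] unfolding plus_L1_def
      by (simp, intro abs_L1_eqI)
        (use rep_P[of x] rep_P[of y] in \<open>auto elim: eventually_elim2 intro: transfer_operator_integrable\<close>)
    show "transfer_L1 T (c *\<^sub>R x) = c *\<^sub>R transfer_L1 T x"
      using comb[of c x 0 x] unfolding scaleR_L1_def
    proof (simp, intro abs_L1_eqI)
      show "AE t in leb01. c * transfer_operator T (rep_L1 x) t = c * rep_L1 (transfer_L1 T x) t"
        using rep_P[of x] by eventually_elim simp
    qed (auto intro: transfer_operator_integrable)
  qed
  show "norm (transfer_L1 T x) \<le> norm x"
    unfolding transfer_L1_def
    by (subst norm_abs_L1)
      (auto simp: norm_L1_def transfer_operator_integrable intro: is_transfer_contraction[OF T] transfer_operator_real[OF T])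
  have "(\<lambda>_. 1::real) \<in> L_infinity" by (auto simp: L_infinity_def)
  then have "(LINT t|leb01. rep_L1 x t * 1) = (LINT t|leb01. transfer_operator T (rep_L1 x) t * 1)"
    using transfer_operator_real[OF T, of "rep_L1 x"] by (auto simp: is_transfer_def)
  then show "integral_L1 (transfer_L1 T x) = integral_L1 x"
    unfolding transfer_L1_def by (subst integral_abs_L1) (auto simp: integral_L1_def transfer_operator_integrable)
qed

end

section \<open>Density of bounded variation\<close>

lemma closure_BV_add:
  assumes "x \<in> closure BV_L1" "y \<in> closure BV_L1"
  shows "x + y \<in> closure BV_L1"
proof -
  obtain X Y where X: "\<And>n. X n \<in> BV_L1" "X \<longlonglongrightarrow> x" and Y: "\<And>n. Y n \<in> BV_L1" "Y \<longlonglongrightarrow> y"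
    using assms unfolding closure_sequential by metis
  have "(\<lambda>n. X n + Y n) \<longlonglongrightarrow> x + y" by (rule tendsto_add[OF X(2) Y(2)])
  moreover have "X n + Y n \<in> BV_L1" for n by (rule L1.B_closed(2)[OF X(1) Y(1)])
  ultimately show ?thesis unfolding closure_sequential by (intro exI[of _ "\<lambda>n. X n + Y n"]) simp
qed

lemma closure_BV_scale:
  assumes "x \<in> closure BV_L1"
  shows "c *\<^sub>R x \<in> closure BV_L1"
proof -
  obtain X where X: "\<And>n. X n \<in> BV_L1" "X \<longlonglongrightarrow> x"
    using assms unfolding closure_sequential by metis
  have "(\<lambda>n. c *\<^sub>R X n) \<longlonglongrightarrow> c *\<^sub>R x" by (rule tendsto_scaleR[OF tendsto_const X(2)])
  moreover have "c *\<^sub>R X n \<in> BV_L1" for n by (rule L1.B_closed(3)[OF X(1)])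
  ultimately show ?thesis unfolding closure_sequential by (intro exI[of _ "\<lambda>n. c *\<^sub>R X n"]) simp
qed

lemma abs_L1_add:
  assumes "integrable leb01 f" "integrable leb01 g"
  shows "abs_L1 f + abs_L1 g = abs_L1 (\<lambda>t. f t + g t)"
  unfolding plus_L1_def
  by (rule abs_L1_eqI) (use assms rep_abs_L1[OF assms(1)] rep_abs_L1[OF assms(2)] in \<open>auto elim: eventually_elim2\<close>)

lemma abs_L1_scale:
  assumes "integrable leb01 f"
  shows "c *\<^sub>R abs_L1 f = abs_L1 (\<lambda>t. c * f t)"
  unfolding scaleR_L1_def
proof (rule abs_L1_eqI)
  show "AE t in leb01. c * rep_L1 (abs_L1 f) t = c * f t" using rep_abs_L1[OF assms] by eventually_elim simp
qed (use assms in auto)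

lemma abs_L1_sum:
  assumes "\<And>i. i \<in> A \<Longrightarrow> integrable leb01 (f i)"
  shows "(\<Sum>i\<in>A. abs_L1 (f i)) = abs_L1 (\<lambda>t. \<Sum>i\<in>A. f i t)"
  using assms
proof (induction A rule: infinite_finite_induct)
  case (insert i A)
  have "abs_L1 (f i) + abs_L1 (\<lambda>t. \<Sum>i\<in>A. f i t) = abs_L1 (\<lambda>t. f i t + (\<Sum>i\<in>A. f i t))"
    by (rule abs_L1_add) (use insert.prems in auto)
  then show ?case using insert by simp
qed (auto simp: zero_L1_def)

lemma dominated_abs_L1_tendsto:
  assumes f: "\<And>n. integrable leb01 (f n)" and g: "integrable leb01 g" and w: "integrable leb01 w"
    and lim: "\<And>t. t \<in> {0..1} \<Longrightarrow> (\<lambda>n. f n t) \<longlonglongrightarrow> g t"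
    and dom: "\<And>n t. t \<in> {0..1} \<Longrightarrow> \<bar>f n t\<bar> \<le> w t"
  shows "(\<lambda>n. abs_L1 (f n)) \<longlonglongrightarrow> abs_L1 g"
proof -
  have "(\<lambda>n. LINT t|leb01. \<bar>f n t - g t\<bar>) \<longlonglongrightarrow> (LINT t|leb01. 0)"
  proof (rule integral_dominated_convergence[where w = "\<lambda>t. w t + \<bar>g t\<bar>"])
    show "AE t in leb01. (\<lambda>n. \<bar>f n t - g t\<bar>) \<longlonglongrightarrow> 0"
      by (rule AE_I2) (use lim in \<open>auto intro!: tendsto_rabs_zero LIM_zero\<close>)
    show "AE t in leb01. norm \<bar>f n t - g t\<bar> \<le> w t + \<bar>g t\<bar>" for n
    proof (rule AE_I2)
      fix t assume "t \<in> space leb01"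
      then have "\<bar>f n t\<bar> \<le> w t" using dom by simp
      then show "norm \<bar>f n t - g t\<bar> \<le> w t + \<bar>g t\<bar>" by simp
    qed
    show "(\<lambda>t. \<bar>f n t - g t\<bar>) \<in> borel_measurable leb01" for n using f[of n] g by measurable
  qed (use g w in auto)
  then have "(\<lambda>n. norm (abs_L1 (f n) - abs_L1 g)) \<longlonglongrightarrow> 0"
    using f g by (simp add: abs_L1_diff norm_abs_L1)
  then show ?thesis by (rule LIM_zero_cancel[OF tendsto_norm_zero_cancel])
qed

text \<open>
  The half-lines generate the Borel sets and have monotone indicators. The sets whose indicators are
  limits of functions of bounded variation are closed under complements and disjoint countable unions,
  since the closure of a subspace is a closed subspace.
\<close>

lemma indicator_borel_in_closure_BV:
  assumes "A \<in> sets borel"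
  shows "abs_L1 (indicator A) \<in> closure BV_L1"
proof -
  have leb: "B \<inter> {0..1} \<in> sets leb01" if "B \<in> sets borel" for B
    using that by (auto simp: sets_restrict_space)
  have int: "integrable leb01 (indicator B :: real \<Rightarrow> real)" if B: "B \<in> sets borel" for B
  proof (rule bounded_integrable_leb01[where C = 1])
    have "(indicator B :: real \<Rightarrow> real) \<in> borel_measurable lebesgue" using B by (intro borel_measurable_indicator) simp
    then show "(indicator B :: real \<Rightarrow> real) \<in> borel_measurable leb01" by (rule measurable_restrict_space1)
  qed (auto simp: indicator_def)
  have borel: "sets borel = sigma_sets UNIV (range (\<lambda>a::real. {..a}))"
    by (subst borel_eq_atMost) (simp add: sets_measure_of)
  have "Int_stable (range (\<lambda>a::real. {..a}))" by (auto simp: Int_stable_def)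
  moreover have "range (\<lambda>a::real. {..a}) \<subseteq> Pow UNIV" by simp
  moreover have "A \<in> sigma_sets UNIV (range (\<lambda>a::real. {..a}))" using assms borel by simp
  ultimately show ?thesis
  proof (induction A rule: sigma_sets_induct_disjoint)
    case (basic A)
    then obtain a where A: "A = {..a}" by auto
    have "abs_L1 (indicator A) \<in> BV_L1"
    proof (rule BV_L1_absI[of "indicator A" "indicator A" "\<lambda>x. - indicator A x"])
      show "var_dominated (indicator A) (\<lambda>x. - indicator A x)"
        by (auto simp: var_dominated_iff A indicator_def)
      show "integrable leb01 (indicator A :: real \<Rightarrow> real)" by (rule int) (simp add: A)
    qed simp
    then show ?case using closure_subset by blast
  next
    case empty
    have "(indicator {} :: real \<Rightarrow> real) = (\<lambda>_. 0)" by (simp add: fun_eq_iff)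
    then have "abs_L1 (indicator {}) = 0" by (simp add: zero_L1_def)
    then show ?case by (rule ssubst) (rule subsetD[OF closure_subset L1.B_closed(1)])
  next
    case (compl A)
    then have A: "A \<in> sets borel" using borel by simp
    have "(indicator (UNIV - A) :: real \<Rightarrow> real) = (\<lambda>t. 1 - indicator A t)"
      by (auto simp: indicator_def)
    then have "abs_L1 (indicator (UNIV - A)) = abs_L1 (\<lambda>_. 1) + (- 1) *\<^sub>R abs_L1 (indicator A)"
      using abs_L1_diff[of "\<lambda>_. 1" "indicator A"] int[OF A] by simp
    also have "\<dots> \<in> closure BV_L1"
      using one_BV_L1 closure_subset compl by (intro closure_BV_add closure_BV_scale) auto
    finally show ?case .
  next
    case (union A)
    have A: "A i \<in> sets borel" for i using union(2) borel by auto
    have "(\<lambda>n. abs_L1 (\<lambda>t. \<Sum>i<n. indicator (A i) t)) \<longlonglongrightarrow> abs_L1 (indicator (\<Union>i. A i))"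
    proof (rule dominated_abs_L1_tendsto[where w = "\<lambda>_. 1"])
      show "integrable leb01 (\<lambda>t. \<Sum>i<n. indicator (A i) t :: real)" for n using int[OF A] by simp
      show "integrable leb01 (indicator (\<Union>i. A i) :: real \<Rightarrow> real)" using A by (intro int) auto
      have eq: "(\<Sum>i<n. indicator (A i) t :: real) = indicator (\<Union>i<n. A i) t" for n t
        using union(1) by (subst indicator_UN_disjoint) (auto simp: disjoint_family_on_def)
      show "(\<lambda>n. \<Sum>i<n. indicator (A i) t :: real) \<longlonglongrightarrow> indicator (\<Union>i. A i) t" for t
        unfolding eq by (rule LIMSEQ_indicator_UN)
      show "\<bar>\<Sum>i<n. indicator (A i) t :: real\<bar> \<le> 1" for n t unfolding eq by (simp add: indicator_def)
    qed simp
    moreover have "abs_L1 (\<lambda>t. \<Sum>i<n. indicator (A i) t) \<in> closure BV_L1" for n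
    proof -
      have "(\<Sum>i<n. abs_L1 (indicator (A i))) \<in> closure BV_L1"
      proof (induction n)
        case 0
        show ?case using subsetD[OF closure_subset L1.B_closed(1)] by simp
      next
        case (Suc n)
        then show ?case using union(3) closure_BV_add by (simp add: add.commute)
      qed
      then show ?thesis using abs_L1_sum[of "{..<n}" "\<lambda>i. indicator (A i)"] int[OF A] by simp
    qed
    ultimately show ?case by (rule closed_sequentially[OF closed_closure, rotated])
  qed
qed

lemma BV_dense_L1: "closure BV_L1 = UNIV"
proof -
  have "abs_L1 f \<in> closure BV_L1" if "integrable leb01 f" for f
    using that
  proof (induction rule: integrable_induct)
    case (base A c)
    then have A_leb: "A \<in> sets lebesgue" by (auto simp: sets_restrict_space_iff)
    obtain S N N' where A: "A = S \<union> N" "N \<subseteq> N'" "N' \<in> null_sets lborel" "S \<in> sets lborel"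
      by (rule sets_completionE[OF A_leb])
    have "N' \<in> null_sets lebesgue" using A(3) by (rule null_sets_completionI)
    then have "AE t in lebesgue. t \<notin> N'" by (rule AE_not_in)
    then have "AE t in leb01. t \<notin> N'" by (subst AE_restrict_space_iff) auto
    then have ae: "AE t in leb01. indicator A t = (indicator S t :: real)"
      by eventually_elim (use A(1,2) in \<open>auto simp: indicator_def\<close>)
    have intA: "integrable leb01 (indicator A :: real \<Rightarrow> real)" using base by simp
    have intS: "integrable leb01 (indicator S :: real \<Rightarrow> real)"
    proof (rule bounded_integrable_leb01[where C = 1])
      have "(indicator S :: real \<Rightarrow> real) \<in> borel_measurable lebesgue" using A(4) by (intro borel_measurable_indicator) simp
      then show "(indicator S :: real \<Rightarrow> real) \<in> borel_measurable leb01" by (rule measurable_restrict_space1)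
    qed (auto simp: indicator_def)
    have "abs_L1 (\<lambda>x. indicator A x *\<^sub>R c) = c *\<^sub>R abs_L1 (indicator S)"
      using abs_L1_scale[OF intA, of c] abs_L1_eqI[OF intA intS ae] by (simp add: mult.commute)
    then show ?case using indicator_borel_in_closure_BV[of S] A(4) closure_BV_scale by simp
  next
    case (add f g)
    then show ?case using closure_BV_add abs_L1_add[of f g] by metis
  next
    case (lim f s)
    have "(\<lambda>n. abs_L1 (s n)) \<longlonglongrightarrow> abs_L1 f"
      by (rule dominated_abs_L1_tendsto[where w = "\<lambda>t. 2 * \<bar>f t\<bar>"]) (use lim in auto)
    with lim.IH show ?case by (rule closed_sequentially[OF closed_closure])
  qed
  from this[of "rep_L1 x" for x] show ?thesis by auto
qed

section \<open>Spectrum and invariant densities\<close>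

lemma BV_complex:
  assumes u: "u \<in> BV_L1" and v: "v \<in> BV_L1"
  shows "(\<lambda>t. Complex (rep_L1 u t) (rep_L1 v t)) \<in> BV"
proof -
  obtain f a where f: "AE t in leb01. f t = rep_L1 u t" "var_dominated f a"
    using Var_representative[of "rep_L1 u" 1] u by (auto simp: BV_L1_def)
  obtain g b where g: "AE t in leb01. g t = rep_L1 v t" "var_dominated g b"
    using Var_representative[of "rep_L1 v" 1] v by (auto simp: BV_L1_def)
  have "total_var (\<lambda>t. Complex (f t) (g t)) \<le> ennreal ((a 1 + b 1) - (a 0 + b 0))"
  proof (rule total_var_le_increment)
    fix x y :: real assume xy: "0 \<le> x" "x \<le> y" "y \<le> 1"
    have "norm (Complex (f y) (g y) - Complex (f x) (g x)) \<le> \<bar>f y - f x\<bar> + \<bar>g y - g x\<bar>"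
      using cmod_le[of "Complex (f y) (g y) - Complex (f x) (g x)"] by simp
    also have "\<dots> \<le> (a y - a x) + (b y - b x)"
      by (intro add_mono var_dominatedD[OF f(2)] var_dominatedD[OF g(2)] xy)
    finally show "norm (Complex (f y) (g y) - Complex (f x) (g x)) \<le> (a y + b y) - (a x + b x)" by simp
  qed
  moreover have "AE t in leb01. Complex (f t) (g t) = Complex (rep_L1 u t) (rep_L1 v t)"
    using f(1) g(1) by eventually_elim simp
  ultimately have "ess_var (\<lambda>t. Complex (rep_L1 u t) (rep_L1 v t)) \<le> ennreal ((a 1 + b 1) - (a 0 + b 0))"
    unfolding ess_var_def by (intro INF_lower2[of "\<lambda>t. Complex (f t) (g t)"]) auto
  then show ?thesis by (auto simp: BV_def Complex_eq intro: le_less_trans)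
qed

context
  fixes T :: "real \<Rightarrow> real"
  assumes T: "nonsingular T"
begin

lemma transfer_L1_AE: "AE t in leb01. rep_L1 (transfer_L1 T x) t = transfer_operator T (rep_L1 x) t"
  unfolding transfer_L1_def by (rule rep_abs_L1) (simp add: transfer_operator_integrable[OF T])

lemma Lasota_Yorke_L1:
  assumes "Lasota_Yorke T"
  shows "\<exists>a b. L1.LY_op a b (transfer_L1 T)"
proof -
  obtain a b where ab: "0 < a" "a < 1" "0 \<le> b" and LY: "\<And>f::real \<Rightarrow> real. f \<in> BV \<Longrightarrow>
      ess_var (transfer_operator T f) \<le> ennreal a * ess_var f + ennreal (b * (LINT x|leb01. \<bar>f x\<bar>))"
    using assms unfolding Lasota_Yorke_def by blast
  have "transfer_L1 T x \<in> BV_L1 \<and> Var_L1 (transfer_L1 T x) \<le> a * Var_L1 x + b * norm x" if x: "x \<in> BV_L1" for x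
  proof -
    have fin: "ess_var (rep_L1 x) < \<infinity>" using x by (simp add: BV_L1_def)
    then have e: "ess_var (rep_L1 x) = ennreal (Var_L1 x)" by (simp add: Var_L1_def)
    have "ess_var (rep_L1 (transfer_L1 T x)) = ess_var (transfer_operator T (rep_L1 x))"
      by (rule ess_var_cong[OF transfer_L1_AE])
    also have "\<dots> \<le> ennreal a * ennreal (Var_L1 x) + ennreal (b * norm x)"
      using LY[of "rep_L1 x"] fin by (simp add: BV_def e norm_L1_def)
    also have "\<dots> = ennreal (a * Var_L1 x + b * norm x)"
      using ab L1.V_nonneg[OF x] by (simp add: ennreal_mult ennreal_plus)
    finally have le: "ess_var (rep_L1 (transfer_L1 T x)) \<le> ennreal (a * Var_L1 x + b * norm x)" .
    then show ?thesis
      using ab L1.V_nonneg[OF x] unfolding BV_L1_def Var_L1_def[of "transfer_L1 T x"]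
      by (auto intro: le_less_trans enn2real_leI)
  qed
  then show ?thesis using ab transfer_L1_props[OF T] unfolding L1.LY_op_def
    by (intro exI[of _ a] exI[of _ b]) auto
qed

text \<open>
  A real fixed point of integral one exists, and every fixed point is a multiple of the eigenfunction
  \<open>f\<close> that spans the eigenspace. So \<open>f\<close> has nonzero integral, and a fixed point of integral zero is
  the zero multiple. A pair \<open>u\<close>, \<open>v\<close> as in the definition is a complex eigenfunction \<open>u + \<i> v\<close>.
\<close>

lemma transfer_peripherally_trivial:
  assumes LY: "L1.LY_op a b (transfer_L1 T)" and spec: "peripheral_spectrum_trivial T"
  shows "L1.peripherally_trivial (transfer_L1 T)"
proof -
  let ?c = "\<lambda>u v t. Complex (rep_L1 u t) (rep_L1 v t)"
  have cplx: "AE t in leb01. transfer_operator T (?c u v) t = Complex (rep_L1 (transfer_L1 T u) t) (rep_L1 (transfer_L1 T v) t)" for u v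
    using transfer_operator_complex[OF T integrable_rep_L1[of u] integrable_rep_L1[of v]] transfer_L1_AE[of u] transfer_L1_AE[of v]
    by eventually_elim simp
  obtain f where f: "f \<in> BV" and simple: "\<And>g k. g \<in> BV \<Longrightarrow>
      (AE x in leb01. ((\<lambda>u x. transfer_operator T u x - 1 * u x) ^^ k) g x = 0) \<Longrightarrow> (\<exists>c::complex. AE x in leb01. g x = c * f x)"
    using spec unfolding peripheral_spectrum_trivial_def simple_BV_eigenvalue_def by blast
  have multiple: "\<exists>c. AE t in leb01. complex_of_real (rep_L1 x t) = c * f t" if x: "x \<in> BV_L1" "transfer_L1 T x = x" for x
  proof -
    have z: "transfer_L1 T 0 = 0" by (rule linear_0[OF transfer_L1_props(1)[OF T]])
    have "AE t in leb01. transfer_operator T (?c x 0) t - 1 * ?c x 0 t = 0"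
      using cplx[of x 0] unfolding x(2) z by eventually_elim simp
    then have "\<exists>c. AE t in leb01. ?c x 0 t = c * f t"
      using simple[of "?c x 0" 1] BV_complex[OF x(1) L1.B_closed(1)] by simp
    then obtain c where "AE t in leb01. ?c x 0 t = c * f t" ..
    then have "AE t in leb01. complex_of_real (rep_L1 x t) = c * f t"
      using rep_L1_arith(1) by eventually_elim (simp add: complex_eq_iff)
    then show ?thesis by blast
  qed
  have int_eq: "complex_of_real (integral_L1 x) = c * (LINT t|leb01. f t)"
    if "AE t in leb01. complex_of_real (rep_L1 x t) = c * f t" for x c
  proof -
    have "complex_of_real (integral_L1 x) = (LINT t|leb01. complex_of_real (rep_L1 x t))"
      by (simp add: integral_L1_def)
    also have "\<dots> = (LINT t|leb01. c * f t)"
      by (rule integral_cong_AE) (use that f in \<open>auto simp: BV_def\<close>)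
    finally show ?thesis by simp
  qed
  obtain h where h: "h \<in> BV_L1" "transfer_L1 T h = h" "integral_L1 h = 1"
    using L1.LY_fixed_point_exists[OF LY one_BV_L1] by (auto simp: integral_abs_L1)
  obtain ch where "AE t in leb01. complex_of_real (rep_L1 h t) = ch * f t" using multiple[OF h(1,2)] ..
  from int_eq[OF this] have f0: "(LINT t|leb01. f t) \<noteq> 0" using h(3) by auto
  have 1: "x = 0" if x: "x \<in> BV_L1" "transfer_L1 T x = x" "integral_L1 x = 0" for x
  proof -
    obtain c where c: "AE t in leb01. complex_of_real (rep_L1 x t) = c * f t" using multiple[OF x(1,2)] ..
    from int_eq[OF this] have "c = 0" using f0 x(3) by auto
    then have "AE t in leb01. rep_L1 x t = rep_L1 0 t" using c rep_L1_arith(1) by (auto elim: eventually_elim2)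
    then show ?thesis by (rule L1_eqI)
  qed
  have 2: "u = 0 \<and> v = 0" if uv: "u \<in> BV_L1" "v \<in> BV_L1" and z: "cmod z = 1" "z \<noteq> 1"
    and Pu: "transfer_L1 T u = Re z *\<^sub>R u - Im z *\<^sub>R v" and Pv: "transfer_L1 T v = Im z *\<^sub>R u + Re z *\<^sub>R v" for u v z
  proof -
    have "AE t in leb01. transfer_operator T (?c u v) t = z * ?c u v t"
      using cplx[of u v] rep_L1_arith(3)[of "Re z *\<^sub>R u" "Im z *\<^sub>R v"] rep_L1_arith(2)[of "Im z *\<^sub>R u" "Re z *\<^sub>R v"]
        rep_L1_arith(5)[of "Re z" u] rep_L1_arith(5)[of "Im z" v] rep_L1_arith(5)[of "Im z" u] rep_L1_arith(5)[of "Re z" v]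
      unfolding Pu Pv by eventually_elim (simp add: complex_eq_iff)
    then have "BV_eigenvalue (transfer_operator T) z" if "\<not> (AE t in leb01. ?c u v t = 0)"
      using BV_complex[OF uv] that unfolding BV_eigenvalue_def by (intro bexI[of _ "?c u v"] conjI)
    moreover have "\<not> BV_eigenvalue (transfer_operator T) z"
      using spec z unfolding peripheral_spectrum_trivial_def by blast
    ultimately have ae: "AE t in leb01. ?c u v t = 0" by blast
    have "u = 0" by (rule L1_eqI) (use ae rep_L1_arith(1) in \<open>eventually_elim, simp add: complex_eq_iff\<close>)
    moreover have "v = 0" by (rule L1_eqI) (use ae rep_L1_arith(1) in \<open>eventually_elim, simp add: complex_eq_iff\<close>)
    ultimately show ?thesis ..
  qed
  show ?thesis unfolding L1.peripherally_trivial_def using 1 2 by blast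
qed

text \<open>
  Approximate \<open>H\<close> by some \<open>f\<close> of bounded variation. Then \<open>P\<^sup>n f\<close> tends to \<open>h\<close> times the integral of
  \<open>f\<close>, while \<open>P\<^sup>n f\<close> stays close to \<open>P\<^sup>n H = H\<close>.
\<close>

lemma invariant_L1_eq_BV_invariant:
  assumes LY: "L1.LY_op a b (transfer_L1 T)" and spec: "L1.peripherally_trivial (transfer_L1 T)"
    and h: "h \<in> BV_L1" "transfer_L1 T h = h" "integral_L1 h = 1"
    and H: "transfer_L1 T H = H" "integral_L1 H = 1"
  shows "H = h"
proof -
  define P where "P = transfer_L1 T"
  have lin: "linear (P ^^ n)" for n unfolding P_def by (rule L1.LY_iter_linear[OF LY])
  have fixed: "(P ^^ n) h = h" "(P ^^ n) H = H" for n by (induction n) (auto simp: P_def h H)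
  have "norm (H - h) \<le> \<delta> * (1 + norm h)" if \<delta>: "0 < \<delta>" for \<delta>
  proof -
    have "H \<in> closure BV_L1" by (simp add: BV_dense_L1)
    then obtain f where f: "f \<in> BV_L1" "norm (f - H) < \<delta>"
      using \<delta> by (auto simp: closure_approachable dist_norm)
    define z where "z = f - integral_L1 f *\<^sub>R h"
    have z: "z \<in> BV_L1" "integral_L1 z = 0"
      using f h by (auto simp: z_def L1.B_closed linear_diff[OF L1.linear_I] linear_scale[OF L1.linear_I])
    have "(\<lambda>n. (P ^^ n) z) \<longlonglongrightarrow> 0" unfolding P_def by (rule L1.iterates_tendsto_0[OF LY spec z])
    then have lim: "(\<lambda>n. norm (H - f) + norm ((P ^^ n) z) + \<bar>integral_L1 f - 1\<bar> * norm h) \<longlonglongrightarrow>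
        norm (H - f) + norm (0::L1) + \<bar>integral_L1 f - 1\<bar> * norm h"
      by (intro tendsto_intros)
    have "norm (H - h) \<le> norm (H - f) + norm ((P ^^ n) z) + \<bar>integral_L1 f - 1\<bar> * norm h" for n
    proof -
      have "H - h = (P ^^ n) (H - f) + (P ^^ n) z + (integral_L1 f - 1) *\<^sub>R h"
        unfolding z_def linear_diff[OF lin] linear_scale[OF lin] fixed by (simp add: algebra_simps)
      then have "norm (H - h) \<le> norm ((P ^^ n) (H - f)) + norm ((P ^^ n) z) + norm ((integral_L1 f - 1) *\<^sub>R h)"
        by (metis add_right_mono norm_triangle_ineq order_trans)
      moreover have "norm ((P ^^ n) (H - f)) \<le> norm (H - f)" unfolding P_def by (rule L1.LY_iter_norm[OF LY])
      ultimately show ?thesis by simp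
    qed
    then have "norm (H - h) \<le> norm (H - f) + \<bar>integral_L1 f - 1\<bar> * norm h"
      using LIMSEQ_le_const[OF lim, of "norm (H - h)"] by simp
    moreover have "\<bar>integral_L1 f - 1\<bar> \<le> norm (f - H)"
      using L1.I_le[of "f - H"] H(2) by (simp add: linear_diff[OF L1.linear_I])
    moreover have "norm (H - f) = norm (f - H)" by (rule norm_minus_commute)
    moreover have "\<bar>integral_L1 f - 1\<bar> * norm h \<le> \<delta> * norm h"
      using calculation(2) f(2) by (intro mult_right_mono) auto
    ultimately show ?thesis using f(2) by (simp add: distrib_left)
  qed
  note close = this
  have "norm (H - h) \<le> 0"
  proof (rule field_le_epsilon)
    fix e :: real assume e: "0 < e"
    have pos: "0 < 1 + norm h" by (simp add: add_pos_nonneg)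
    then show "norm (H - h) \<le> 0 + e" using close[of "e / (1 + norm h)"] e by simp
  qed
  then show ?thesis by simp
qed

text \<open>
  Invariance of the measure, tested against bounded functions, is the fixed point equation for its
  density.
\<close>

lemma acim_density:
  assumes "acim T \<nu>"
  shows "\<exists>h0. integrable leb01 h0 \<and> (\<forall>x. 0 \<le> h0 x) \<and> \<nu> = density leb01 (\<lambda>x. ennreal (h0 x)) \<and>
    distr \<nu> leb01 T = \<nu> \<and> transfer_L1 T (abs_L1 h0) = abs_L1 h0 \<and> integral_L1 (abs_L1 h0) = 1"
proof -
  have prob: "prob_space \<nu>" and sets: "sets \<nu> = sets leb01" and ac: "absolutely_continuous leb01 \<nu>"
    and inv: "\<And>A. A \<in> sets leb01 \<Longrightarrow> emeasure \<nu> (T -` A \<inter> {0..1}) = emeasure \<nu> A"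
    using assms by (auto simp: acim_def)
  interpret \<nu>: prob_space \<nu> by (rule prob)
  have space: "space \<nu> = {0..1}" using sets_eq_imp_space_eq[OF sets] by simp
  have TM: "T \<in> measurable \<nu> leb01" using nonsingular_measurable[OF T] measurable_cong_sets[OF sets refl, of leb01] by blast
  have distr: "distr \<nu> leb01 T = \<nu>"
  proof (rule measure_eqI)
    fix A assume "A \<in> sets (distr \<nu> leb01 T)"
    then have A: "A \<in> sets leb01" by simp
    show "emeasure (distr \<nu> leb01 T) A = emeasure \<nu> A"
      by (subst emeasure_distr[OF TM A]) (simp add: space inv[OF A])
  qed (simp add: sets)
  obtain H where H: "H \<in> borel_measurable leb01" "density leb01 H = \<nu>"
    using leb01.Radon_Nikodym[OF ac sets] by auto
  have [measurable]: "H \<in> borel_measurable leb01" by (rule H(1))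
  have total: "(\<integral>\<^sup>+x. H x \<partial>leb01) = 1"
  proof -
    have "(\<integral>\<^sup>+x. H x \<partial>leb01) = emeasure (density leb01 H) {0..1}"
      by (subst emeasure_density) (auto intro!: nn_integral_cong)
    then show ?thesis using \<nu>.emeasure_space_1 H(2) space by simp
  qed
  have "AE x in leb01. H x \<noteq> \<infinity>" by (rule nn_integral_PInf_AE) (use total in auto)
  define h0 where "h0 x = enn2real (H x)" for x
  have [measurable]: "h0 \<in> borel_measurable leb01" unfolding h0_def by measurable
  have pos: "0 \<le> h0 x" for x by (simp add: h0_def)
  have Hh: "AE x in leb01. H x = ennreal (h0 x)"
    using \<open>AE x in leb01. H x \<noteq> \<infinity>\<close> by eventually_elim (simp add: h0_def less_top)
  have total': "(\<integral>\<^sup>+x. ennreal (h0 x) \<partial>leb01) = 1"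
    using nn_integral_cong_AE[OF Hh] total by simp
  have int: "integrable leb01 h0"
    by (rule integrableI_nonneg) (use total' pos in auto)
  have dens: "\<nu> = density leb01 (\<lambda>x. ennreal (h0 x))"
    unfolding H(2)[symmetric] by (rule density_cong) (use Hh in auto)
  have "ennreal (LINT x|leb01. h0 x) = ennreal 1"
    using nn_integral_eq_integral[OF int] total' pos by simp
  then have one: "(LINT x|leb01. h0 x) = 1" by (subst (asm) ennreal_inj) (auto intro: integral_nonneg_AE simp: pos)
  have "is_transfer T h0 h0" unfolding is_transfer_def
  proof (intro conjI ballI int)
    fix g :: "real \<Rightarrow> real" assume g: "g \<in> L_infinity"
    have [measurable]: "g \<in> borel_measurable leb01" using g by (simp add: L_infinity_def)
    have [measurable]: "T \<in> measurable leb01 leb01" by (rule nonsingular_measurable[OF T])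
    have "(LINT x|leb01. h0 x * g (T x)) = (LINT x|\<nu>. g (T x))"
      unfolding dens by (subst integral_real_density) (auto simp: pos)
    also have "\<dots> = (LINT x|distr \<nu> leb01 T. g x)" by (rule integral_distr[symmetric, OF TM]) simp
    also have "\<dots> = (LINT x|\<nu>. g x)" by (simp add: distr)
    also have "\<dots> = (LINT x|leb01. h0 x * g x)"
      unfolding dens by (subst integral_real_density) (auto simp: pos)
    finally show "(LINT x|leb01. h0 x * g (T x)) = (LINT x|leb01. h0 x * g x)" .
  qed
  then have "transfer_L1 T (abs_L1 h0) = abs_L1 h0" by (rule is_transfer_imp_L1[OF T int])
  then show ?thesis using int pos dens distr one by (intro exI[of _ h0]) (auto simp: integral_abs_L1)
qed

end

section \<open>Autocovariances\<close>

lemma Cesaro_mean_tendsto: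
  fixes b :: "nat \<Rightarrow> real"
  assumes b: "b \<longlonglongrightarrow> L"
  shows "(\<lambda>n. 1 / real n * (\<Sum>m<n. b m)) \<longlonglongrightarrow> L"
proof (rule LIMSEQ_I)
  fix r :: real assume r: "0 < r"
  obtain N where N: "\<And>m. m \<ge> N \<Longrightarrow> norm (b m - L) < r / 2" using LIMSEQ_D[OF b, of "r / 2"] r by auto
  define K where "K = (\<Sum>m<N. \<bar>b m - L\<bar>)"
  have K: "0 \<le> K" by (simp add: K_def sum_nonneg)
  obtain M :: nat where M: "2 * K / r < real M" using reals_Archimedean2 by blast
  show "\<exists>n0. \<forall>n\<ge>n0. norm (1 / real n * (\<Sum>m<n. b m) - L) < r"
  proof (intro exI[of _ "Suc (N + M)"] allI impI)
    fix n assume n: "n \<ge> Suc (N + M)"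
    then have n0: "0 < real n" by simp
    have "1 / real n * (\<Sum>m<n. b m) - L = 1 / real n * (\<Sum>m<n. b m - L)"
      using n0 by (simp add: sum_subtractf field_simps)
    then have "norm (1 / real n * (\<Sum>m<n. b m) - L) \<le> 1 / real n * (\<Sum>m<n. \<bar>b m - L\<bar>)"
      using n0 sum_abs[of "\<lambda>m. b m - L" "{..<n}"] by (simp add: divide_right_mono)
    also have "(\<Sum>m<n. \<bar>b m - L\<bar>) = K + (\<Sum>m\<in>{N..<n}. \<bar>b m - L\<bar>)"
      unfolding K_def using n by (subst sum.union_disjoint[symmetric]) (auto simp: ivl_disj_un)
    also have "(\<Sum>m\<in>{N..<n}. \<bar>b m - L\<bar>) \<le> (\<Sum>m\<in>{N..<n}. r / 2)"
      using N by (intro sum_mono) (auto simp: less_imp_le)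
    also have "\<dots> \<le> real n * (r / 2)" using r by (auto intro!: mult_right_mono)
    finally have "norm (1 / real n * (\<Sum>m<n. b m) - L) \<le> 1 / real n * (K + real n * (r / 2))"
      using n0 by (simp add: divide_right_mono)
    also have "\<dots> = K / real n + r / 2" using n0 by (simp add: field_simps)
    also have "\<dots> < r / 2 + r / 2"
    proof -
      have "2 * K / r < real n" using M n by linarith
      then have "2 * K < real n * r" using r by (simp add: field_simps)
      then have "K / real n < r / 2" using n0 by (simp add: field_simps)
      then show ?thesis by linarith
    qed
    finally show "norm (1 / real n * (\<Sum>m<n. b m) - L) < r" by simp
  qed
qed

text \<open>
  Passing from \<open>n\<close> to \<open>n + 1\<close> adds one row, one column and a diagonal entry. In this form the variance
  of a Birkhoff sum, divided by \<open>n\<close>, is a Cesaro mean of partial sums of the series.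
\<close>

lemma double_sum_toeplitz:
  fixes c :: "nat \<Rightarrow> real"
  shows "(\<Sum>i<n. \<Sum>j<n. if i \<le> j then c (j - i) else c (i - j)) = (\<Sum>m<n. c 0 + 2 * (\<Sum>k=1..<Suc m. c k))"
proof (induction n)
  case (Suc n)
  let ?d = "\<lambda>i j. if i \<le> j then c (j - i) else c (i - j)"
  have re: "(\<Sum>i<n. c (n - i)) = (\<Sum>k=1..<Suc n. c k)"
    by (rule sum.reindex_bij_witness[of _ "\<lambda>k. n - k" "\<lambda>i. n - i"]) auto
  have "(\<Sum>i<Suc n. \<Sum>j<Suc n. ?d i j) = (\<Sum>i<n. \<Sum>j<n. ?d i j) + (\<Sum>i<n. ?d i n) + ((\<Sum>j<n. ?d n j) + ?d n n)"
    by (simp add: sum.distrib)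
  also have "(\<Sum>i<n. ?d i n) = (\<Sum>k=1..<Suc n. c k)" unfolding re[symmetric] by (intro sum.cong) auto
  also have "(\<Sum>j<n. ?d n j) = (\<Sum>k=1..<Suc n. c k)" unfolding re[symmetric] by (intro sum.cong) auto
  finally show ?case using Suc by simp
qed simp

definition mult_L1 :: "(real \<Rightarrow> real) \<Rightarrow> L1 \<Rightarrow> L1"
  where "mult_L1 \<phi> x = abs_L1 (\<lambda>t. \<phi> t * rep_L1 x t)"

lemma L_infinity_mult_integrable_left:
  fixes f \<phi> :: "real \<Rightarrow> real"
  shows "\<phi> \<in> L_infinity \<Longrightarrow> integrable leb01 f \<Longrightarrow> integrable leb01 (\<lambda>t. \<phi> t * f t)"
  using L_infinity_mult_integrable[of f \<phi>] by (simp add: mult.commute)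

lemma mult_abs_L1:
  assumes "\<phi> \<in> L_infinity" "integrable leb01 f"
  shows "mult_L1 \<phi> (abs_L1 f) = abs_L1 (\<lambda>t. \<phi> t * f t)"
  unfolding mult_L1_def
proof (rule abs_L1_eqI)
  show "AE t in leb01. \<phi> t * rep_L1 (abs_L1 f) t = \<phi> t * f t"
    using rep_abs_L1[OF assms(2)] by eventually_elim simp
qed (use assms in \<open>auto intro: L_infinity_mult_integrable_left\<close>)

lemma bounded_linear_mult_L1:
  assumes \<phi>: "\<phi> \<in> L_infinity"
  shows "bounded_linear (mult_L1 \<phi>)"
proof -
  note int = L_infinity_mult_integrable_left[OF \<phi>]
  obtain C where C: "AE t in leb01. \<bar>\<phi> t\<bar> \<le> C" using \<phi> by (auto simp: L_infinity_def)
  show ?thesis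
  proof (rule bounded_linear_intro)
    fix x y :: L1 and c :: real
    have "mult_L1 \<phi> (x + y) = abs_L1 (\<lambda>t. \<phi> t * (rep_L1 x t + rep_L1 y t))"
      unfolding plus_L1_def by (rule mult_abs_L1[OF \<phi>]) simp
    also have "\<dots> = mult_L1 \<phi> x + mult_L1 \<phi> y"
      unfolding mult_L1_def by (simp add: abs_L1_add int distrib_left)
    finally show "mult_L1 \<phi> (x + y) = mult_L1 \<phi> x + mult_L1 \<phi> y" .
    have "mult_L1 \<phi> (c *\<^sub>R x) = abs_L1 (\<lambda>t. \<phi> t * (c * rep_L1 x t))"
      unfolding scaleR_L1_def by (rule mult_abs_L1[OF \<phi>]) simp
    also have "\<dots> = c *\<^sub>R mult_L1 \<phi> x"
      unfolding mult_L1_def by (simp add: abs_L1_scale int mult.left_commute)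
    finally show "mult_L1 \<phi> (c *\<^sub>R x) = c *\<^sub>R mult_L1 \<phi> x" .
    have "(LINT t|leb01. \<bar>\<phi> t * rep_L1 x t\<bar>) \<le> (LINT t|leb01. \<bar>rep_L1 x t\<bar> * C)"
    proof (rule integral_mono_AE)
      show "AE t in leb01. \<bar>\<phi> t * rep_L1 x t\<bar> \<le> \<bar>rep_L1 x t\<bar> * C"
        using C by eventually_elim (simp add: abs_mult mult.commute[of _ C] mult_right_mono)
    qed (use int in auto)
    then show "norm (mult_L1 \<phi> x) \<le> norm x * C"
      unfolding mult_L1_def norm_abs_L1[OF int[OF integrable_rep_L1]] norm_L1_def[of x] by simp
  qed
qed

lemma integral_mult_L1:
  assumes "\<phi> \<in> L_infinity"
  shows "integral_L1 (mult_L1 \<phi> x) = (LINT t|leb01. \<phi> t * rep_L1 x t)"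
  unfolding mult_L1_def by (rule integral_abs_L1) (simp add: L_infinity_mult_integrable_left[OF assms])

lemma L_infinity_closed:
  fixes \<phi> \<psi> :: "real \<Rightarrow> real"
  assumes \<phi>: "\<phi> \<in> L_infinity"
  shows "(\<lambda>x. \<phi> x - c) \<in> L_infinity" "\<psi> \<in> L_infinity \<Longrightarrow> (\<lambda>x. \<phi> x * \<psi> x) \<in> L_infinity"
proof -
  obtain C where C: "\<phi> \<in> borel_measurable leb01" "AE t in leb01. \<bar>\<phi> t\<bar> \<le> C" using \<phi> by (auto simp: L_infinity_def)
  have "AE t in leb01. norm (\<phi> t - c) \<le> C + \<bar>c\<bar>" using C(2) by eventually_elim simp
  then show "(\<lambda>x. \<phi> x - c) \<in> L_infinity" using C(1) by (auto simp: L_infinity_def)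
  assume "\<psi> \<in> L_infinity"
  then obtain D where D: "\<psi> \<in> borel_measurable leb01" "AE t in leb01. \<bar>\<psi> t\<bar> \<le> D" by (auto simp: L_infinity_def)
  have "AE t in leb01. norm (\<phi> t * \<psi> t) \<le> C * D"
    using C(2) D(2) by eventually_elim (auto simp: abs_mult intro!: mult_mono)
  then show "(\<lambda>x. \<phi> x * \<psi> x) \<in> L_infinity" using C(1) D(1) by (auto simp: L_infinity_def)
qed

lemma BV_subset_L_infinity:
  fixes \<psi> :: "real \<Rightarrow> real"
  assumes "\<psi> \<in> BV"
  shows "\<psi> \<in> L_infinity"
  using assms ess_var_bounded[of \<psi>] by (auto simp: BV_def L_infinity_def)

lemma mult_L1_BV:
  assumes \<psi>: "\<psi> \<in> BV" and x: "x \<in> BV_L1"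
  shows "mult_L1 \<psi> x \<in> BV_L1"
proof -
  have "ess_var (\<lambda>t. \<psi> t * rep_L1 x t) < \<infinity>"
    using ess_var_mult_finite[of \<psi> "rep_L1 x"] \<psi> x by (simp add: BV_def BV_L1_def)
  then show ?thesis
    unfolding BV_L1_def mult_L1_def
    by (simp add: ess_var_rep_abs_L1 L_infinity_mult_integrable_left[OF BV_subset_L_infinity[OF \<psi>]])
qed

text \<open>
  The class of \<open>(\<psi> - \<mu>) x\<close>, where \<open>\<mu>\<close> is the integral of \<open>\<psi> x\<close>.
\<close>

definition centered_L1 :: "(real \<Rightarrow> real) \<Rightarrow> L1 \<Rightarrow> L1"
  where "centered_L1 \<psi> x = mult_L1 \<psi> x - integral_L1 (mult_L1 \<psi> x) *\<^sub>R x"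

text \<open>
  The integral of \<open>Q\<^sup>i((\<psi> - \<mu>) x) (\<psi> - \<mu>)\<close>. Expanding the last factor leaves a single multiplication
  operator, that by \<open>\<psi>\<close>, which is independent of \<open>x\<close>; so the dependence on \<open>Q\<close> and \<open>x\<close> is
  visibly continuous.
\<close>

definition autocovariance :: "(L1 \<Rightarrow> L1) \<Rightarrow> L1 \<Rightarrow> (real \<Rightarrow> real) \<Rightarrow> nat \<Rightarrow> real"
  where "autocovariance Q x \<psi> i =
    integral_L1 (mult_L1 \<psi> ((Q ^^ i) (centered_L1 \<psi> x)))
      - integral_L1 (mult_L1 \<psi> x) * integral_L1 ((Q ^^ i) (centered_L1 \<psi> x))"

lemma centered_pairing:
  assumes \<psi>: "\<psi> \<in> L_infinity" and f: "integrable leb01 f"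
  shows "integral_L1 (mult_L1 \<psi> (abs_L1 f)) - \<mu> * integral_L1 (abs_L1 f) = (LINT t|leb01. f t * (\<psi> t - \<mu>))"
  using L_infinity_mult_integrable_left[OF \<psi> f] f
  by (simp add: mult_abs_L1[OF \<psi> f] integral_abs_L1 right_diff_distrib mult.commute)

lemma centered_abs_L1:
  assumes \<psi>: "\<psi> \<in> L_infinity" and f: "integrable leb01 f"
  shows "centered_L1 \<psi> (abs_L1 f) = abs_L1 (\<lambda>t. (\<psi> t - (LINT t|leb01. \<psi> t * f t)) * f t)"
  using L_infinity_mult_integrable_left[OF \<psi> f] f
  by (simp add: centered_L1_def mult_abs_L1[OF \<psi> f] integral_abs_L1 abs_L1_scale abs_L1_diff left_diff_distrib)

definition ulam_L1 :: "(real \<Rightarrow> real) \<Rightarrow> real set set \<Rightarrow> L1 \<Rightarrow> L1"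
  where "ulam_L1 T \<eta> x = projection_L1 \<eta> (transfer_L1 T (projection_L1 \<eta> x))"

context
  fixes T :: "real \<Rightarrow> real" and \<eta> :: "real set set" and \<epsilon> :: real
  assumes T: "nonsingular T" and \<eta>: "interval_partition \<epsilon> \<eta>"
begin

lemma ulam_operator_L1:
  assumes f: "integrable leb01 f"
  shows "integrable leb01 (ulam_operator T \<eta> f)" "abs_L1 (ulam_operator T \<eta> f) = ulam_L1 T \<eta> (abs_L1 f)"
proof -
  note i1 = ulam_projection_integrable[OF \<eta> f]
  note i2 = transfer_operator_integrable[OF T i1]
  show "integrable leb01 (ulam_operator T \<eta> f)"
    using ulam_projection_integrable[OF \<eta> i2] by (simp add: ulam_operator_def)
  show "abs_L1 (ulam_operator T \<eta> f) = ulam_L1 T \<eta> (abs_L1 f)"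
    unfolding ulam_operator_def ulam_L1_def
    by (simp add: abs_ulam_projection(1)[OF \<eta> i2] abs_transfer_operator[OF T i1] abs_ulam_projection(1)[OF \<eta> f])
qed

lemma ulam_operator_iterate_L1:
  assumes f: "integrable leb01 f"
  shows "integrable leb01 ((ulam_operator T \<eta> ^^ i) f) \<and> abs_L1 ((ulam_operator T \<eta> ^^ i) f) = (ulam_L1 T \<eta> ^^ i) (abs_L1 f)"
  by (induction i) (use f ulam_operator_L1 in auto)

lemma ulam_diffusion_eq_autocovariances:
  assumes \<psi>: "\<psi> \<in> L_infinity" and h: "integrable leb01 h"
  shows "ulam_diffusion T \<eta> h \<psi> l = autocovariance (ulam_L1 T \<eta>) (abs_L1 h) \<psi> 0 +
    2 * (\<Sum>i=1..<l. autocovariance (ulam_L1 T \<eta>) (abs_L1 h) \<psi> i)"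
proof -
  define \<mu> where "\<mu> = (LINT t|leb01. \<psi> t * h t)"
  define f where "f t = (\<psi> t - \<mu>) * h t" for t
  have f: "integrable leb01 f"
    unfolding f_def by (rule L_infinity_mult_integrable_left[OF L_infinity_closed(1)[OF \<psi>] h])
  have \<mu>: "integral_L1 (mult_L1 \<psi> (abs_L1 h)) = \<mu>"
    using L_infinity_mult_integrable_left[OF \<psi> h] by (simp add: mult_abs_L1[OF \<psi> h] integral_abs_L1 \<mu>_def)
  have cov: "autocovariance (ulam_L1 T \<eta>) (abs_L1 h) \<psi> i = (LINT t|leb01. (ulam_operator T \<eta> ^^ i) f t * (\<psi> t - \<mu>))" for i
    unfolding autocovariance_def \<mu> centered_abs_L1[OF \<psi> h] \<mu>_def[symmetric] f_def[symmetric]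
    using ulam_operator_iterate_L1[OF f, of i] centered_pairing[OF \<psi>, of "(ulam_operator T \<eta> ^^ i) f" \<mu>] by simp
  have "(LINT t|leb01. (\<psi> t - \<mu>)\<^sup>2 * h t) = autocovariance (ulam_L1 T \<eta>) (abs_L1 h) \<psi> 0"
    unfolding cov by (simp add: f_def power2_eq_square mult_ac)
  then show ?thesis
    unfolding ulam_diffusion_def Let_def \<mu>_def[symmetric] f_def[symmetric] cov by simp
qed

text \<open>
  The projections contract the norm, preserve the integral and do not increase the variation, so the
  constants are those of the transfer operator.
\<close>

lemma ulam_L1_LY:
  assumes "L1.LY_op a b (transfer_L1 T)"
  shows "L1.LY_op a b (ulam_L1 T \<eta>)"
proof -
  note P = assms[unfolded L1.LY_op_def]
  note proj = projection_L1_props[OF \<eta>]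
  have "linear (ulam_L1 T \<eta>)"
    using linear_compose[OF linear_compose[OF proj(1), of "transfer_L1 T"] proj(1)] P
    by (simp add: ulam_L1_def[abs_def] o_def)
  moreover have "norm (ulam_L1 T \<eta> x) \<le> norm x" for x
    unfolding ulam_L1_def using P proj(2) by (meson order_trans)
  moreover have "integral_L1 (ulam_L1 T \<eta> x) = integral_L1 x" for x
    unfolding ulam_L1_def using P proj(3) by simp
  moreover have "ulam_L1 T \<eta> x \<in> BV_L1 \<and> Var_L1 (ulam_L1 T \<eta> x) \<le> a * Var_L1 x + b * norm x" if x: "x \<in> BV_L1" for x
  proof -
    have px: "projection_L1 \<eta> x \<in> BV_L1" by (rule proj(4)[OF x])
    then have Ppx: "transfer_L1 T (projection_L1 \<eta> x) \<in> BV_L1"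
      and "Var_L1 (transfer_L1 T (projection_L1 \<eta> x)) \<le> a * Var_L1 (projection_L1 \<eta> x) + b * norm (projection_L1 \<eta> x)"
      using P by auto
    moreover have "a * Var_L1 (projection_L1 \<eta> x) + b * norm (projection_L1 \<eta> x) \<le> a * Var_L1 x + b * norm x"
      by (intro add_mono mult_left_mono proj(2) proj(5)[OF x]) (use P in auto)
    moreover have "Var_L1 (ulam_L1 T \<eta> x) \<le> Var_L1 (transfer_L1 T (projection_L1 \<eta> x))"
      unfolding ulam_L1_def by (rule proj(5)[OF Ppx])
    ultimately show ?thesis using proj(4)[OF Ppx] by (simp add: ulam_L1_def)
  qed
  ultimately show ?thesis using P unfolding L1.LY_op_def by blast
qed

lemma ulam_L1_close:
  assumes LY: "L1.LY_op a b (transfer_L1 T)" and x: "x \<in> BV_L1" and \<epsilon>: "0 \<le> \<epsilon>"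
  shows "norm (ulam_L1 T \<eta> x - transfer_L1 T x) \<le> \<epsilon> * (2 + b) * (Var_L1 x + norm x)"
proof -
  note P = LY[unfolded L1.LY_op_def]
  note proj = projection_L1_props[OF \<eta>]
  define P where "P = transfer_L1 T"
  have Px: "P x \<in> BV_L1" "Var_L1 (P x) \<le> a * Var_L1 x + b * norm x" using P x by (auto simp: P_def)
  have "ulam_L1 T \<eta> x - P x = projection_L1 \<eta> (P (projection_L1 \<eta> x - x)) + (projection_L1 \<eta> (P x) - P x)"
    using P proj(1) by (simp add: ulam_L1_def P_def linear_diff)
  then have "norm (ulam_L1 T \<eta> x - P x) \<le> norm (projection_L1 \<eta> (P (projection_L1 \<eta> x - x))) + norm (projection_L1 \<eta> (P x) - P x)"
    by (metis norm_triangle_ineq)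
  also have "norm (projection_L1 \<eta> (P (projection_L1 \<eta> x - x))) \<le> norm (projection_L1 \<eta> x - x)"
    using proj(2)[of "P (projection_L1 \<eta> x - x)"] P by (auto simp: P_def intro: order_trans)
  also have "norm (projection_L1 \<eta> x - x) \<le> \<epsilon> * Var_L1 x" by (rule proj(6)[OF x])
  also have "norm (projection_L1 \<eta> (P x) - P x) \<le> \<epsilon> * Var_L1 (P x)" by (rule proj(6)[OF Px(1)])
  also have "\<epsilon> * Var_L1 (P x) \<le> \<epsilon> * (a * Var_L1 x + b * norm x)" by (rule mult_left_mono[OF Px(2) \<epsilon>])
  also have "\<epsilon> * Var_L1 x + \<epsilon> * (a * Var_L1 x + b * norm x) = \<epsilon> * (Var_L1 x + a * Var_L1 x + b * norm x)"
    by (simp add: algebra_simps)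
  also have "\<dots> \<le> \<epsilon> * ((2 + b) * (Var_L1 x + norm x))"
  proof (rule mult_left_mono[OF _ \<epsilon>])
    have "a * Var_L1 x \<le> 1 * Var_L1 x"
      by (rule mult_right_mono) (use P L1.V_nonneg[OF x] in auto)
    moreover have "0 \<le> b * Var_L1 x" "0 \<le> b" "0 \<le> norm x" using P L1.V_nonneg[OF x] by auto
    moreover have "(2 + b) * (Var_L1 x + norm x) = 2 * Var_L1 x + 2 * norm x + b * Var_L1 x + b * norm x"
      by (simp add: algebra_simps)
    ultimately show "Var_L1 x + a * Var_L1 x + b * norm x \<le> (2 + b) * (Var_L1 x + norm x)"
      using L1.V_nonneg[OF x] by linarith
  qed
  finally show ?thesis by (simp add: P_def mult.assoc)
qed

lemma unique_ulam_density_rep_L1: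
  assumes x: "x \<in> BV_L1" "ulam_L1 T \<eta> x = x" "integral_L1 x = 1"
    and unique: "\<And>y. y \<in> BV_L1 \<Longrightarrow> ulam_L1 T \<eta> y = y \<Longrightarrow> integral_L1 y = 1 \<Longrightarrow> y = x"
  shows "unique_ulam_density T \<eta> (rep_L1 x)"
  unfolding unique_ulam_density_def
proof (intro conjI allI impI)
  have "abs_L1 (ulam_operator T \<eta> (rep_L1 x)) = x"
    using ulam_operator_L1(2)[OF integrable_rep_L1[of x]] x by simp
  then have "AE t in leb01. ulam_operator T \<eta> (rep_L1 x) t = rep_L1 x t"
    using rep_abs_L1[OF ulam_operator_L1(1)[OF integrable_rep_L1[of x]]] by (auto elim: eventually_mono)
  then show "normalized_ulam_fixed_point T \<eta> (rep_L1 x)"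
    using x by (simp add: normalized_ulam_fixed_point_def BV_def BV_L1_def integral_L1_def)
  fix g assume g: "normalized_ulam_fixed_point T \<eta> g"
  then have int: "integrable leb01 g" by (simp add: normalized_ulam_fixed_point_def BV_def)
  have "abs_L1 (ulam_operator T \<eta> g) = abs_L1 g"
    by (rule abs_L1_eqI) (use g int ulam_operator_L1(1) in \<open>auto simp: normalized_ulam_fixed_point_def\<close>)
  then have "ulam_L1 T \<eta> (abs_L1 g) = abs_L1 g" by (simp add: ulam_operator_L1(2)[OF int])
  then have "abs_L1 g = x"
    using g int by (intro unique)
      (auto simp: normalized_ulam_fixed_point_def BV_def BV_L1_def ess_var_rep_abs_L1 integral_abs_L1)
  then show "AE t in leb01. g t = rep_L1 x t" using rep_abs_L1[OF int] by (auto elim: eventually_mono)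
qed

end

lemma transfer_iterate_duality:
  fixes g :: "real \<Rightarrow> real"
  assumes T: "nonsingular T" and f: "integrable leb01 f" and g: "g \<in> L_infinity"
  shows "(LINT t|leb01. f t * g ((T ^^ k) t)) = integral_L1 (mult_L1 g ((transfer_L1 T ^^ k) (abs_L1 f)))"
  using g
proof (induction k arbitrary: g)
  case 0
  then show ?case
    using mult_abs_L1[OF 0 f] L_infinity_mult_integrable_left[OF 0 f] by (simp add: integral_abs_L1 mult.commute)
next
  case (Suc k)
  let ?x = "(transfer_L1 T ^^ k) (abs_L1 f)"
  note gT = L_infinity_compose_T[OF T Suc.prems]
  have "(LINT t|leb01. f t * g ((T ^^ Suc k) t)) = integral_L1 (mult_L1 (\<lambda>t. g (T t)) ?x)"
    using Suc.IH[OF gT] by simp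
  also have "\<dots> = (LINT t|leb01. rep_L1 ?x t * g (T t))"
    by (simp add: integral_mult_L1[OF gT] mult.commute)
  also have "\<dots> = (LINT t|leb01. transfer_operator T (rep_L1 ?x) t * g t)"
    by (rule is_transferD[OF transfer_operator_real[OF T integrable_rep_L1] Suc.prems])
  also have "\<dots> = integral_L1 (mult_L1 g (transfer_L1 T ?x))"
    unfolding transfer_L1_def[of T ?x]
    using mult_abs_L1[OF Suc.prems transfer_operator_integrable[OF T integrable_rep_L1[of ?x]]]
      L_infinity_mult_integrable_left[OF Suc.prems transfer_operator_integrable[OF T integrable_rep_L1[of ?x]]]
    by (simp add: integral_abs_L1 mult.commute)
  finally show ?case by simp
qed

text \<open>
  By invariance the covariance of the observable at times \<open>i\<close> and \<open>j\<close> depends on the distance of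
  \<open>i\<close> and \<open>j\<close> only, and by duality it is an autocovariance of the transfer operator.
\<close>

lemma diffusion_coefficient_eq_series:
  assumes T: "nonsingular T" and h0: "integrable leb01 h0" "\<And>x. 0 \<le> h0 x"
    and \<nu>: "\<nu> = density leb01 (\<lambda>x. ennreal (h0 x))" and inv: "distr \<nu> leb01 T = \<nu>"
    and \<psi>: "\<psi> \<in> L_infinity"
    and conv: "(\<lambda>n. \<Sum>k=1..<Suc n. autocovariance (transfer_L1 T) (abs_L1 h0) \<psi> k) \<longlonglongrightarrow> S"
  shows "diffusion_coefficient T \<nu> \<psi> = autocovariance (transfer_L1 T) (abs_L1 h0) \<psi> 0 + 2 * S"
proof -
  have [measurable]: "T \<in> measurable leb01 leb01" by (rule nonsingular_measurable[OF T])
  have sets: "sets \<nu> = sets leb01" unfolding \<nu> by simp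
  have TM: "T \<in> measurable \<nu> leb01" unfolding \<nu> by simp
  have h0m[measurable]: "h0 \<in> borel_measurable leb01" using h0(1) by simp
  have Tk[measurable]: "(T ^^ i) \<in> measurable leb01 leb01" for i
    by (induction i) (auto intro: measurable_compose)
  define c where "c k = autocovariance (transfer_L1 T) (abs_L1 h0) \<psi> k" for k
  have int_\<nu>: "(LINT x|\<nu>. g x) = (LINT x|leb01. h0 x * g x)" if "g \<in> borel_measurable leb01" for g :: "real \<Rightarrow> real"
    unfolding \<nu> using that h0(2) by (subst integral_real_density) auto
  have integrable_\<nu>: "integrable \<nu> g" if g: "g \<in> L_infinity" for g :: "real \<Rightarrow> real"
  proof -
    have "g \<in> borel_measurable leb01" using g by (simp add: L_infinity_def)
    then show ?thesis unfolding \<nu> using L_infinity_mult_integrable[OF h0(1) g] h0(2)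
      by (subst integrable_real_density) auto
  qed
  have \<psi>m[measurable]: "\<psi> \<in> borel_measurable leb01" using \<psi> by (simp add: L_infinity_def)
  define \<mu> where "\<mu> = (LINT x|\<nu>. \<psi> x)"
  have \<mu>: "\<mu> = (LINT t|leb01. \<psi> t * h0 t)" unfolding \<mu>_def by (simp add: int_\<nu> mult.commute)
  have \<mu>': "integral_L1 (mult_L1 \<psi> (abs_L1 h0)) = \<mu>"
    using L_infinity_mult_integrable_left[OF \<psi> h0(1)] by (simp add: mult_abs_L1[OF \<psi> h0(1)] integral_abs_L1 \<mu>)
  define \<phi> where "\<phi> x = \<psi> x - \<mu>" for x
  have \<phi>: "\<phi> \<in> L_infinity" unfolding \<phi>_def by (rule L_infinity_closed(1)[OF \<psi>])
  have [measurable]: "\<phi> \<in> borel_measurable leb01" using \<phi> by (simp add: L_infinity_def)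
  have \<phi>T: "(\<lambda>x. \<phi> ((T ^^ i) x)) \<in> L_infinity" for i
  proof (induction i)
    case (Suc i)
    then show ?case using L_infinity_compose_T[OF T Suc] by (simp add: funpow_swap1)
  qed (use \<phi> in simp)
  have invariance: "(LINT x|\<nu>. G ((T ^^ i) x)) = (LINT x|\<nu>. G x)" if G[measurable]: "G \<in> borel_measurable leb01" for G :: "real \<Rightarrow> real" and i
  proof (induction i)
    case (Suc i)
    have "(LINT x|\<nu>. G ((T ^^ Suc i) x)) = (LINT x|\<nu>. G ((T ^^ i) (T x)))" by (simp add: funpow_swap1)
    also have "\<dots> = (LINT x|distr \<nu> leb01 T. G ((T ^^ i) x))"
      by (rule integral_distr[symmetric, OF TM]) measurable
    also have "\<dots> = (LINT x|\<nu>. G x)" using Suc by (simp add: inv)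
    finally show ?case .
  qed simp
  have cov: "(LINT x|\<nu>. \<phi> ((T ^^ i) x) * \<phi> ((T ^^ (i + k)) x)) = c k" for i k
  proof -
    have "(LINT x|\<nu>. \<phi> ((T ^^ i) x) * \<phi> ((T ^^ (i + k)) x)) = (LINT x|\<nu>. (\<lambda>y. \<phi> y * \<phi> ((T ^^ k) y)) ((T ^^ i) x))"
      by (simp add: funpow_add add.commute[of i])
    also have "\<dots> = (LINT x|\<nu>. \<phi> x * \<phi> ((T ^^ k) x))" by (rule invariance) measurable
    also have "\<dots> = (LINT x|leb01. (\<phi> x * h0 x) * \<phi> ((T ^^ k) x))"
      by (subst int_\<nu>) (auto simp: mult_ac)
    also have "\<dots> = integral_L1 (mult_L1 \<phi> ((transfer_L1 T ^^ k) (abs_L1 (\<lambda>x. \<phi> x * h0 x))))"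
      by (rule transfer_iterate_duality[OF T L_infinity_mult_integrable_left[OF \<phi> h0(1)] \<phi>])
    also have "abs_L1 (\<lambda>x. \<phi> x * h0 x) = centered_L1 \<psi> (abs_L1 h0)"
      unfolding centered_abs_L1[OF \<psi> h0(1)] \<phi>_def \<mu> ..
    also have "integral_L1 (mult_L1 \<phi> ((transfer_L1 T ^^ k) (centered_L1 \<psi> (abs_L1 h0)))) = c k"
      unfolding c_def autocovariance_def \<mu>' integral_mult_L1[OF \<phi>]
      using centered_pairing[OF \<psi> integrable_rep_L1[of "(transfer_L1 T ^^ k) (centered_L1 \<psi> (abs_L1 h0))"], of \<mu>]
      by (simp add: \<phi>_def mult.commute)
    finally show ?thesis .
  qed
  have cov': "(LINT x|\<nu>. \<phi> ((T ^^ i) x) * \<phi> ((T ^^ j) x)) = (if i \<le> j then c (j - i) else c (i - j))" for i j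
    using cov[of i "j - i"] cov[of j "i - j"] by (auto simp: mult.commute)
  have "1 / real n * (LINT x|\<nu>. ((\<Sum>i<n. \<psi> ((T ^^ i) x)) - real n * (LINT y|\<nu>. \<psi> y))\<^sup>2) =
    1 / real n * (\<Sum>m<n. c 0 + 2 * (\<Sum>k=1..<Suc m. c k))" for n
  proof -
    have "(LINT x|\<nu>. ((\<Sum>i<n. \<psi> ((T ^^ i) x)) - real n * (LINT y|\<nu>. \<psi> y))\<^sup>2) =
      (LINT x|\<nu>. (\<Sum>i<n. \<Sum>j<n. \<phi> ((T ^^ i) x) * \<phi> ((T ^^ j) x)))"
    proof (rule Bochner_Integration.integral_cong[OF refl])
      fix x
      have "(\<Sum>i<n. \<psi> ((T ^^ i) x)) - real n * (LINT y|\<nu>. \<psi> y) = (\<Sum>i<n. \<phi> ((T ^^ i) x))"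
        by (simp add: \<phi>_def \<mu>_def sum_subtractf)
      then show "((\<Sum>i<n. \<psi> ((T ^^ i) x)) - real n * (LINT y|\<nu>. \<psi> y))\<^sup>2 = (\<Sum>i<n. \<Sum>j<n. \<phi> ((T ^^ i) x) * \<phi> ((T ^^ j) x))"
        by (simp add: power2_eq_square sum_product)
    qed
    also have "\<dots> = (\<Sum>i<n. \<Sum>j<n. LINT x|\<nu>. \<phi> ((T ^^ i) x) * \<phi> ((T ^^ j) x))"
      by (subst Bochner_Integration.integral_sum, intro Bochner_Integration.integrable_sum integrable_\<nu> L_infinity_closed(2) \<phi>T,
          intro sum.cong refl Bochner_Integration.integral_sum integrable_\<nu> L_infinity_closed(2) \<phi>T)
    also have "\<dots> = (\<Sum>m<n. c 0 + 2 * (\<Sum>k=1..<Suc m. c k))"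
      unfolding cov' by (rule double_sum_toeplitz)
    finally show ?thesis by simp
  qed
  moreover have "(\<lambda>n. 1 / real n * (\<Sum>m<n. c 0 + 2 * (\<Sum>k=1..<Suc m. c k))) \<longlonglongrightarrow> c 0 + 2 * S"
    using conv unfolding c_def[symmetric] by (intro Cesaro_mean_tendsto tendsto_intros)
  ultimately show ?thesis
    unfolding diffusion_coefficient_def c_def[symmetric] by (intro limI) (simp only:)
qed

lemma autocovariance_tendsto:
  assumes \<psi>: "\<psi> \<in> BV" and X: "X \<longlonglongrightarrow> h" and h: "h \<in> BV_L1"
    and iter: "\<And>Y y. y \<in> BV_L1 \<Longrightarrow> Y \<longlonglongrightarrow> y \<Longrightarrow> (\<lambda>k. (Q k ^^ i) (Y k)) \<longlonglongrightarrow> (P ^^ i) y"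
  shows "(\<lambda>k. autocovariance (Q k) (X k) \<psi> i) \<longlonglongrightarrow> autocovariance P h \<psi> i"
proof -
  note mult = bounded_linear.tendsto[OF bounded_linear_mult_L1[OF BV_subset_L_infinity[OF \<psi>]]]
  have \<mu>: "(\<lambda>k. integral_L1 (mult_L1 \<psi> (X k))) \<longlonglongrightarrow> integral_L1 (mult_L1 \<psi> h)"
    by (intro L1.tendsto_I mult X)
  have "(\<lambda>k. centered_L1 \<psi> (X k)) \<longlonglongrightarrow> centered_L1 \<psi> h"
    unfolding centered_L1_def by (intro tendsto_intros mult X \<mu>)
  moreover have "centered_L1 \<psi> h \<in> BV_L1"
    unfolding centered_L1_def by (intro L1.B_closed mult_L1_BV \<psi> h)
  ultimately have "(\<lambda>k. (Q k ^^ i) (centered_L1 \<psi> (X k))) \<longlonglongrightarrow> (P ^^ i) (centered_L1 \<psi> h)" by (rule iter[rotated])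
  then show ?thesis unfolding autocovariance_def by (intro tendsto_intros L1.tendsto_I mult \<mu>)
qed

section \<open>Approximation of the diffusion coefficient\<close>

theorem theorem2p3:
  fixes T \<psi> :: "real \<Rightarrow> real" and \<nu> :: "real measure"
    and \<eta> :: "real \<Rightarrow> real set set" and \<tau> :: real
  assumes "piecewise_C2_expanding T"
    and "Lasota_Yorke T"
    and "peripheral_spectrum_trivial T"
    and "acim T \<nu>"
    and "\<psi> \<in> BV"
    and "\<And>\<epsilon>. \<epsilon> > 0 \<Longrightarrow> interval_partition \<epsilon> (\<eta> \<epsilon>)"
    and "\<tau> > 0"
  shows "\<exists>(l::nat) (\<epsilon>::real) h. l > 0 \<and> \<epsilon> > 0 \<and> unique_ulam_density T (\<eta> \<epsilon>) h \<and>
    \<bar>ulam_diffusion T (\<eta> \<epsilon>) h \<psi> l - diffusion_coefficient T \<nu> \<psi>\<bar> \<le> \<tau>"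
proof -
  have T: "nonsingular T" by (rule piecewise_expanding_nonsingular[OF assms(1)])
  define P where "P = transfer_L1 T"
  obtain a b where P: "L1.LY_op a b P" using Lasota_Yorke_L1[OF T assms(2)] by (auto simp: P_def)
  have spec: "L1.peripherally_trivial P"
    unfolding P_def by (rule transfer_peripherally_trivial[OF T P[unfolded P_def] assms(3)])
  have \<psi>: "\<psi> \<in> L_infinity" by (rule BV_subset_L_infinity[OF assms(5)])
  obtain h where h: "h \<in> BV_L1" "P h = h" "integral_L1 h = 1"
    using L1.LY_fixed_point_exists[OF P one_BV_L1] by (auto simp: integral_abs_L1)
  obtain h0 where h0: "integrable leb01 h0" "\<And>x. 0 \<le> h0 x"
      "\<nu> = density leb01 (\<lambda>x. ennreal (h0 x))" "distr \<nu> leb01 T = \<nu>"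
      "P (abs_L1 h0) = abs_L1 h0" "integral_L1 (abs_L1 h0) = 1"
    using acim_density[OF T assms(4)] by (auto simp: P_def)
  have hh0: "abs_L1 h0 = h"
    by (rule invariant_L1_eq_BV_invariant[OF T P[unfolded P_def] spec[unfolded P_def]])
      (use h h0 in \<open>auto simp: P_def\<close>)
  define c where "c k = autocovariance P h \<psi> k" for k
  have y: "centered_L1 \<psi> h \<in> BV_L1" "integral_L1 (centered_L1 \<psi> h) = 0"
    unfolding centered_L1_def
    by (auto intro!: L1.B_closed mult_L1_BV assms(5) h simp: linear_diff[OF L1.linear_I] linear_scale[OF L1.linear_I] h(3))
  obtain K where K: "\<And>x. norm (mult_L1 \<psi> x) \<le> norm x * K"
    using bounded_linear.bounded[OF bounded_linear_mult_L1[OF \<psi>]] by blast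
  have "summable c"
  proof (rule summable_comparison_test')
    define \<mu> where "\<mu> = integral_L1 (mult_L1 \<psi> h)"
    show "summable (\<lambda>n. norm ((P ^^ n) (centered_L1 \<psi> h)) * (K + \<bar>\<mu>\<bar>))"
      by (intro summable_mult2 L1.iterates_summable[OF P spec y])
    show "norm (c n) \<le> norm ((P ^^ n) (centered_L1 \<psi> h)) * (K + \<bar>\<mu>\<bar>)" for n
    proof -
      let ?z = "(P ^^ n) (centered_L1 \<psi> h)"
      have "\<bar>integral_L1 (mult_L1 \<psi> ?z) - \<mu> * integral_L1 ?z\<bar> \<le> \<bar>integral_L1 (mult_L1 \<psi> ?z)\<bar> + \<bar>\<mu>\<bar> * \<bar>integral_L1 ?z\<bar>"
        by (metis abs_mult abs_triangle_ineq4)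
      also have "\<dots> \<le> norm ?z * K + \<bar>\<mu>\<bar> * norm ?z"
        by (intro add_mono mult_left_mono order_trans[OF L1.I_le K] L1.I_le) simp
      finally show ?thesis by (simp add: c_def autocovariance_def \<mu>_def algebra_simps)
    qed
  qed
  then have "summable (\<lambda>n. c (Suc n))" by (simp add: summable_Suc_iff)
  then obtain S where "(\<lambda>n. c (Suc n)) sums S" by (auto simp: summable_def)
  then have S: "(\<lambda>n. \<Sum>k=1..<Suc n. c k) \<longlonglongrightarrow> S"
  proof -
    have "(\<Sum>k=1..<Suc n. c k) = (\<Sum>i<n. c (Suc i))" for n by (induction n) simp_all
    then show ?thesis using \<open>(\<lambda>n. c (Suc n)) sums S\<close> by (simp only: sums_def)
  qed
  have diffusion: "diffusion_coefficient T \<nu> \<psi> = c 0 + 2 * S"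
    using diffusion_coefficient_eq_series[OF T h0(1-4) \<psi>] S by (simp add: hh0 c_def P_def)
  have "(\<lambda>n. c 0 + 2 * (\<Sum>k=1..<Suc n. c k)) \<longlonglongrightarrow> c 0 + 2 * S" by (intro tendsto_intros S)
  \<comment> \<open>The truncation is fixed here, before the mesh is chosen.\<close>
  then obtain l where "norm (c 0 + 2 * (\<Sum>k=1..<Suc l. c k) - (c 0 + 2 * S)) < \<tau> / 2"
    using LIMSEQ_D[of _ _ "\<tau> / 2"] assms(7) by (metis half_gt_zero order_refl)
  then have l: "\<bar>c 0 + 2 * (\<Sum>k=1..<Suc l. c k) - diffusion_coefficient T \<nu> \<psi>\<bar> < \<tau> / 2"
    by (simp add: diffusion)
  define \<epsilon> where "\<epsilon> k = inverse (real (Suc k))" for k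
  have \<epsilon>: "0 < \<epsilon> k" for k by (simp add: \<epsilon>_def)
  define Q where "Q k = ulam_L1 T (\<eta> (\<epsilon> k))" for k
  note \<eta> = assms(6)[OF \<epsilon>]
  have Q: "L1.LY_op a b (Q k)" for k
    unfolding Q_def by (rule ulam_L1_LY[OF T \<eta> P[unfolded P_def]])
  define \<kappa> where "\<kappa> k = \<epsilon> k * (2 + b)" for k
  have close: "norm (Q k x - P x) \<le> \<kappa> k * (Var_L1 x + norm x)" if "x \<in> BV_L1" for k x
    unfolding Q_def P_def \<kappa>_def
    using ulam_L1_close[OF T \<eta> P[unfolded P_def] that] \<epsilon>[of k] by simp
  have b: "0 \<le> b" using L1.LY_constants[OF P] by simp
  have \<kappa>0: "0 \<le> \<kappa> k" for k using \<epsilon>[of k] b by (simp add: \<kappa>_def)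
  have "\<epsilon> \<longlonglongrightarrow> 0" unfolding \<epsilon>_def by (rule LIMSEQ_inverse_real_of_nat)
  then have \<kappa>: "\<kappa> \<longlonglongrightarrow> 0" unfolding \<kappa>_def by (rule tendsto_mult_left_zero)
  note perturb = P Q close \<kappa>0 \<kappa>
  define fp where "fp k x \<longleftrightarrow> x \<in> BV_L1 \<and> Q k x = x \<and> integral_L1 x = 1 \<and> norm x \<le> norm h \<and>
    (\<forall>y\<in>BV_L1. Q k y = y \<longrightarrow> integral_L1 y = 1 \<longrightarrow> y = x)" for k x
  have ex: "\<forall>\<^sub>F k in sequentially. \<exists>x. fp k x"
    using L1.perturbed_unique_fixed_point[OF perturb spec h]
    by (rule eventually_mono) (auto simp: fp_def)
  define X where "X k = (SOME x. fp k x)" for k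
  have X: "\<forall>\<^sub>F k in sequentially. fp k (X k)"
    using ex by (rule eventually_mono) (auto simp: X_def intro: someI_ex)
  have Xh: "X \<longlonglongrightarrow> h"
    by (rule L1.perturbed_fixed_points_tendsto[OF perturb spec h, where D = "norm h"])
      (use X in \<open>auto simp: fp_def elim: eventually_mono\<close>)
  have cov: "(\<lambda>k. autocovariance (Q k) (X k) \<psi> i) \<longlonglongrightarrow> c i" for i
    unfolding c_def
    by (rule autocovariance_tendsto[OF assms(5) Xh h(1) L1.perturbed_iterates_tendsto[OF perturb]])
  have "(\<lambda>k. autocovariance (Q k) (X k) \<psi> 0 + 2 * (\<Sum>i=1..<Suc l. autocovariance (Q k) (X k) \<psi> i)) \<longlonglongrightarrow>
      c 0 + 2 * (\<Sum>i=1..<Suc l. c i)"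
    by (intro tendsto_intros cov)
  then have "\<forall>\<^sub>F k in sequentially. dist (autocovariance (Q k) (X k) \<psi> 0 + 2 * (\<Sum>i=1..<Suc l. autocovariance (Q k) (X k) \<psi> i))
      (c 0 + 2 * (\<Sum>i=1..<Suc l. c i)) < \<tau> / 2"
    by (rule tendstoD) (use assms(7) in simp)
  then have "\<forall>\<^sub>F k in sequentially. fp k (X k) \<and>
      dist (autocovariance (Q k) (X k) \<psi> 0 + 2 * (\<Sum>i=1..<Suc l. autocovariance (Q k) (X k) \<psi> i))
      (c 0 + 2 * (\<Sum>i=1..<Suc l. c i)) < \<tau> / 2"
    using X by eventually_elim simp
  then obtain k where k: "fp k (X k)" and near:
      "dist (autocovariance (Q k) (X k) \<psi> 0 + 2 * (\<Sum>i=1..<Suc l. autocovariance (Q k) (X k) \<psi> i))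
      (c 0 + 2 * (\<Sum>i=1..<Suc l. c i)) < \<tau> / 2"
    by (auto simp: eventually_sequentially)
  have "unique_ulam_density T (\<eta> (\<epsilon> k)) (rep_L1 (X k))"
    by (rule unique_ulam_density_rep_L1[OF T \<eta>]) (use k in \<open>auto simp: fp_def Q_def\<close>)
  moreover have "ulam_diffusion T (\<eta> (\<epsilon> k)) (rep_L1 (X k)) \<psi> (Suc l) =
      autocovariance (Q k) (X k) \<psi> 0 + 2 * (\<Sum>i=1..<Suc l. autocovariance (Q k) (X k) \<psi> i)"
    using ulam_diffusion_eq_autocovariances[OF T \<eta> \<psi> integrable_rep_L1[of "X k"]] by (simp add: Q_def)
  moreover from near l
  have "\<bar>autocovariance (Q k) (X k) \<psi> 0 + 2 * (\<Sum>i=1..<Suc l. autocovariance (Q k) (X k) \<psi> i)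
      - diffusion_coefficient T \<nu> \<psi>\<bar> \<le> \<tau>"
    unfolding dist_real_def by linarith
  ultimately show ?thesis
    using \<epsilon>[of k] by (intro exI[of _ "Suc l"] exI[of _ "\<epsilon> k"] exI[of _ "rep_L1 (X k)"]) (simp only: zero_less_Suc)
qed

end
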